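(* The ind-groups $\mathrm{U}(\mathrm{SL}_2/T)$ and $\mathrm{U}(\mathbb{A}^2/\mu_2)$ are not isomorphic as ind-groups.
   Context: The base field is $\mathbb{C}$. $T\subset \mathrm{SL}_2=\mathrm{SL}_2(\mathbb{C})$ is the standard (diagonal) one-dimensional torus, and $\mathrm{SL}_2/T$ is the corresponding quotient variety; it is isomorphic to the affine surface $\{(x,y,z)\in\mathbb{A}^3 \mid xy=z^2-z\}$. $\mathbb{A}^2/\mu_2$ is the quotient of $\mathbb{A}^2$ by the group $\mu_2=\{\xi\in\mathbb{C}^*\mid \xi^2=1\}$ acting by scalar multiplication. An ind-variety is a set $V$ with an ascending filtration $V_0\subset V_1\subset\cdots$ such that $V=\bigcup_k V_k$, each $V_k$ is an (affine) algebraic variety and each $V_k$ is Zariski closed in $V_{k+1}$. A morphism $\bigcup_k V_k\to\bigcup_l W_l$ is a map $\phi$ such that for each $k$ there is $l$ with $\phi(V_k)\subset W_l$ and $V_k\to W_l$ a morphism of varieties. A subset $S\subset V$ is closed if $S\cap V_k$ is closed in $V_k$ for all $k$; closed subsets are ind-varieties in a natural way. An ind-group is an ind-variety $G$ with a group structure such that $(g,h)\mapsto gh^{-1}$ is a morphism. An isomorphism of ind-groups is a group isomorphism which is an isomorphism of ind-varieties. For an affine variety $X$, the group $\mathrm{Aut}(X)$ of regular automorphisms has a natural structure of an ind-group: for a closed embedding $X\subset\mathbb{A}^n$, the endomorphisms of $X$ form a closed subset of $\mathcal{O}(X)^n$ filtered by degree, and $\mathrm{Aut}(X)$ is identified with the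 closed set of pairs $(f,g)$ of endomorphisms with $f\circ g=g\circ f=\mathrm{id}$. $\mathrm{U}(X)\subset\mathrm{Aut}(X)$ is the subgroup generated by all $\mathbb{C}^+$-actions on $X$ (algebraic actions of the additive group), equivalently by all closed one-dimensional unipotent subgroups. The subgroups $\mathrm{U}(\mathrm{SL}_2/T)\subset\mathrm{Aut}(\mathrm{SL}_2/T)$ and $\mathrm{U}(\mathbb{A}^2/\mu_2)\subset\mathrm{Aut}(\mathbb{A}^2/\mu_2)$ are closed and hence carry the induced structure of ind-groups. *)

theory Defs
  imports "HOL-Analysis.Analysis" "HOL-Algebra.Bij" "HOL-Algebra.Generated_Groups"
begin

text \<open>
  An affine variety over the complex numbers is given by its set of points together with its
  algebra of regular functions.  Regular functions are extensional: they are
  \<^const>\<open>undefined\<close> off the set of points, so that they are determined by their values there.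
\<close>

record 'a variety =
  points :: "'a set"
  regs :: "('a \<Rightarrow> complex) set"

text \<open>\<open>poly_fun S k f\<close>: \<open>f\<close> is a polynomial of degree at most \<open>k\<close> in the functions from \<open>S\<close>.\<close>

inductive poly_fun :: "('a \<Rightarrow> complex) set \<Rightarrow> nat \<Rightarrow> ('a \<Rightarrow> complex) \<Rightarrow> bool"
  for S :: "('a \<Rightarrow> complex) set" where
  const: "poly_fun S k (\<lambda>x. c)"
| gen: "f \<in> S \<Longrightarrow> poly_fun S (Suc k) f"
| add: "poly_fun S k f \<Longrightarrow> poly_fun S k g \<Longrightarrow> poly_fun S k (\<lambda>x. f x + g x)"
| mult: "poly_fun S k f \<Longrightarrow> poly_fun S l g \<Longrightarrow> poly_fun S (k + l) (\<lambda>x. f x * g x)"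

definition variety_gen :: "'a set \<Rightarrow> ('a \<Rightarrow> complex) set \<Rightarrow> 'a variety" where
  "variety_gen V S = \<lparr>points = V, regs = {restrict f V | f. \<exists>k. poly_fun S k f}\<rparr>"

definition coords :: "((complex^'n) \<Rightarrow> complex) set" where
  "coords = range (\<lambda>i x. x $ i)"

definition zariski_closed :: "(complex^'n) set \<Rightarrow> bool" where
  "zariski_closed X \<longleftrightarrow> (\<exists>F \<subseteq> {f. \<exists>k. poly_fun coords k f}. X = {x. \<forall>f\<in>F. f x = 0})"

definition affine_subvar :: "(complex^'n) set \<Rightarrow> (complex^'n) variety" where
  "affine_subvar X = variety_gen X coords"

definition affine_line :: "complex variety" where
  "affine_line = variety_gen UNIV {\<lambda>t. t}"

definition prod_variety :: "'a variety \<Rightarrow> 'b variety \<Rightarrow> ('a \<times> 'b) variety" where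
  "prod_variety V W = variety_gen (points V \<times> points W)
     ({\<lambda>p. f (fst p) | f. f \<in> regs V} \<union> {\<lambda>p. g (snd p) | g. g \<in> regs W})"

definition restrict_variety :: "'a variety \<Rightarrow> 'a set \<Rightarrow> 'a variety" where
  "restrict_variety V Z =
     \<lparr>points = points V \<inter> Z, regs = {restrict f (points V \<inter> Z) | f. f \<in> regs V}\<rparr>"

definition morphism :: "'a variety \<Rightarrow> 'b variety \<Rightarrow> ('a \<Rightarrow> 'b) \<Rightarrow> bool" where
  "morphism V W \<phi> \<longleftrightarrow>
     \<phi> \<in> points V \<rightarrow> points W \<and> (\<forall>h\<in>regs W. compose (points V) h \<phi> \<in> regs V)"

record 'a ind_group = "'a monoid" +
  stage :: "nat \<Rightarrow> 'a variety"

definition ind_morphism ::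
    "(nat \<Rightarrow> 'a variety) \<Rightarrow> (nat \<Rightarrow> 'b variety) \<Rightarrow> ('a \<Rightarrow> 'b) \<Rightarrow> bool" where
  "ind_morphism V W \<phi> \<longleftrightarrow> (\<forall>k. \<exists>l. morphism (V k) (W l) \<phi>)"

definition ind_group_isomorphic :: "'a ind_group \<Rightarrow> 'b ind_group \<Rightarrow> bool" where
  "ind_group_isomorphic G H \<longleftrightarrow>
     (\<exists>\<phi>\<in>iso G H. ind_morphism (stage G) (stage H) \<phi> \<and>
        ind_morphism (stage H) (stage G) (inv_into (carrier G) \<phi>))"

text \<open>
  Closedness of \<open>H\<close> is not needed to form the restricted stages; for a closed subgroup they are
  the induced structure of an ind-group.
\<close>

definition ind_subgroup :: "'a ind_group \<Rightarrow> 'a set \<Rightarrow> 'a ind_group" where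
  "ind_subgroup G H = G\<lparr>carrier := H, stage := (\<lambda>k. restrict_variety (stage G k) H)\<rparr>"

text \<open>
  \<open>poly_maps X k\<close> is the finite-dimensional vector space of all maps from \<open>X\<close> to affine
  \<open>n\<close>-space whose components are regular functions of degree at most \<open>k\<close>, i.e. the \<open>k\<close>-th member
  of the degree filtration of \<open>\<O>(X)\<^sup>n\<close>.  As a variety it is an affine space; its
  regular functions are the polynomials in its linear functionals.
\<close>

definition poly_maps :: "(complex^'n) set \<Rightarrow> nat \<Rightarrow> (complex^'n \<Rightarrow> complex^'n) set" where
  "poly_maps X k =
     {f \<in> extensional X. \<forall>i. \<exists>P. poly_fun coords k P \<and> (\<forall>p\<in>X. f p $ i = P p)}"

definition linear_functional ::
    "(complex^'n) set \<Rightarrow> nat \<Rightarrow> ((complex^'n \<Rightarrow> complex^'n) \<Rightarrow> complex) \<Rightarrow> bool" where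
  "linear_functional X k l \<longleftrightarrow>
     (\<forall>f\<in>poly_maps X k. \<forall>g\<in>poly_maps X k. l (\<lambda>p\<in>X. f p + g p) = l f + l g) \<and>
     (\<forall>c. \<forall>f\<in>poly_maps X k. l (\<lambda>p\<in>X. c *s f p) = c * l f)"

definition poly_maps_variety ::
    "(complex^'n) set \<Rightarrow> nat \<Rightarrow> (complex^'n \<Rightarrow> complex^'n) variety" where
  "poly_maps_variety X k = variety_gen (poly_maps X k) {l. linear_functional X k l}"

text \<open>
  An automorphism \<open>f\<close> is identified with the pair \<open>(f, f\<^sup>-\<^sup>1)\<close>; the \<open>k\<close>-th stage is
  the set of those pairs with both entries of degree at most \<open>k\<close>, with the regular functions
  that it inherits as a closed subset of \<open>poly_maps X k \<times> poly_maps X k\<close>.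
\<close>

definition aut_points :: "(complex^'n) set \<Rightarrow> nat \<Rightarrow> (complex^'n \<Rightarrow> complex^'n) set" where
  "aut_points X k = {f \<in> Bij X. f \<in> poly_maps X k \<and> inv\<^bsub>BijGroup X\<^esub> f \<in> poly_maps X k}"

definition aut_stage :: "(complex^'n) set \<Rightarrow> nat \<Rightarrow> (complex^'n \<Rightarrow> complex^'n) variety" where
  "aut_stage X k =
     \<lparr>points = aut_points X k,
      regs = {\<lambda>f\<in>aut_points X k. h (f, inv\<^bsub>BijGroup X\<^esub> f) | h.
                h \<in> regs (prod_variety (poly_maps_variety X k) (poly_maps_variety X k))}\<rparr>"

definition Aut :: "(complex^'n) set \<Rightarrow> (complex^'n \<Rightarrow> complex^'n) ind_group" where
  "Aut X = \<lparr>carrier = (\<Union>k. aut_points X k),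
            monoid.mult = monoid.mult (BijGroup X),
            one = one (BijGroup X),
            stage = aut_stage X\<rparr>"

definition additive_action ::
    "(complex^'n) set \<Rightarrow> (complex \<Rightarrow> complex^'n \<Rightarrow> complex^'n) \<Rightarrow> bool" where
  "additive_action X \<alpha> \<longleftrightarrow>
     morphism (prod_variety affine_line (affine_subvar X)) (affine_subvar X)
       (\<lambda>(t, p). \<alpha> t p) \<and>
     (\<forall>p\<in>X. \<alpha> 0 p = p) \<and> (\<forall>s t. \<forall>p\<in>X. \<alpha> (s + t) p = \<alpha> s (\<alpha> t p))"

definition U :: "(complex^'n) set \<Rightarrow> (complex^'n \<Rightarrow> complex^'n) ind_group" where
  "U X = ind_subgroup (Aut X)
     (generate (Aut X) {restrict (\<alpha> t) X | \<alpha> t. additive_action X \<alpha>})"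

text \<open>
  \<open>affine_quotient V G act X \<pi>\<close>: the closed subset \<open>X\<close> of affine space, together with
  \<open>\<pi>\<close>, is the quotient of the affine variety \<open>V\<close> by the action of the group \<open>G\<close>.  The fibres
  of \<open>\<pi>\<close> are the orbits, and the regular functions on \<open>X\<close> are the invariant ones on \<open>V\<close>.
  This determines \<open>X\<close> up to isomorphism; the surfaces in \<open>SL2_mod_T_exists\<close> and
  \<open>A2_mod_mu2_exists\<close> below are models of the two quotients.
\<close>

definition affine_quotient ::
    "'a variety \<Rightarrow> 'g set \<Rightarrow> ('g \<Rightarrow> 'a \<Rightarrow> 'a) \<Rightarrow> (complex^'n) set \<Rightarrow> ('a \<Rightarrow> complex^'n) \<Rightarrow> bool"
  where
  "affine_quotient V G act X \<pi> \<longleftrightarrow>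
     zariski_closed X \<and>
     \<pi> ` points V = X \<and>
     (\<forall>p\<in>points V. \<forall>q\<in>points V. \<pi> p = \<pi> q \<longleftrightarrow> (\<exists>g\<in>G. q = act g p)) \<and>
     {compose (points V) h \<pi> | h. h \<in> regs (affine_subvar X)} =
       {f \<in> regs V. \<forall>g\<in>G. \<forall>p\<in>points V. f (act g p) = f p}"

definition SL2 :: "(complex^2^2) variety" where
  "SL2 = variety_gen {A. det A = 1} {\<lambda>A. A $ i $ j | i j. True}"

definition torus :: "(complex^2^2) set" where
  "torus = {A. det A = 1 \<and> A $ 1 $ 2 = 0 \<and> A $ 2 $ 1 = 0}"

definition affine_plane :: "(complex^2) variety" where
  "affine_plane = affine_subvar UNIV"

definition mu2 :: "complex set" where
  "mu2 = {\<xi>. \<xi> \<noteq> 0 \<and> \<xi>\<^sup>2 = 1}"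

definition is_SL2_mod_T :: "(complex^'n) set \<Rightarrow> bool" where
  "is_SL2_mod_T X \<longleftrightarrow> (\<exists>\<pi>. affine_quotient SL2 torus (\<lambda>t A. A ** t) X \<pi>)"

definition is_A2_mod_mu2 :: "(complex^'n) set \<Rightarrow> bool" where
  "is_A2_mod_mu2 Y \<longleftrightarrow> (\<exists>\<pi>. affine_quotient affine_plane mu2 (\<lambda>\<xi> v. \<xi> *s v) Y \<pi>)"

inductive mono_fun :: "('a \<Rightarrow> complex) set \<Rightarrow> nat \<Rightarrow> ('a \<Rightarrow> complex) \<Rightarrow> bool"
  for S :: "('a \<Rightarrow> complex) set" where
  mono_one: "mono_fun S n (\<lambda>x. 1)"
| mono_step: "f \<in> S \<Longrightarrow> mono_fun S n m \<Longrightarrow> mono_fun S (Suc n) (\<lambda>x. f x * m x)"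

inductive mono_span :: "('a \<Rightarrow> complex) set \<Rightarrow> nat \<Rightarrow> ('a \<Rightarrow> complex) \<Rightarrow> bool"
  for S :: "('a \<Rightarrow> complex) set" and n :: nat where
  span_zero: "mono_span S n (\<lambda>x. 0)"
| span_add: "mono_fun S n m \<Longrightarrow> mono_span S n f \<Longrightarrow> mono_span S n (\<lambda>x. c * m x + f x)"

lemma mono_mult: "mono_fun S k m \<Longrightarrow> mono_fun S l m' \<Longrightarrow> mono_fun S (k + l) (\<lambda>x. m x * m' x)"
proof (induction rule: mono_fun.induct)
  case (mono_one n)
  from this show ?case
    by (induction arbitrary: n rule: mono_fun.induct)
      (auto intro: mono_fun.intros mono_fun.mono_step[of _ S, where n = "_ + _", simplified])
next
  case (mono_step f n m)
  then have "mono_fun S (n + l) (\<lambda>x. m x * m' x)" by blast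
  from mono_fun.mono_step[OF mono_step(1) this] show ?case by (simp add: mult.assoc)
qed

lemma span_sum: "mono_span S n f \<Longrightarrow> mono_span S n g \<Longrightarrow> mono_span S n (\<lambda>x. f x + g x)"
  by (induction rule: mono_span.induct) (auto simp: add.assoc intro: mono_span.intros)

lemma span_mono_mult:
  "mono_span S l g \<Longrightarrow> mono_fun S k m \<Longrightarrow> mono_span S (k + l) (\<lambda>x. c * m x * g x)"
proof (induction rule: mono_span.induct)
  case span_zero
  then show ?case by (simp add: mono_span.span_zero)
next
  case (span_add m' f d)
  from mono_span.span_add[OF mono_mult[OF span_add(4) span_add(1)] span_add(3)[OF span_add(4)], of "c * d"]
  show ?case by (simp add: algebra_simps)
qed

lemma span_mult:
  "mono_span S k f \<Longrightarrow> mono_span S l g \<Longrightarrow> mono_span S (k + l) (\<lambda>x. f x * g x)"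
proof (induction rule: mono_span.induct)
  case span_zero
  then show ?case by (simp add: mono_span.span_zero)
next
  case (span_add m f c)
  from span_sum[OF span_mono_mult[OF span_add(4) span_add(1), of c] span_add(3)[OF span_add(4)]]
  show ?case by (simp add: algebra_simps)
qed

lemma poly_fun_span: "poly_fun S k f \<Longrightarrow> mono_span S k f"
proof (induction rule: poly_fun.induct)
  case (const k c)
  show ?case using span_add[OF mono_one span_zero, of S k c] by simp
next
  case (gen f k)
  show ?case using span_add[OF mono_step[OF gen mono_one] span_zero, of k 1] by simp
qed (auto intro: span_sum span_mult)

lemma poly_fun_mono: "poly_fun S k f \<Longrightarrow> k \<le> l \<Longrightarrow> poly_fun S l f"
  using poly_fun.mult[OF poly_fun.const[of S "l - k" 1]] by fastforce

definition is_poly :: "('a \<Rightarrow> complex) set \<Rightarrow> ('a \<Rightarrow> complex) \<Rightarrow> bool" where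
  "is_poly S f \<longleftrightarrow> (\<exists>k. poly_fun S k f)"

lemma is_poly_const [simp, intro]: "is_poly S (\<lambda>x. c)"
  and is_poly_gen: "f \<in> S \<Longrightarrow> is_poly S f"
  unfolding is_poly_def by (blast intro: poly_fun.intros)+

lemma is_poly_add [intro]: "is_poly S f \<Longrightarrow> is_poly S g \<Longrightarrow> is_poly S (\<lambda>x. f x + g x)"
proof -
  assume "is_poly S f" "is_poly S g"
  then obtain k l where "poly_fun S k f" "poly_fun S l g" by (auto simp: is_poly_def)
  then have "poly_fun S (max k l) f" "poly_fun S (max k l) g"
    by (auto intro: poly_fun_mono)
  from poly_fun.add[OF this] show ?thesis by (auto simp: is_poly_def)
qed

lemma is_poly_mult [intro]: "is_poly S f \<Longrightarrow> is_poly S g \<Longrightarrow> is_poly S (\<lambda>x. f x * g x)"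
  unfolding is_poly_def by (elim exE, rule exI, rule poly_fun.mult)

lemma is_poly_diff [intro]: "is_poly S f \<Longrightarrow> is_poly S g \<Longrightarrow> is_poly S (\<lambda>x. f x - g x)"
  using is_poly_add[OF _ is_poly_mult[OF is_poly_const[of S "-1"]], of f g] by simp

lemma is_poly_power [intro]: "is_poly S f \<Longrightarrow> is_poly S (\<lambda>x. f x ^ n)"
  by (induction n) (auto intro: is_poly_mult)

lemma is_poly_coord [simp, intro]: "is_poly coords (\<lambda>v. v $ i)"
  by (rule is_poly_gen) (auto simp: coords_def)

lemmas is_poly_intros =
  is_poly_diff is_poly_add is_poly_mult is_poly_power is_poly_coord is_poly_const

lemma is_poly_comp:
  assumes "is_poly S f" and "\<And>s. s \<in> S \<Longrightarrow> is_poly R (\<lambda>x. s (\<phi> x))"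
  shows "is_poly R (\<lambda>x. f (\<phi> x))"
proof -
  obtain k where "poly_fun S k f" using assms(1) by (auto simp: is_poly_def)
  then show ?thesis by induction (use assms(2) in auto)
qed

lemma zariski_closed_eq:
  assumes "is_poly coords f" shows "zariski_closed {v. f v = 0}"
  unfolding zariski_closed_def by (rule exI[of _ "{f}"]) (use assms in \<open>auto simp: is_poly_def\<close>)

lemma regs_variety_gen: "regs (variety_gen V S) = {restrict f V | f. is_poly S f}"
  by (simp add: variety_gen_def is_poly_def)

lemma points_variety_gen [simp]: "points (variety_gen V S) = V"
  by (simp add: variety_gen_def)

text \<open>A sufficient criterion: every polynomial averages to a polynomial in the components of \<open>\<pi>\<close>.\<close>

lemma affine_quotientI:
  fixes X :: "(complex^'n) set"
  assumes closed: "zariski_closed X" and surj: "\<pi> ` V = X"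
    and inj: "\<And>p q. p \<in> V \<Longrightarrow> q \<in> V \<Longrightarrow> \<pi> p = \<pi> q \<longleftrightarrow> (\<exists>g\<in>G. q = act g p)"
    and act: "\<And>g p. g \<in> G \<Longrightarrow> p \<in> V \<Longrightarrow> act g p \<in> V"
    and poly: "\<And>i. is_poly S (\<lambda>p. \<pi> p $ i)"
    and average: "\<And>k. \<exists>N>0. \<exists>t. (\<forall>j<N. t j \<in> G) \<and>
      (\<forall>m. mono_fun S k m \<longrightarrow> (\<exists>h. is_poly coords h \<and>
         (\<forall>p\<in>V. (\<Sum>j<N. m (act (t j) p)) = of_nat N * h (\<pi> p))))"
  shows "affine_quotient (variety_gen V S) G act X \<pi>"
proof -
  have "compose V h \<pi> \<in> regs (variety_gen V S) \<and> (\<forall>g\<in>G. \<forall>p\<in>V. compose V h \<pi> (act g p) = compose V h \<pi> p)"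
    if h: "h \<in> regs (affine_subvar X)" for h
  proof
    obtain H where H: "h = restrict H X" "is_poly coords H"
      using h unfolding affine_subvar_def regs_variety_gen by blast
    have "is_poly S (\<lambda>p. H (\<pi> p))"
      by (rule is_poly_comp[OF H(2)]) (use poly in \<open>auto simp: coords_def\<close>)
    moreover have "compose V h \<pi> = restrict (\<lambda>p. H (\<pi> p)) V"
      using surj by (auto simp: compose_def H(1) intro!: restrict_ext)
    ultimately show "compose V h \<pi> \<in> regs (variety_gen V S)"
      by (auto simp: regs_variety_gen)
    show "\<forall>g\<in>G. \<forall>p\<in>V. compose V h \<pi> (act g p) = compose V h \<pi> p"
      using inj act by (metis compose_eq)
  qed
  moreover have "\<exists>h. f = compose V h \<pi> \<and> h \<in> regs (affine_subvar X)"
    if f: "f \<in> regs (variety_gen V S)" and invar: "\<forall>g\<in>G. \<forall>p\<in>V. f (act g p) = f p" for f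
  proof -
    obtain F k where F: "f = restrict F V" "poly_fun S k F"
      using f by (auto simp: regs_variety_gen is_poly_def)
    obtain N t where N: "N > 0" "\<forall>j<N. t j \<in> G" and
      m: "\<And>m. mono_fun S k m \<Longrightarrow> \<exists>h. is_poly coords h \<and>
         (\<forall>p\<in>V. (\<Sum>j<N. m (act (t j) p)) = of_nat N * h (\<pi> p))"
      using average[of k] by metis
    have "mono_span S k F" using F(2) by (rule poly_fun_span)
    then have "\<exists>h. is_poly coords h \<and> (\<forall>p\<in>V. (\<Sum>j<N. F (act (t j) p)) = of_nat N * h (\<pi> p))"
    proof induction
      case span_zero
      show ?case by (rule exI[of _ "\<lambda>_. 0"]) auto
    next
      case (span_add m f c)
      obtain h where h: "is_poly coords h" 
         "\<forall>p\<in>V. (\<Sum>j<N. f (act (t j) p)) = of_nat N * h (\<pi> p)" using span_add by blast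
      obtain h' where h': "is_poly coords h'" 
         "\<forall>p\<in>V. (\<Sum>j<N. m (act (t j) p)) = of_nat N * h' (\<pi> p)" using m[OF span_add(1)] by blast
      have "is_poly coords (\<lambda>v. c * h' v + h v)" by (intro is_poly_intros h(1) h'(1))
      then show ?case
        by (intro exI[of _ "\<lambda>v. c * h' v + h v"] conjI)
          (use h h' in \<open>auto simp: sum.distrib sum_distrib_left[symmetric] algebra_simps\<close>)
    qed
    then obtain h where h: "is_poly coords h"
      "\<And>p. p \<in> V \<Longrightarrow> (\<Sum>j<N. F (act (t j) p)) = of_nat N * h (\<pi> p)" by blast
    have "F p = h (\<pi> p)" if p: "p \<in> V" for p
    proof -
      have "F (act (t j) p) = F p" if "j < N" for j
        using invar N(2) that p act by (auto simp: F(1))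
      then have "of_nat N * F p = of_nat N * h (\<pi> p)" using h(2)[OF p] by simp
      then show ?thesis using N(1) by simp
    qed
    then have "f = compose V (restrict h X) \<pi>"
      using surj by (auto simp: F(1) compose_def intro!: restrict_ext)
    then show ?thesis using h(1) by (auto simp: affine_subvar_def regs_variety_gen)
  qed
  ultimately have "{compose V h \<pi> |h. h \<in> regs (affine_subvar X)} =
    {f \<in> regs (variety_gen V S). \<forall>g\<in>G. \<forall>p\<in>V. f (act g p) = f p}"
    by blast
  then show ?thesis using closed surj inj by (simp add: affine_quotient_def)
qed

lemma A2_mod_mu2_exists: "is_A2_mod_mu2 {v :: complex^3. v $ 1 * v $ 3 = (v $ 2)\<^sup>2}"
proof -
  let ?X = "{v :: complex^3. v $ 1 * v $ 3 = (v $ 2)\<^sup>2}"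
  define \<pi> :: "complex^2 \<Rightarrow> complex^3" where
    "\<pi> p = vector [(p $ 1)\<^sup>2, p $ 1 * p $ 2, (p $ 2)\<^sup>2]" for p
  have \<pi>: "\<pi> p $ 1 = (p $ 1)\<^sup>2" "\<pi> p $ 2 = p $ 1 * p $ 2" "\<pi> p $ 3 = (p $ 2)\<^sup>2" for p
    by (simp_all add: \<pi>_def)
  have mu2: "mu2 = {1, -1}" by (auto simp: mu2_def power2_eq_1_iff)
  have "zariski_closed {v :: complex^3. v $ 1 * v $ 3 - (v $ 2)\<^sup>2 = 0}"
    by (rule zariski_closed_eq) (intro is_poly_intros)
  then have closed: "zariski_closed ?X" by simp
  have surj: "\<pi> ` UNIV = ?X"
  proof (intro equalityI subsetI)
    fix v assume v: "v \<in> ?X"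
    define a where "a = csqrt (v $ 1)"
    define b where "b = (if a = 0 then csqrt (v $ 3) else v $ 2 / a)"
    have a: "a\<^sup>2 = v $ 1" by (simp add: a_def)
    have "a * b = v $ 2 \<and> b\<^sup>2 = v $ 3"
    proof (cases "a = 0")
      case True
      then have "v $ 1 = 0" using a by simp
      then show ?thesis using True v by (simp add: b_def)
    next
      case False
      then have "v $ 1 \<noteq> 0" using a by auto
      then have "v $ 3 = (v $ 2)\<^sup>2 / v $ 1" using v by (simp add: field_simps)
      then show ?thesis using False by (simp add: b_def power_divide a)
    qed
    then have "\<pi> (vector [a, b]) = v" by (simp add: vec_eq_iff forall_3 \<pi> a)
    then show "v \<in> range \<pi>" by (metis rangeI)
  qed (auto simp: \<pi> power_mult_distrib)
  have inj: "\<pi> p = \<pi> q \<longleftrightarrow> (\<exists>g\<in>mu2. q = g *s p)" for p q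
  proof
    assume "\<pi> p = \<pi> q"
    then have "(q$1)\<^sup>2 = (p$1)\<^sup>2" "(q$2)\<^sup>2 = (p$2)\<^sup>2" "p$1 * p$2 = q$1 * q$2"
      by (metis \<pi>)+
    then have "(q$1 = p$1 \<and> q$2 = p$2) \<or> (q$1 = - p$1 \<and> q$2 = - p$2)"
      by (auto simp: power2_eq_iff)
    then show "\<exists>g\<in>mu2. q = g *s p" by (auto simp: mu2 vec_eq_iff forall_2)
  qed (auto simp: mu2 vec_eq_iff forall_3 \<pi>)
  have mono: "\<exists>i j. m = (\<lambda>p. p $ 1 ^ i * p $ 2 ^ j)" if "mono_fun coords k m"
    for k and m :: "complex^2 \<Rightarrow> complex"
    using that
  proof induction
    case (mono_one n)
    show ?case by (rule exI[of _ 0], rule exI[of _ 0]) simp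
  next
    case (mono_step f n m)
    then obtain i j l where m: "m = (\<lambda>p. p $ 1 ^ i * p $ 2 ^ j)" and f: "f = (\<lambda>p. p $ l)"
      by (auto simp: coords_def)
    have "l = 1 \<or> l = 2" by (rule exhaust_2)
    then show ?case
      using exI[of _ "Suc i"] exI[of _ j] exI[of _ "Suc j"] exI[of _ i]
      by (elim disjE)
        ((rule exI[of _ "Suc i"], rule exI[of _ j], simp add: m f mult_ac; fail) |
         (rule exI[of _ i], rule exI[of _ "Suc j"], simp add: m f mult_ac; fail))+
  qed
  have even: "\<exists>h. is_poly coords h \<and> (\<forall>p. p $ 1 ^ i * p $ 2 ^ j = h (\<pi> p))"
    if "even (i + j)" for i j :: nat
  proof (cases "even i")
    case True
    with that obtain r s where rs: "i = 2 * r" "j = 2 * s" by (metis dvdE even_add)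
    show ?thesis
      by (rule exI[of _ "\<lambda>v. v $ 1 ^ r * v $ 3 ^ s"], intro conjI is_poly_intros)
        (simp add: \<pi> rs power_mult power_mult_distrib)
  next
    case False
    with that obtain r s where rs: "i = 2 * r + 1" "j = 2 * s + 1"
      by (metis even_add oddE)
    show ?thesis
      by (rule exI[of _ "\<lambda>v. v $ 1 ^ r * v $ 3 ^ s * v $ 2"], intro conjI is_poly_intros)
        (simp add: \<pi> rs power_mult power_mult_distrib)
  qed
  have "affine_quotient affine_plane mu2 (\<lambda>\<xi> v. \<xi> *s v) ?X \<pi>"
    unfolding affine_plane_def affine_subvar_def
  proof (rule affine_quotientI[OF closed surj inj])
    show "is_poly coords (\<lambda>p. \<pi> p $ i)" for i
      using exhaust_3[of i] by (elim disjE; simp only: \<pi>; intro is_poly_intros)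
    fix k
    define t where "t j = (if j = 0 then 1 else - 1 :: complex)" for j :: nat
    have "\<exists>h. is_poly coords h \<and> (\<forall>p\<in>UNIV. (\<Sum>j<2. m (t j *s p)) = of_nat 2 * h (\<pi> p))"
      if m': "mono_fun coords k m" for m
    proof -
      obtain i j where m: "m = (\<lambda>p. p $ 1 ^ i * p $ 2 ^ j)" using mono[OF m'] by blast
      have sum: "(\<Sum>j<2. m (t j *s p)) = (1 + (- 1) ^ (i + j)) * (p $ 1 ^ i * p $ 2 ^ j)" for p
        by (simp add: m t_def numeral_2_eq_2 power_minus[of "p $ _"] power_add algebra_simps)
      show ?thesis
      proof (cases "even (i + j)")
        case True
        obtain h where "is_poly coords h" "\<forall>p. p $ 1 ^ i * p $ 2 ^ j = h (\<pi> p)"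
          using even[OF True] by blast
        then show ?thesis using True by (auto simp: sum)
      next
        case False
        then show ?thesis by (intro exI[of _ "\<lambda>_. 0"]) (auto simp: sum)
      qed
    qed
    then show "\<exists>N>0. \<exists>t. (\<forall>j<N. t j \<in> mu2) \<and> (\<forall>m. mono_fun coords k m \<longrightarrow>
       (\<exists>h. is_poly coords h \<and> (\<forall>p\<in>UNIV. (\<Sum>j<N. m (t j *s p)) = of_nat N * h (\<pi> p))))"
      by (intro exI[of _ 2] conjI exI[of _ t]) (auto simp: t_def mu2)
  qed auto
  then show ?thesis unfolding is_A2_mod_mu2_def by blast
qed

lemma SL2_mod_T_exists: "is_SL2_mod_T {v :: complex^3. v $ 1 * v $ 2 = (v $ 3)\<^sup>2 - v $ 3}"
proof -
  let ?X = "{v :: complex^3. v $ 1 * v $ 2 = (v $ 3)\<^sup>2 - v $ 3}"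
  let ?V = "{A :: complex^2^2. det A = 1}"
  let ?S = "{\<lambda>A :: complex^2^2. A $ i $ j | i j. True}"
  define \<pi> :: "complex^2^2 \<Rightarrow> complex^3" where
    "\<pi> A = vector [A$1$1 * A$1$2, A$2$1 * A$2$2, A$1$1 * A$2$2]" for A
  have \<pi>: "\<pi> A $ 1 = A$1$1 * A$1$2" "\<pi> A $ 2 = A$2$1 * A$2$2" "\<pi> A $ 3 = A$1$1 * A$2$2" for A
    by (simp_all add: \<pi>_def)
  have bc: "A$1$2 * A$2$1 = \<pi> A $ 3 - 1" if "A \<in> ?V" for A
    using that by (simp add: \<pi> det_2 algebra_simps)
  have V: "A \<in> ?V \<longleftrightarrow> A$1$1 * A$2$2 = 1 + A$1$2 * A$2$1" for A
    by (simp add: det_2 algebra_simps)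
  have act: "(A ** t) $ i $ 1 = A $ i $ 1 * t $ 1 $ 1" "(A ** t) $ i $ 2 = A $ i $ 2 * t $ 2 $ 2"
    "t $ 1 $ 1 * t $ 2 $ 2 = 1"
    if "t \<in> torus" for A t :: "complex^2^2" and i
    using that by (auto simp: torus_def matrix_matrix_mult_def sum_2 det_2)
  define D :: "complex \<Rightarrow> complex^2^2" where "D s = vector [vector [s, 0], vector [0, inverse s]]" for s
  have D: "D s \<in> torus" if "s \<noteq> 0" for s
    using that by (simp add: D_def torus_def det_2)
  have actD: "(A ** D s) $ i $ 1 = A $ i $ 1 * s" "(A ** D s) $ i $ 2 = A $ i $ 2 * inverse s" for A s i
    by (simp_all add: D_def matrix_matrix_mult_def sum_2)
  have "zariski_closed {v :: complex^3. v $ 1 * v $ 2 - ((v $ 3)\<^sup>2 - v $ 3) = 0}"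
    by (rule zariski_closed_eq) (intro is_poly_intros)
  then have closed: "zariski_closed ?X" by simp
  have surj: "\<pi> ` ?V = ?X"
  proof (intro equalityI subsetI)
    fix v assume "v \<in> \<pi> ` ?V"
    then obtain A where A: "A \<in> ?V" "v = \<pi> A" by blast
    have "v$1 * v$2 = v$3 * (A$1$2 * A$2$1)" by (simp add: A(2) \<pi>)
    also have "\<dots> = v$3 * (v$3 - 1)" using bc[OF A(1)] by (simp add: A(2))
    finally show "v \<in> ?X" by (simp add: power2_eq_square algebra_simps)
  next
    fix v assume "v \<in> ?X"
    then have v: "v$1 * v$2 = v$3 * (v$3 - 1)" by (simp add: power2_eq_square algebra_simps)
    define mk where "mk a b c d = (vector [vector [a, b], vector [c, d]] :: complex^2^2)" for a b c d
    have mk: "mk a b c d $ 1 $ 1 = a" "mk a b c d $ 1 $ 2 = b" "mk a b c d $ 2 $ 1 = c" "mk a b c d $ 2 $ 2 = d"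
      for a b c d by (simp_all add: mk_def)
    have "\<exists>a b c d. a * b = v$1 \<and> c * d = v$2 \<and> a * d = v$3 \<and> a * d = 1 + b * c"
    proof (cases "v$3 = 0")
      case True
      show ?thesis
      proof (cases "v$1 = 0")
        case True
        show ?thesis using \<open>v$3 = 0\<close> \<open>v$1 = 0\<close>
          by (intro exI[of _ 0] exI[of _ 1] exI[of _ "-1"] exI[of _ "- v$2"]) auto
      next
        case False
        then have "v$2 = 0" using v True by simp
        then show ?thesis using False True
          by (intro exI[of _ "v$1"] exI[of _ 1] exI[of _ "-1"] exI[of _ 0]) auto
      qed
    next
      case False
      then show ?thesis using v
        by (intro exI[of _ 1] exI[of _ "v$1"] exI[of _ "v$2 / v$3"] exI[of _ "v$3"])
          (auto simp: field_simps)
    qed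
    then obtain a b c d where e: "a * b = v$1" "c * d = v$2" "a * d = v$3" "a * d = 1 + b * c" by blast
    have "mk a b c d \<in> ?V" using e(4) by (simp add: V mk del: mem_Collect_eq)
    moreover have "\<pi> (mk a b c d) = v" by (simp add: vec_eq_iff forall_3 \<pi> mk e)
    ultimately show "v \<in> \<pi> ` ?V" by (metis imageI)
  qed
  have inj: "\<pi> A = \<pi> B \<longleftrightarrow> (\<exists>t\<in>torus. B = A ** t)" if AB: "A \<in> ?V" "B \<in> ?V" for A B
  proof
    assume eq: "\<pi> A = \<pi> B"
    have e: "A$1$1 * A$1$2 = B$1$1 * B$1$2" "A$2$1 * A$2$2 = B$2$1 * B$2$2"
      "A$1$1 * A$2$2 = B$1$1 * B$2$2" using eq by (metis \<pi>)+
    have e': "A$1$2 * A$2$1 = B$1$2 * B$2$1" using bc AB eq by simp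
    have d: "A$1$1 * A$2$2 = 1 + A$1$2 * A$2$1" "B$1$1 * B$2$2 = 1 + B$1$2 * B$2$1"
      using AB V by blast+
    define s where "s = A$2$2 * B$1$1 - A$1$2 * B$2$1"
    define r where "r = A$1$1 * B$2$2 - A$2$1 * B$1$2"
    have B: "B$1$1 = A$1$1 * s" "B$2$1 = A$2$1 * s" "B$1$2 = A$1$2 * r" "B$2$2 = A$2$2 * r"
      unfolding s_def r_def using e e' d by algebra+
    have "s * r = 1" unfolding s_def r_def using e e' d by algebra
    then have s: "s \<noteq> 0" "r = inverse s" by (auto simp: inverse_unique)
    have "B = A ** D s" by (simp add: vec_eq_iff forall_2 actD B s(2))
    then show "\<exists>t\<in>torus. B = A ** t" using D[OF s(1)] by blast
  next
    assume "\<exists>t\<in>torus. B = A ** t"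
    then obtain t where t: "t \<in> torus" "B = A ** t" by blast
    have "x * t$1$1 * (y * t$2$2) = x * y" for x y using act(3)[OF t(1)] by algebra
    then show "\<pi> A = \<pi> B" by (simp add: vec_eq_iff forall_3 \<pi> t(2) act(1,2)[OF t(1)])
  qed
  have mono: "\<exists>i j k l. i + j + k + l \<le> n \<and> m = (\<lambda>A. A$1$1 ^ i * A$1$2 ^ j * A$2$1 ^ k * A$2$2 ^ l)"
    if "mono_fun ?S n m" for n m
    using that
  proof induction
    case (mono_one n)
    show ?case by (intro exI[of _ 0]) simp
  next
    case (mono_step f n m)
    then obtain i j k l x y where m: "m = (\<lambda>A. A$1$1 ^ i * A$1$2 ^ j * A$2$1 ^ k * A$2$2 ^ l)"
      and n: "i + j + k + l \<le> n" and f: "f = (\<lambda>A. A $ x $ y)"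
      by auto
    consider "x = 1" "y = 1" | "x = 1" "y = 2" | "x = 2" "y = 1" | "x = 2" "y = 2"
      using exhaust_2[of x] exhaust_2[of y] by blast
    then show ?case
    proof cases
      case 1 show ?thesis
        by (rule exI[of _ "Suc i"], rule exI[of _ j], rule exI[of _ k], rule exI[of _ l])
          (use n in \<open>simp add: m f 1 mult_ac\<close>)
    next
      case 2 show ?thesis
        by (rule exI[of _ i], rule exI[of _ "Suc j"], rule exI[of _ k], rule exI[of _ l])
          (use n in \<open>simp add: m f 2 mult_ac\<close>)
    next
      case 3 show ?thesis
        by (rule exI[of _ i], rule exI[of _ j], rule exI[of _ "Suc k"], rule exI[of _ l])
          (use n in \<open>simp add: m f 3 mult_ac\<close>)
    next
      case 4 show ?thesis
        by (rule exI[of _ i], rule exI[of _ j], rule exI[of _ k], rule exI[of _ "Suc l"])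
          (use n in \<open>simp add: m f 4 mult_ac\<close>)
    qed
  qed
  have weight0: "\<exists>h. is_poly coords h \<and>
      (\<forall>A\<in>?V. A$1$1 ^ i * A$1$2 ^ j * A$2$1 ^ k * A$2$2 ^ l = h (\<pi> A))"
    if "i + k = j + l" for i j k l :: nat
    using that
  proof (induction "i + k" arbitrary: i j k l)
    case 0
    then show ?case by (intro exI[of _ "\<lambda>_. 1"]) auto
  next
    case (Suc n)
    consider i' j' where "i = Suc i'" "j = Suc j'" | i' l' where "i = Suc i'" "l = Suc l'"
      | k' j' where "k = Suc k'" "j = Suc j'" | k' l' where "k = Suc k'" "l = Suc l'"
      using Suc(2,3) by (metis add_is_0 not0_implies_Suc nat.distinct(1))
    then show ?case
    proof cases
      case 1
      obtain h where "is_poly coords h"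
        "\<forall>A\<in>?V. A$1$1 ^ i' * A$1$2 ^ j' * A$2$1 ^ k * A$2$2 ^ l = h (\<pi> A)"
        using Suc(1)[of i' k j' l] Suc(2,3) 1 by auto
      then show ?thesis
        by (intro exI[of _ "\<lambda>v. v$1 * h v"]) (auto simp: 1 \<pi> mult_ac dest!: bspec)
    next
      case 2
      obtain h where "is_poly coords h"
        "\<forall>A\<in>?V. A$1$1 ^ i' * A$1$2 ^ j * A$2$1 ^ k * A$2$2 ^ l' = h (\<pi> A)"
        using Suc(1)[of i' k j l'] Suc(2,3) 2 by auto
      then show ?thesis
        by (intro exI[of _ "\<lambda>v. v$3 * h v"]) (auto simp: 2 \<pi> mult_ac dest!: bspec)
    next
      case 3
      obtain h where h: "is_poly coords h"
        "\<forall>A\<in>?V. A$1$1 ^ i * A$1$2 ^ j' * A$2$1 ^ k' * A$2$2 ^ l = h (\<pi> A)"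
        using Suc(1)[of i k' j' l] Suc(2,3) 3 by auto
      have "A$1$1 ^ i * A$1$2 ^ j * A$2$1 ^ k * A$2$2 ^ l = (\<pi> A $ 3 - 1) * h (\<pi> A)"
        if "A \<in> ?V" for A
        unfolding bc[OF that, symmetric] bspec[OF h(2) that, symmetric] by (simp add: 3 mult_ac)
      moreover have "is_poly coords (\<lambda>v. (v$3 - 1) * h v)"
        by (intro is_poly_intros h(1))
      ultimately show ?thesis by blast
    next
      case 4
      obtain h where "is_poly coords h"
        "\<forall>A\<in>?V. A$1$1 ^ i * A$1$2 ^ j * A$2$1 ^ k' * A$2$2 ^ l' = h (\<pi> A)"
        using Suc(1)[of i k' j l'] Suc(2,3) 4 by auto
      then show ?thesis
        by (intro exI[of _ "\<lambda>v. v$2 * h v"]) (auto simp: 4 \<pi> mult_ac dest!: bspec)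
    qed
  qed
  have "affine_quotient SL2 torus (\<lambda>t A. A ** t) ?X \<pi>"
    unfolding SL2_def
  proof (rule affine_quotientI[OF closed surj inj])
    show "A ** t \<in> ?V" if "t \<in> torus" "A \<in> ?V" for A t
      using that by (simp add: det_mul torus_def)
    have S: "is_poly ?S (\<lambda>A. A $ i $ j)" for i j by (rule is_poly_gen) blast
    show "is_poly ?S (\<lambda>p. \<pi> p $ i)" for i
      using exhaust_3[of i] by (elim disjE; simp only: \<pi>; intro is_poly_mult S)
    fix n
    define N where "N = Suc n"
    define \<omega> where "\<omega> = cis (2 * pi / real N)"
    have \<omega>0: "\<omega> \<noteq> 0" by (simp add: \<omega>_def)
    have "real N \<noteq> 0" by (simp add: N_def)
    then have N2pi: "real N * (2 * pi / real N) = 2 * pi" by simp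
    have \<omega>N: "\<omega> ^ N = 1" unfolding \<omega>_def Complex.DeMoivre N2pi by simp
    have \<omega>1: "\<omega> ^ r \<noteq> 1" if "0 < r" "r < N" for r
    proof
      assume "\<omega> ^ r = 1"
      moreover have inj_N: "inj_on (\<lambda>k. cis (2 * pi * real k / real N)) {..<N}"
        by (rule bij_betw_imp_inj_on[OF Complex.bij_betw_roots_unity]) (simp add: N_def)
      have "cis (2 * pi * real r / real N) \<noteq> cis (2 * pi * real 0 / real N)"
        using inj_onD[OF inj_N, of r 0] that by fastforce
      moreover have "\<omega> ^ r = cis (2 * pi * real r / real N)"
        unfolding \<omega>_def Complex.DeMoivre by (simp only: mult_ac times_divide_eq_right)
      ultimately show False by simp
    qed
    define t where "t j = D (\<omega> ^ j)" for j :: nat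
    have "\<exists>h. is_poly coords h \<and> (\<forall>A\<in>?V. (\<Sum>j<N. m (A ** t j)) = of_nat N * h (\<pi> A))"
      if m': "mono_fun ?S n m" for m
    proof -
      obtain i j k l where m: "m = (\<lambda>A. A$1$1 ^ i * A$1$2 ^ j * A$2$1 ^ k * A$2$2 ^ l)"
        and n: "i + j + k + l \<le> n" using mono[OF m'] by blast
      define w where "w = \<omega> ^ (i + k) * inverse \<omega> ^ (j + l)"
      have mt: "m (A ** t s) = w ^ s * m A" for A s
        by (simp add: m t_def actD w_def power_mult_distrib power_mult[symmetric]
            power_add power_inverse mult_ac)
      have sum: "(\<Sum>s<N. m (A ** t s)) = (\<Sum>s<N. w ^ s) * m A" for A
        by (simp add: mt sum_distrib_right)
      show ?thesis
      proof (cases "i + k = j + l")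
        case True
        then have "w = 1" using \<omega>0 by (simp add: w_def power_inverse)
        obtain h where "is_poly coords h"
          "\<forall>A\<in>?V. A$1$1 ^ i * A$1$2 ^ j * A$2$1 ^ k * A$2$2 ^ l = h (\<pi> A)"
          using weight0[OF True] by blast
        then show ?thesis by (intro exI[of _ h]) (simp add: sum \<open>w = 1\<close>, simp add: m)
      next
        case False
        have "w \<noteq> 1"
        proof
          assume "w = 1"
          then have eq: "\<omega> ^ (i + k) = \<omega> ^ (j + l)"
            using \<omega>0 by (simp add: w_def power_inverse divide_simps flip: divide_inverse)
          show False
          proof (cases "i + k < j + l")
            case True
            then have "\<omega> ^ (j + l) = \<omega> ^ (i + k) * \<omega> ^ (j + l - (i + k))"
              by (simp flip: power_add)
            then have "\<omega> ^ (j + l - (i + k)) = 1" using eq \<omega>0 by simp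
            then show False using \<omega>1[of "j + l - (i + k)"] True n by (simp add: N_def)
          next
            case F: False
            then have "\<omega> ^ (i + k) = \<omega> ^ (j + l) * \<omega> ^ (i + k - (j + l))"
              by (simp flip: power_add)
            then have "\<omega> ^ (i + k - (j + l)) = 1" using eq \<omega>0 by simp
            then show False using \<omega>1[of "i + k - (j + l)"] F False n by (simp add: N_def)
          qed
        qed
        moreover have "w ^ N = 1"
          by (simp only: w_def power_mult_distrib power_mult[symmetric] mult.commute[of _ N])
            (simp add: power_mult power_inverse \<omega>N)
        ultimately have "(\<Sum>s<N. w ^ s) = 0" by (simp add: geometric_sum)
        then show ?thesis by (intro exI[of _ "\<lambda>_. 0"]) (simp add: sum)
      qed
    qed
    moreover have "t j \<in> torus" for j using D \<omega>0 by (simp add: t_def)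
    ultimately show "\<exists>N>0. \<exists>t. (\<forall>j<N. t j \<in> torus) \<and> (\<forall>m. mono_fun ?S n m \<longrightarrow>
       (\<exists>h. is_poly coords h \<and> (\<forall>A\<in>?V. (\<Sum>j<N. m (A ** t j)) = of_nat N * h (\<pi> A))))"
      by (intro exI[of _ N] conjI exI[of _ t]) (auto simp: N_def)
  qed
  then show ?thesis unfolding is_SL2_mod_T_def by blast
qed

lemma group_Aut: "group (Aut X)"
proof -
  interpret B: group "BijGroup X" by (rule group_BijGroup)
  have poly: "f \<in> (\<Union>k. poly_maps X k) \<longleftrightarrow>
      f \<in> extensional X \<and> (\<forall>i. \<exists>P. is_poly coords P \<and> (\<forall>p\<in>X. f p $ i = P p))" for f
  proof
    assume R: "f \<in> extensional X \<and> (\<forall>i. \<exists>P. is_poly coords P \<and> (\<forall>p\<in>X. f p $ i = P p))"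
    then obtain P k where P: "\<And>i. poly_fun coords (k i) (P i)" "\<And>i p. p \<in> X \<Longrightarrow> f p $ i = P i p"
      unfolding is_poly_def by metis
    have "poly_fun coords (Max (range k)) (P i)" for i
      by (rule poly_fun_mono[OF P(1)]) simp
    then show "f \<in> (\<Union>k. poly_maps X k)" using R P(2) unfolding poly_maps_def by blast
  next
    assume "f \<in> (\<Union>k. poly_maps X k)"
    then show "f \<in> extensional X \<and> (\<forall>i. \<exists>P. is_poly coords P \<and> (\<forall>p\<in>X. f p $ i = P p))"
      unfolding poly_maps_def is_poly_def by blast
  qed
  have mono: "poly_maps X k \<subseteq> poly_maps X l" if "k \<le> l" for k l
    using that poly_fun_mono unfolding poly_maps_def by blast
  have carrier: "carrier (Aut X) = {f \<in> carrier (BijGroup X).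
      f \<in> (\<Union>k. poly_maps X k) \<and> inv\<^bsub>BijGroup X\<^esub> f \<in> (\<Union>k. poly_maps X k)}"
  proof -
    have "\<exists>k. f \<in> poly_maps X k \<and> g \<in> poly_maps X k"
      if "f \<in> poly_maps X k" "g \<in> poly_maps X l" for f g k l
      using mono[of k "max k l"] mono[of l "max k l"] that by auto
    then show ?thesis by (auto simp: Aut_def aut_points_def BijGroup_def)
  qed
  have comp: "f \<otimes>\<^bsub>BijGroup X\<^esub> g \<in> (\<Union>k. poly_maps X k)"
    if fg': "f \<in> carrier (BijGroup X)" "g \<in> carrier (BijGroup X)"
      "f \<in> (\<Union>k. poly_maps X k)" "g \<in> (\<Union>k. poly_maps X k)" for f g
    unfolding poly
  proof (intro conjI allI)
    have fg: "f \<otimes>\<^bsub>BijGroup X\<^esub> g = compose X f g" using that by (simp add: BijGroup_def)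
    show "f \<otimes>\<^bsub>BijGroup X\<^esub> g \<in> extensional X" by (simp add: fg)
    obtain P where P: "\<And>i. is_poly coords (P i)" "\<And>i p. p \<in> X \<Longrightarrow> f p $ i = P i p"
      using fg'(3) unfolding poly by metis
    obtain Q where Q: "\<And>i. is_poly coords (Q i)" "\<And>i p. p \<in> X \<Longrightarrow> g p $ i = Q i p"
      using fg'(4) unfolding poly by metis
    have X: "g p \<in> X" if "p \<in> X" for p
      using \<open>g \<in> carrier (BijGroup X)\<close> that by (auto simp: BijGroup_def Bij_def bij_betw_def)
    have gQ: "g p = (\<chi> j. Q j p)" if "p \<in> X" for p
      using Q(2)[OF that] by (simp add: vec_eq_iff)
    show "\<exists>R. is_poly coords R \<and> (\<forall>p\<in>X. (f \<otimes>\<^bsub>BijGroup X\<^esub> g) p $ i = R p)" for i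
    proof (rule exI[of _ "\<lambda>p. P i (\<chi> j. Q j p)"], intro conjI ballI)
      show "is_poly coords (\<lambda>p. P i (\<chi> j. Q j p))"
        by (rule is_poly_comp[OF P(1)]) (use Q(1) in \<open>auto simp: coords_def\<close>)
      show "(f \<otimes>\<^bsub>BijGroup X\<^esub> g) p $ i = P i (\<chi> j. Q j p)" if "p \<in> X" for p
        using P(2)[OF X[OF that]] that by (simp add: fg compose_def gQ)
    qed
  qed
  have "subgroup (carrier (Aut X)) (BijGroup X)"
  proof (rule B.subgroupI)
    have "\<one>\<^bsub>BijGroup X\<^esub> \<in> (\<Union>k. poly_maps X k)"
      unfolding poly by (auto simp: BijGroup_def intro!: exI[of _ "\<lambda>p. p $ _"])
    then have "\<one>\<^bsub>BijGroup X\<^esub> \<in> carrier (Aut X)" unfolding carrier by simp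
    then show "carrier (Aut X) \<noteq> {}" by blast
    show "carrier (Aut X) \<subseteq> carrier (BijGroup X)" by (auto simp: carrier)
    show "inv\<^bsub>BijGroup X\<^esub> f \<in> carrier (Aut X)" if "f \<in> carrier (Aut X)" for f
      using that unfolding carrier by simp
    show "f \<otimes>\<^bsub>BijGroup X\<^esub> g \<in> carrier (Aut X)"
      if "f \<in> carrier (Aut X)" "g \<in> carrier (Aut X)" for f g
      using that comp[of f g] comp[of "inv\<^bsub>BijGroup X\<^esub> g" "inv\<^bsub>BijGroup X\<^esub> f"]
      unfolding carrier mem_Collect_eq by (metis B.inv_mult_group B.m_closed B.inv_closed)
  qed
  then have "group (BijGroup X\<lparr>carrier := carrier (Aut X)\<rparr>)"
    by (rule B.subgroup_imp_group)
  then show ?thesis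
    unfolding group_def monoid_def group_axioms_def Units_def by (simp add: Aut_def)
qed

lemma additive_action_carrier:
  fixes X :: "(complex^'n) set"
  assumes "additive_action X \<alpha>"
  shows "restrict (\<alpha> t) X \<in> carrier (Aut X)"
proof -
  let ?V = "prod_variety affine_line (affine_subvar X)"
  have "(\<lambda>(t, p). \<alpha> t p) \<in> UNIV \<times> X \<rightarrow> X"
    using assms
    by (simp add: additive_action_def morphism_def prod_variety_def affine_line_def affine_subvar_def)
  then have X: "\<alpha> t p \<in> X" if "p \<in> X" for t p
    using funcset_mem[of "\<lambda>(t, p). \<alpha> t p" _ _ "(t, p)"] that by force
  have inv: "\<alpha> s (\<alpha> t p) = p" if "p \<in> X" "s + t = 0" for s t p
    using assms that unfolding additive_action_def by metis
  have poly: "\<exists>P. is_poly coords P \<and> (\<forall>p\<in>X. \<alpha> t p $ i = P p)" for t i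
  proof -
    have "restrict (\<lambda>v. v $ i) X \<in> regs (affine_subvar X)"
      by (auto simp: affine_subvar_def regs_variety_gen)
    then have "compose (points ?V) (restrict (\<lambda>v. v $ i) X) (\<lambda>(t, p). \<alpha> t p) \<in> regs ?V"
      using assms by (auto simp: additive_action_def morphism_def)
    then obtain F where F: "compose (UNIV \<times> X) (restrict (\<lambda>v. v $ i) X) (\<lambda>(t, p). \<alpha> t p) = restrict F (UNIV \<times> X)"
      and "is_poly ({\<lambda>p. f (fst p) | f. f \<in> regs affine_line} \<union> {\<lambda>p. g (snd p) | g. g \<in> regs (affine_subvar X)}) F"
      by (auto simp: prod_variety_def regs_variety_gen affine_line_def affine_subvar_def)
    then obtain k where "poly_fun ({\<lambda>p. f (fst p) | f. f \<in> regs affine_line} \<union> {\<lambda>p. g (snd p) | g. g \<in> regs (affine_subvar X)}) k F"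
      unfolding is_poly_def by blast
    then have "\<exists>P. is_poly coords P \<and> (\<forall>p\<in>X. F (t, p) = P p)"
    proof induction
      case (const k c)
      then show ?case by (intro exI[of _ "\<lambda>_. c"]) auto
    next
      case (gen f k)
      then consider g where "f = (\<lambda>p. g (fst p))"
        | g where "f = (\<lambda>p. g (snd p))" "g \<in> regs (affine_subvar X)" by auto
      then show ?case
      proof cases
        case 1
        then show ?thesis by (intro exI[of _ "\<lambda>_. g t"]) auto
      next
        case 2
        then show ?thesis by (auto simp: affine_subvar_def regs_variety_gen)
      qed
    next
      case (add k f g)
      then obtain P Q where "is_poly coords P" "\<forall>p\<in>X. f (t, p) = P p"
        "is_poly coords Q" "\<forall>p\<in>X. g (t, p) = Q p" by blast
      then show ?case by (intro exI[of _ "\<lambda>p. P p + Q p"]) auto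
    next
      case (mult k f l g)
      then obtain P Q where "is_poly coords P" "\<forall>p\<in>X. f (t, p) = P p"
        "is_poly coords Q" "\<forall>p\<in>X. g (t, p) = Q p" by blast
      then show ?case by (intro exI[of _ "\<lambda>p. P p * Q p"]) auto
    qed
    moreover have "\<alpha> t p $ i = F (t, p)" if "p \<in> X" for p
      using fun_cong[OF F, of "(t, p)"] that X by (simp add: compose_def)
    ultimately show ?thesis by auto
  qed
  have bij: "restrict (\<alpha> t) X \<in> Bij X" for t
  proof -
    have "bij_betw (\<alpha> t) X X"
      by (rule bij_betwI[of _ _ _ "\<alpha> (- t)"]) (use X inv in auto)
    then show ?thesis by (simp add: Bij_def cong: bij_betw_cong)
  qed
  have "restrict (\<alpha> (- t)) X \<otimes>\<^bsub>BijGroup X\<^esub> restrict (\<alpha> t) X = \<one>\<^bsub>BijGroup X\<^esub>"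
    using bij X inv by (auto simp: BijGroup_def compose_def intro!: restrict_ext)
  then have eq: "inv\<^bsub>BijGroup X\<^esub> (restrict (\<alpha> t) X) = restrict (\<alpha> (- t)) X"
    using group.inv_equality[OF group_BijGroup] bij by (metis BijGroup_def partial_object.select_convs(1))
  obtain P k where P: "\<And>t i. poly_fun coords (k t i) (P t i)" "\<And>t i p. p \<in> X \<Longrightarrow> \<alpha> t p $ i = P t i p"
    using poly unfolding is_poly_def by metis
  define K where "K = max (Max (range (k t))) (Max (range (k (- t))))"
  have "poly_fun coords K (P t i)" "poly_fun coords K (P (- t) i)" for i
    by (rule poly_fun_mono[OF P(1)], simp add: K_def le_max_iff_disj)+
  then have "restrict (\<alpha> t) X \<in> poly_maps X K" "restrict (\<alpha> (- t)) X \<in> poly_maps X K"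
    using P(2) unfolding poly_maps_def by auto
  then show ?thesis using bij by (auto simp: Aut_def aut_points_def eq)
qed

lemma group_U: "group (U X)"
proof -
  let ?H = "generate (Aut X) {restrict (\<alpha> t) X | \<alpha> t. additive_action X \<alpha>}"
  have "subgroup ?H (Aut X)"
    by (rule group.generate_is_subgroup[OF group_Aut]) (use additive_action_carrier in blast)
  then have "group (Aut X\<lparr>carrier := ?H\<rparr>)"
    by (rule group.subgroup_imp_group[OF group_Aut])
  then show ?thesis
    unfolding group_def monoid_def group_axioms_def Units_def
    by (simp add: U_def ind_subgroup_def)
qed

end

theory Submission
  imports Defs "HOL-Computational_Algebra.Polynomial"
begin

text \<open>
  The group of the cone has a regular three-dimensional representation that is not trivial, and the
  group of the smooth quadric has none.

  The first quotient is the smooth quadric \<open>u\<^sup>2 - 4xy = 1\<close> and the second one is the cone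
  \<open>u\<^sup>2 - 4xy = 0\<close> (\<open>is_SL2_mod_T_quadric\<close>, \<open>is_A2_mod_mu2_quadric\<close>). Every automorphism
  of the cone fixes its only singular point (\<open>vertex_fixed\<close>), hence it acts on the
  three-dimensional tangent space there. The entries of this representation are linear functionals of
  the automorphism (\<open>linear_functional_\<rho>\<close>), so they are regular on each stage. An isomorphism of
  ind-groups would turn it into a homomorphism from the group of the smooth quadric to matrices which
  is regular on the stages as well. It remains to show that such a homomorphism is trivial
  (\<open>\<psi>_trivial\<close>). Both groups contain shears with the same weights for the torus; the difference
  lies in the brackets of their generators.

  Regularity provides a differential of the homomorphism, which is linear on the span of the vector
  fields that generate additive actions (\<open>tangent_\<Theta>_0\<close>) and respects brackets
  (\<open>tangent_bracket\<close>). Vector fields with Hamiltonian \<open>x\<^sup>n\<^sup>+\<^sup>1\<close> are weight vectors of the torus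
  for pairwise different weights, so that almost all of them are in the kernel of the differential
  (\<open>velocity_shear_eventually_0\<close>). On the smooth quadric the Poisson bracket is not homogeneous
  for the degree; iterated brackets lead from large \<open>n\<close> down to \<open>n = 0\<close>
  (\<open>bracket_combination\<close>, \<open>velocity_shear_down\<close>). Thus the kernel contains the Lie algebra of
  \<open>SL\<^sub>2\<close>, and the differential is invariant under \<open>SL\<^sub>2\<close>. Since there is no vector field on
  the quadric that is invariant under \<open>SL\<^sub>2\<close>, averaging over this group shows that the
  differential vanishes on the generator of every additive action (\<open>tangent_trivial\<close>). The
  averaging is done algebraically: a torus element removes the components of nonzero weight (\<open>tangent_fixed_part\<close>), and the Casimir operator, which on fields of
  weight zero is a differential operator in \<open>u\<close> with positive eigenvalues, removes the rest
  (\<open>tangent_weight0_trivial\<close>). As the group is generated by additive actions, the homomorphism is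
  trivial.
\<close>

section \<open>Polynomial maps and derivatives along curves\<close>

definition polymap :: "(complex^'n \<Rightarrow> complex^'m) \<Rightarrow> bool" where
  "polymap \<Phi> \<longleftrightarrow> (\<forall>i. is_poly coords (\<lambda>p. \<Phi> p $ i))"

lemma is_poly_sum:
  "(\<And>i. i \<in> A \<Longrightarrow> is_poly S (f i)) \<Longrightarrow> is_poly S (\<lambda>x. \<Sum>i\<in>A. f i x)"
  by (induction A rule: infinite_finite_induct) auto

lemma is_poly_polymap:
  assumes "is_poly coords P" "polymap \<Phi>"
  shows "is_poly coords (\<lambda>p. P (\<Phi> p))"
  by (rule is_poly_comp[OF assms(1)]) (use assms(2) in \<open>auto simp: coords_def polymap_def\<close>)

lemma polymap_comp: "polymap \<Psi> \<Longrightarrow> polymap \<Phi> \<Longrightarrow> polymap (\<lambda>p. \<Psi> (\<Phi> p))"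
  using is_poly_polymap unfolding polymap_def by blast

text \<open>
  Differentials of polynomial maps are only ever applied to velocities of curves, so that the notion of a
  derivative for curves suffices.
\<close>

definition curve_deriv :: "(complex \<Rightarrow> complex^'n) \<Rightarrow> complex^'n \<Rightarrow> bool" where
  "curve_deriv \<gamma> w \<longleftrightarrow> (\<forall>i. ((\<lambda>s. \<gamma> s $ i) has_field_derivative w $ i) (at 0))"

lemma curve_deriv_unique: "curve_deriv \<gamma> v \<Longrightarrow> curve_deriv \<gamma> w \<Longrightarrow> v = w"
  unfolding curve_deriv_def vec_eq_iff by (blast intro: DERIV_unique)

lemma curve_deriv_line: "curve_deriv (\<lambda>\<sigma>. \<sigma> *s w) w"
  unfolding curve_deriv_def by (auto intro!: derivative_eq_intros)

text \<open>
  The chain rule along curves, by induction on the construction of the polynomial: the gradient at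
  \<open>a\<close> of a product is given by the Leibniz rule and depends on the values at \<open>a\<close> only, not on
  the curve.
\<close>

lemma is_poly_gradient:
  fixes a :: "complex^'n"
  assumes "is_poly coords P"
  obtains g :: "complex^'n" where "\<And>\<gamma> w. \<gamma> 0 = a \<Longrightarrow> curve_deriv \<gamma> w \<Longrightarrow>
     ((\<lambda>s. P (\<gamma> s)) has_field_derivative (\<Sum>i\<in>UNIV. g $ i * w $ i)) (at 0)"
proof -
  define grad where "grad f g \<longleftrightarrow> (\<forall>\<gamma> w. \<gamma> 0 = a \<longrightarrow> curve_deriv \<gamma> w \<longrightarrow>
     ((\<lambda>s. f (\<gamma> s)) has_field_derivative (\<Sum>i\<in>UNIV. g $ i * w $ i)) (at 0))"
    for f :: "complex^'n \<Rightarrow> complex" and g :: "complex^'n"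
  have gradD: "((\<lambda>s. f (\<gamma> s)) has_field_derivative (\<Sum>i\<in>UNIV. g $ i * w $ i)) (at 0)"
    if "grad f g" "\<gamma> 0 = a" "curve_deriv \<gamma> w" for f g \<gamma> w
    using that unfolding grad_def by blast
  obtain k where "poly_fun coords k P" using assms by (auto simp: is_poly_def)
  then have "\<exists>g. grad P g"
  proof induction
    case (const k c)
    show ?case by (rule exI[of _ 0]) (simp add: grad_def)
  next
    case (gen f k)
    then obtain j where f: "f = (\<lambda>x. x $ j)" by (auto simp: coords_def)
    have "(\<Sum>i\<in>UNIV. axis j 1 $ i * w $ i) = w $ j" for w :: "complex^'n"
      by (simp add: axis_def if_distrib[of "\<lambda>x. x * _"] cong: if_cong)
    then show ?case by (intro exI[of _ "axis j 1"]) (simp add: grad_def f curve_deriv_def)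
  next
    case (add k f g)
    then obtain u v where "grad f u" "grad g v" by blast
    note uv = gradD[OF this(1)] gradD[OF this(2)]
    have "grad (\<lambda>x. f x + g x) (u + v)"
      unfolding grad_def using DERIV_add[OF uv] by (simp add: distrib_right sum.distrib)
    then show ?case by blast
  next
    case (mult k f l g)
    then obtain u v where "grad f u" "grad g v" by blast
    note uv = gradD[OF this(1)] gradD[OF this(2)]
    have "((\<lambda>s. f (\<gamma> s) * g (\<gamma> s)) has_field_derivative
        (\<Sum>i\<in>UNIV. (g a *s u + f a *s v) $ i * w $ i)) (at 0)"
      if "\<gamma> 0 = a" "curve_deriv \<gamma> w" for \<gamma> w
      using DERIV_mult[OF uv(1)[OF that] uv(2)[OF that]] that(1)
      by (simp add: distrib_left distrib_right sum.distrib sum_distrib_left sum_distrib_right mult_ac)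
    then have "grad (\<lambda>x. f x * g x) (g a *s u + f a *s v)"
      unfolding grad_def by blast
    then show ?case by blast
  qed
  then show ?thesis using gradD that by blast
qed

lemma polymap_jacobian:
  fixes \<Phi> :: "complex^'n \<Rightarrow> complex^'m"
  assumes "polymap \<Phi>"
  obtains J :: "complex^'n^'m" where
    "\<And>\<gamma> w. \<gamma> 0 = a \<Longrightarrow> curve_deriv \<gamma> w \<Longrightarrow> curve_deriv (\<lambda>s. \<Phi> (\<gamma> s)) (J *v w)"
proof -
  have "\<exists>g :: complex^'n. \<forall>\<gamma> w. \<gamma> 0 = a \<longrightarrow> curve_deriv \<gamma> w \<longrightarrow>
     ((\<lambda>s. \<Phi> (\<gamma> s) $ i) has_field_derivative (\<Sum>j\<in>UNIV. g $ j * w $ j)) (at 0)" for i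
    by (rule is_poly_gradient[of "\<lambda>p. \<Phi> p $ i" a]) (use assms in \<open>auto simp: polymap_def\<close>)
  then obtain g :: "'m \<Rightarrow> complex^'n" where g: "\<And>i \<gamma> w. \<gamma> 0 = a \<Longrightarrow> curve_deriv \<gamma> w \<Longrightarrow>
     ((\<lambda>s. \<Phi> (\<gamma> s) $ i) has_field_derivative (\<Sum>j\<in>UNIV. g i $ j * w $ j)) (at 0)"
    by metis
  show ?thesis
  proof (rule that[of "\<chi> i. g i"])
    fix \<gamma> :: "complex \<Rightarrow> complex^'n" and w assume "\<gamma> 0 = a" "curve_deriv \<gamma> w"
    then show "curve_deriv (\<lambda>s. \<Phi> (\<gamma> s)) ((\<chi> i. g i) *v w)"
      using g unfolding curve_deriv_def[of "\<lambda>s. \<Phi> (\<gamma> s)"] by (simp add: matrix_vector_mult_def)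
  qed
qed

section \<open>Polynomial families and additive actions\<close>

text \<open>
  A family of functions on \<open>X\<close> that is polynomial in the parameter. The degree bound has to
  be uniform on \<open>X\<close>: only then are the coefficients of the powers of \<open>t\<close> finitely many functions.
\<close>

definition poly_family :: "(complex^'n) set \<Rightarrow> (complex \<Rightarrow> complex^'n \<Rightarrow> complex) \<Rightarrow> bool" where
  "poly_family X F \<longleftrightarrow> (\<exists>c d. (\<forall>p. degree (c p) \<le> d) \<and> (\<forall>j. is_poly coords (\<lambda>p. coeff (c p) j)) \<and>
     (\<forall>t. \<forall>p\<in>X. F t p = poly (c p) t))"

lemma poly_familyI:
  assumes "\<And>p. degree (c p) \<le> d" "\<And>j. is_poly coords (\<lambda>p. coeff (c p) j)"
    "\<And>t p. p \<in> X \<Longrightarrow> F t p = poly (c p) t"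
  shows "poly_family X F"
  unfolding poly_family_def by (rule exI[of _ c], rule exI[of _ d]) (use assms in simp)

lemma poly_familyE:
  assumes "poly_family X F"
  obtains c d where "\<And>p. degree (c p) \<le> d" "\<And>j. is_poly coords (\<lambda>p. coeff (c p) j)"
    "\<And>t p. p \<in> X \<Longrightarrow> F t p = poly (c p) t"
proof -
  from assms obtain c d where "(\<forall>p. degree (c p) \<le> d) \<and> (\<forall>j. is_poly coords (\<lambda>p. coeff (c p) j)) \<and>
     (\<forall>t. \<forall>p\<in>X. F t p = poly (c p) t)"
    unfolding poly_family_def by (elim exE)
  then show ?thesis by (intro that[of c d]) simp_all
qed

lemma poly_family_cong:
  assumes "poly_family X F" "\<And>t p. p \<in> X \<Longrightarrow> F t p = G t p"
  shows "poly_family X G"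
proof -
  from assms(1) obtain c d where c: "\<And>p. degree (c p) \<le> d"
    "\<And>j. is_poly coords (\<lambda>p. coeff (c p) j)" "\<And>t p. p \<in> X \<Longrightarrow> F t p = poly (c p) t"
    by (rule poly_familyE) (rule that)
  show ?thesis by (rule poly_familyI[of c d]) (use c assms(2) in auto)
qed

lemma poly_family_poly: "is_poly coords P \<Longrightarrow> poly_family X (\<lambda>t. P)"
proof (rule poly_familyI[of "\<lambda>p. [:P p:]" 0])
  show "is_poly coords (\<lambda>p. coeff [:P p:] j)" if "is_poly coords P" for j
    using that by (cases j) auto
qed auto

lemma poly_family_const: "poly_family X (\<lambda>t p. c)"
  and poly_family_coord: "poly_family X (\<lambda>t p. p $ i)"
  by (auto intro: poly_family_poly)

lemma poly_family_param: "poly_family X (\<lambda>t p. t)"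
  by (rule poly_familyI[of "\<lambda>p. [:0, 1:]" 1]) auto

lemma poly_family_add:
  assumes "poly_family X F" "poly_family X G" shows "poly_family X (\<lambda>t p. F t p + G t p)"
proof -
  from assms(1) obtain c d where c: "\<And>p. degree (c p) \<le> d"
    "\<And>j. is_poly coords (\<lambda>p. coeff (c p) j)" "\<And>t p. p \<in> X \<Longrightarrow> F t p = poly (c p) t"
    by (rule poly_familyE) (rule that)
  from assms(2) obtain c' d' where c': "\<And>p. degree (c' p) \<le> d'"
    "\<And>j. is_poly coords (\<lambda>p. coeff (c' p) j)" "\<And>t p. p \<in> X \<Longrightarrow> G t p = poly (c' p) t"
    by (rule poly_familyE) (rule that)
  show ?thesis
  proof (rule poly_familyI[of "\<lambda>p. c p + c' p" "max d d'"])
    show "degree (c p + c' p) \<le> max d d'" for p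
      by (rule degree_add_le) (use c(1) c'(1) in \<open>simp_all add: le_max_iff_disj\<close>)
  qed (use c c' in auto)
qed

lemma poly_family_mult:
  assumes "poly_family X F" "poly_family X G" shows "poly_family X (\<lambda>t p. F t p * G t p)"
proof -
  from assms(1) obtain c d where c: "\<And>p. degree (c p) \<le> d"
    "\<And>j. is_poly coords (\<lambda>p. coeff (c p) j)" "\<And>t p. p \<in> X \<Longrightarrow> F t p = poly (c p) t"
    by (rule poly_familyE) (rule that)
  from assms(2) obtain c' d' where c': "\<And>p. degree (c' p) \<le> d'"
    "\<And>j. is_poly coords (\<lambda>p. coeff (c' p) j)" "\<And>t p. p \<in> X \<Longrightarrow> G t p = poly (c' p) t"
    by (rule poly_familyE) (rule that)
  show ?thesis
  proof (rule poly_familyI[of "\<lambda>p. c p * c' p" "d + d'"])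
    show "degree (c p * c' p) \<le> d + d'" for p
      using order.trans[OF degree_mult_le add_mono[OF c(1) c'(1)]] .
    show "is_poly coords (\<lambda>p. coeff (c p * c' p) j)" for j
      unfolding coeff_mult by (intro is_poly_sum is_poly_mult c c')
  qed (use c c' in auto)
qed

lemma poly_family_diff: "poly_family X F \<Longrightarrow> poly_family X G \<Longrightarrow> poly_family X (\<lambda>t p. F t p - G t p)"
  using poly_family_add[OF _ poly_family_mult[OF poly_family_const[of X "-1"]], of F G] by simp

lemma poly_family_uminus: "poly_family X F \<Longrightarrow> poly_family X (\<lambda>t p. - F t p)"
  using poly_family_mult[OF poly_family_const[of X "-1"], of F] by simp

lemma poly_family_power: "poly_family X F \<Longrightarrow> poly_family X (\<lambda>t p. F t p ^ n)"
  by (induction n) (auto intro: poly_family_mult poly_family_const)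

lemmas poly_family_intros = poly_family_add poly_family_mult poly_family_diff poly_family_uminus poly_family_power poly_family_const poly_family_coord poly_family_param

lemma poly_family_comp:
  assumes "is_poly S H" "\<And>s. s \<in> S \<Longrightarrow> poly_family X (\<lambda>t p. s (G t p))"
  shows "poly_family X (\<lambda>t p. H (G t p))"
proof -
  obtain k where "poly_fun S k H" using assms(1) by (auto simp: is_poly_def)
  then show ?thesis by induction (use assms(2) in \<open>auto intro: poly_family_intros\<close>)
qed

lemma poly_family_polymap_after:
  assumes "polymap \<Phi>" "\<And>i. poly_family X (\<lambda>t p. G t p $ i)"
  shows "poly_family X (\<lambda>t p. \<Phi> (G t p) $ i)"
  by (rule poly_family_comp[of coords "\<lambda>q. \<Phi> q $ i"])
    (use assms in \<open>auto simp: polymap_def coords_def\<close>)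

lemma poly_family_polymap_before:
  assumes "poly_family X F" "polymap \<Phi>" "\<And>p. p \<in> Z \<Longrightarrow> \<Phi> p \<in> X"
  shows "poly_family Z (\<lambda>t p. F t (\<Phi> p))"
proof -
  from assms(1) obtain c d where c: "\<And>p. degree (c p) \<le> d"
    "\<And>j. is_poly coords (\<lambda>p. coeff (c p) j)" "\<And>t p. p \<in> X \<Longrightarrow> F t p = poly (c p) t"
    by (rule poly_familyE) (rule that)
  show ?thesis
  proof (rule poly_familyI[of "\<lambda>p. c (\<Phi> p)" d])
    show "is_poly coords (\<lambda>p. coeff (c (\<Phi> p)) j)" for j
      by (rule is_poly_polymap[OF c(2) assms(2)])
  qed (use c assms(3) in auto)
qed

lemma poly_eq_sum_atMost:
  fixes q :: "complex poly" assumes "degree q \<le> d" shows "poly q t = (\<Sum>j\<le>d. coeff q j * t ^ j)"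
  unfolding poly_altdef
  by (rule sum.mono_neutral_left) (use assms in \<open>auto simp: coeff_eq_0\<close>)

lemma poly_family_at:
  assumes "poly_family X F" obtains P where "is_poly coords P" "\<And>p. p \<in> X \<Longrightarrow> F t p = P p"
proof -
  from assms(1) obtain c d where c: "\<And>p. degree (c p) \<le> d"
    "\<And>j. is_poly coords (\<lambda>p. coeff (c p) j)" "\<And>t p. p \<in> X \<Longrightarrow> F t p = poly (c p) t"
    by (rule poly_familyE) (rule that)
  show ?thesis
  proof (rule that[of "\<lambda>p. \<Sum>j\<le>d. coeff (c p) j * t ^ j"])
    show "is_poly coords (\<lambda>p. \<Sum>j\<le>d. coeff (c p) j * t ^ j)"
      by (intro is_poly_sum is_poly_mult is_poly_const c)
  qed (simp add: c(3) poly_eq_sum_atMost[OF c(1)])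
qed

lemma poly_family_maps_at:
  fixes X :: "(complex^'n) set"
  assumes "\<And>i. poly_family X (\<lambda>t p. a t p $ i)"
  obtains \<Phi> where "polymap \<Phi>" "\<And>p. p \<in> X \<Longrightarrow> a t p = \<Phi> p"
proof -
  have "\<exists>P. is_poly coords P \<and> (\<forall>p\<in>X. a t p $ i = P p)" for i
    by (rule poly_family_at[OF assms[of i], of t]) blast
  then obtain P where P: "\<And>i. is_poly coords (P i)" "\<And>i p. p \<in> X \<Longrightarrow> a t p $ i = P i p"
    by metis
  show ?thesis by (rule that[of "\<lambda>p. \<chi> i. P i p"]) (auto simp: polymap_def P vec_eq_iff)
qed

text \<open>
  An additive action is a morphism from the product of the line with \<open>X\<close>, and the coordinate
  ring of this product is the polynomial ring in \<open>t\<close> over the one of \<open>X\<close>. Hence a morphism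
  is the same as a map whose components are polynomial families.
\<close>

lemma additive_action_iff:
  fixes X :: "(complex^'n) set"
  shows "additive_action X a \<longleftrightarrow> (\<forall>t. \<forall>p\<in>X. a t p \<in> X) \<and> (\<forall>i. poly_family X (\<lambda>t p. a t p $ i)) \<and>
     (\<forall>p\<in>X. a 0 p = p) \<and> (\<forall>s t. \<forall>p\<in>X. a (s + t) p = a s (a t p))"
proof -
  let ?V = "prod_variety affine_line (affine_subvar X)"
  let ?S = "{\<lambda>p. f (fst p) | f. f \<in> regs affine_line} \<union> {\<lambda>p. g (snd p) | g. g \<in> regs (affine_subvar X)}"
  have pts: "points ?V = UNIV \<times> X" "points (affine_subvar X) = X"
    by (simp_all add: prod_variety_def affine_line_def affine_subvar_def)
  have regs: "regs ?V = {restrict F (UNIV \<times> X) | F. is_poly ?S F}"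
    by (simp add: prod_variety_def regs_variety_gen affine_line_def affine_subvar_def)
  have S: "poly_family X (\<lambda>t p. s (t, p))" if s: "s \<in> ?S" for s
  proof -
    consider f where "s = (\<lambda>p. f (fst p))" "f \<in> regs affine_line"
      | g where "s = (\<lambda>p. g (snd p))" "g \<in> regs (affine_subvar X)" using s by auto
    then show ?thesis
    proof cases
      case 1
      then obtain F where "f = F" "is_poly {\<lambda>t. t} F"
        unfolding affine_line_def regs_variety_gen by (auto simp: restrict_UNIV)
      then show ?thesis using poly_family_comp[of "{\<lambda>t. t}" F X "\<lambda>t p. t"] by (simp add: 1 poly_family_param)
    next
      case 2
      then obtain G where "g = restrict G X" "is_poly coords G"
        by (auto simp: affine_subvar_def regs_variety_gen)
      then show ?thesis using poly_family_cong[OF poly_family_poly[of G X]] by (simp add: 2)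
    qed
  qed
  have "morphism ?V (affine_subvar X) (\<lambda>(t, p). a t p) \<longleftrightarrow>
     (\<forall>t. \<forall>p\<in>X. a t p \<in> X) \<and> (\<forall>i. poly_family X (\<lambda>t p. a t p $ i))" (is "?l \<longleftrightarrow> ?r")
  proof
    assume l: ?l
    then have X: "a t p \<in> X" if "p \<in> X" for t p
      using funcset_mem[of "\<lambda>(t, p). a t p" _ _ "(t, p)"] that unfolding morphism_def pts by force
    have "poly_family X (\<lambda>t p. a t p $ i)" for i
    proof -
      have "restrict (\<lambda>v. v $ i) X \<in> regs (affine_subvar X)"
        by (auto simp: affine_subvar_def regs_variety_gen)
      then have "compose (UNIV \<times> X) (restrict (\<lambda>v. v $ i) X) (\<lambda>(t, p). a t p) \<in> regs ?V"
        using l unfolding morphism_def pts by blast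
      then obtain F where F: "is_poly ?S F"
        "compose (UNIV \<times> X) (restrict (\<lambda>v. v $ i) X) (\<lambda>(t, p). a t p) = restrict F (UNIV \<times> X)"
        unfolding regs by auto
      have PF: "poly_family X (\<lambda>t p. F (t, p))" by (rule poly_family_comp[OF F(1) S])
      have a: "a t p $ i = F (t, p)" if "p \<in> X" for t p
        using fun_cong[OF F(2), of "(t, p)"] that X by (simp add: compose_def)
      show ?thesis by (rule poly_family_cong[OF PF]) (simp add: a)
    qed
    then show ?r using X by blast
  next
    assume r: ?r
    have "compose (UNIV \<times> X) h (\<lambda>(t, p). a t p) \<in> regs ?V" if "h \<in> regs (affine_subvar X)" for h
    proof -
      from that obtain H where H: "h = restrict H X" "is_poly coords H"
        by (auto simp: affine_subvar_def regs_variety_gen)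
      have "poly_family X (\<lambda>t p. H (a t p))"
        by (rule poly_family_comp[OF H(2)]) (use r in \<open>auto simp: coords_def\<close>)
      then obtain c d where c:
        "\<And>p. degree (c p) \<le> d" "\<And>j. is_poly coords (\<lambda>p. coeff (c p) j)"
        "\<And>t p. p \<in> X \<Longrightarrow> H (a t p) = poly (c p) t"
        by (rule poly_familyE) (rule that)
      let ?F = "\<lambda>q. \<Sum>j\<le>d. restrict (\<lambda>p. coeff (c p) j) X (snd q) * restrict (\<lambda>t. t) UNIV (fst q) ^ j"
      have "is_poly ?S ?F"
      proof (intro is_poly_sum is_poly_mult is_poly_power)
        fix j
        have "restrict (\<lambda>p. coeff (c p) j) X \<in> regs (affine_subvar X)"
          using c(2) by (auto simp: affine_subvar_def regs_variety_gen)
        then show "is_poly ?S (\<lambda>q. restrict (\<lambda>p. coeff (c p) j) X (snd q))"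
          by (intro is_poly_gen) blast
        have "restrict (\<lambda>t. t) UNIV \<in> regs affine_line"
          by (auto simp: affine_line_def regs_variety_gen intro!: exI[of _ "\<lambda>t. t"] is_poly_gen)
        then show "is_poly ?S (\<lambda>q. restrict (\<lambda>t. t) UNIV (fst q))"
          by (intro is_poly_gen) blast
      qed
      moreover have "compose (UNIV \<times> X) h (\<lambda>(t, p). a t p) = restrict ?F (UNIV \<times> X)"
        using r by (auto simp: compose_def H(1) c(3) poly_eq_sum_atMost[OF c(1)] intro!: restrict_ext)
      ultimately show ?thesis unfolding regs by blast
    qed
    then show ?l using r unfolding morphism_def pts by auto
  qed
  then show ?thesis unfolding additive_action_def by auto
qed

section \<open>Vector fields and the differential of a representation\<close>

text \<open>
  Quadratic forms in two variables with a given discriminant. For \<open>c = 1\<close> the quadric is the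
  quotient of \<open>SL\<^sub>2\<close> by its torus, and for \<open>c = 0\<close> the cone over a conic, which is
  the plane modulo sign. In both cases \<open>SL\<^sub>2\<close> acts by substitution of variables.
\<close>

definition quadric :: "complex \<Rightarrow> (complex^3) set" where
  "quadric c = {v. (v $ 3)\<^sup>2 - 4 * v $ 1 * v $ 2 = c}"

definition cscale :: "complex \<Rightarrow> complex^'n^'m \<Rightarrow> complex^'n^'m" where
  "cscale c M = (\<chi> i. c *s M $ i)"

lemma cscale_nth [simp]: "cscale c M $ i $ j = c * M $ i $ j"
  by (simp add: cscale_def)

definition matrix_deriv :: "(complex \<Rightarrow> complex^'n^'m) \<Rightarrow> complex^'n^'m \<Rightarrow> bool" where
  "matrix_deriv M m \<longleftrightarrow> (\<forall>i j. ((\<lambda>s. M s $ i $ j) has_field_derivative m $ i $ j) (at 0))"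

lemma matrix_deriv_mult:
  assumes "matrix_deriv A a" "matrix_deriv B b"
  shows "matrix_deriv (\<lambda>s. A s ** B s) (a ** B 0 + A 0 ** b)"
  unfolding matrix_deriv_def
proof (intro allI)
  fix i j
  have "((\<lambda>s. \<Sum>k\<in>UNIV. A s $ i $ k * B s $ k $ j) has_field_derivative
      (\<Sum>k\<in>UNIV. a $ i $ k * B 0 $ k $ j + b $ k $ j * A 0 $ i $ k)) (at 0)"
    using assms unfolding matrix_deriv_def by (intro DERIV_sum DERIV_mult) auto
  then show "((\<lambda>s. (A s ** B s) $ i $ j) has_field_derivative (a ** B 0 + A 0 ** b) $ i $ j) (at 0)"
    by (simp add: matrix_matrix_mult_def sum.distrib mult.commute)
qed

lemma matrix_mult_minus: "A ** (- B) = - (A ** B)" for A :: "complex^'n^'m"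
  by (simp add: matrix_matrix_mult_def vec_eq_iff sum_negf)

lemma matrix_deriv_const: "matrix_deriv (\<lambda>s. A) 0"
  by (simp add: matrix_deriv_def)

lemma matrix_deriv_unique: "matrix_deriv M a \<Longrightarrow> matrix_deriv M b \<Longrightarrow> a = b"
  unfolding matrix_deriv_def vec_eq_iff by (blast intro: DERIV_unique)

lemma additive_actionD:
  assumes "additive_action X a" "p \<in> X"
  shows "a t p \<in> X" "a 0 p = p" "a (s + t) p = a s (a t p)" "a t (a (- t) p) = p" "a (- t) (a t p) = p"
  using assms unfolding additive_action_iff by (auto; metis add.right_inverse add.left_inverse)+

lemma additive_action_poly_family: "additive_action X a \<Longrightarrow> poly_family X (\<lambda>t p. a t p $ i)"
  by (simp add: additive_action_iff)

text \<open>
  The adjoint action on vector fields enters through the conjugates of an action.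
\<close>

lemma conj_action:
  assumes "additive_action X a" "additive_action X b"
  shows "additive_action X (\<lambda>s p. a t (b s (a (- t) p)))"
proof -
  obtain \<Phi> where \<Phi>: "polymap \<Phi>" "\<And>p. p \<in> X \<Longrightarrow> a t p = \<Phi> p"
    by (rule poly_family_maps_at[of X a t, OF additive_action_poly_family[OF assms(1)]]) (rule that)
  obtain \<Psi> where \<Psi>: "polymap \<Psi>" "\<And>p. p \<in> X \<Longrightarrow> a (- t) p = \<Psi> p"
    by (rule poly_family_maps_at[of X a "- t", OF additive_action_poly_family[OF assms(1)]]) (rule that)
  note a = additive_actionD[OF assms(1)] and b = additive_actionD[OF assms(2)]
  have \<Psi>X: "\<Psi> p \<in> X" if "p \<in> X" for p using a(1)[OF that, of "- t"] \<Psi>(2)[OF that] by simp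
  have "poly_family X (\<lambda>s p. a t (b s (a (- t) p)) $ i)" for i
  proof (rule poly_family_cong)
    show "poly_family X (\<lambda>s p. \<Phi> (b s (\<Psi> p)) $ i)"
      by (rule poly_family_polymap_after[OF \<Phi>(1)], rule poly_family_polymap_before[OF _ \<Psi>(1) \<Psi>X],
        rule additive_action_poly_family[OF assms(2)])
    show "\<Phi> (b s (\<Psi> p)) $ i = a t (b s (a (- t) p)) $ i" if "p \<in> X" for s p
      using that by (simp add: \<Phi>(2)[symmetric] \<Psi>(2)[symmetric] a b)
  qed
  then show ?thesis unfolding additive_action_iff using a b by auto
qed

lemma scale_minus_left_vec: "V + (- 1) *s W = V - (W :: complex^'n)"
  by (simp add: vec_eq_iff)

lemma cscale_uminus: "cscale 1 m + cscale (- 1) m' = m - m'"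
  by (simp add: vec_eq_iff)

text \<open>
  Let \<open>\<Theta> b s\<close> be the image, in a representation of the group, of the time \<open>s\<close> of
  the additive action \<open>b\<close>. The relation is the linear span of the pairs that consist of the
  vector field generating an action and the velocity of its image. Thus it is the differential of
  the representation, as a relation between vector fields on the quadric and matrices. That it is a
  function is a property of regular representations and is required separately.
\<close>

inductive tangent ::
    "((complex \<Rightarrow> complex^3 \<Rightarrow> complex^3) \<Rightarrow> complex \<Rightarrow> complex^3^3) \<Rightarrow>
      (complex^3 \<Rightarrow> complex^3) \<Rightarrow> complex^3^3 \<Rightarrow> bool"
  for \<Theta> where
  gen: "additive_action (quadric 1) b \<Longrightarrow> (\<And>p. p \<in> quadric 1 \<Longrightarrow> curve_deriv (\<lambda>s. b s p) (V p)) \<Longrightarrow>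
     matrix_deriv (\<Theta> b) m \<Longrightarrow> tangent \<Theta> V m"
| lin: "tangent \<Theta> V m \<Longrightarrow> tangent \<Theta> V' m' \<Longrightarrow>
     tangent \<Theta> (\<lambda>p. x *s V p + y *s V' p) (cscale x m + cscale y m')"
| cong: "tangent \<Theta> V m \<Longrightarrow> (\<And>p. p \<in> quadric 1 \<Longrightarrow> V p = V' p) \<Longrightarrow> tangent \<Theta> V' m"

lemma tangent_scale: "tangent \<Theta> V m \<Longrightarrow> tangent \<Theta> (\<lambda>p. c *s V p) (cscale c m)"
proof -
  assume V: "tangent \<Theta> V m"
  have "cscale c m + cscale 0 m = cscale c m" by (simp add: vec_eq_iff)
  then show ?thesis using tangent.lin[OF V V, of c 0] by simp
qed

lemma tangent_unscale:
  assumes "tangent \<Theta> (\<lambda>p. c *s V p) (cscale c m)" "c \<noteq> 0" shows "tangent \<Theta> V m"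
proof -
  have "cscale (1 / c) (cscale c m) = m" using assms(2) by (simp add: vec_eq_iff)
  then show ?thesis using tangent_scale[OF assms(1), of "1 / c"] assms(2) by simp
qed

lemma tangent_diff: "tangent \<Theta> V m \<Longrightarrow> tangent \<Theta> V' m' \<Longrightarrow> tangent \<Theta> (\<lambda>p. V p - V' p) (m - m')"
  using tangent.lin[of \<Theta> V m V' m' 1 "- 1"]
  by (simp add: scale_minus_left_vec cscale_uminus)

lemma tangent_add: "tangent \<Theta> V m \<Longrightarrow> tangent \<Theta> V' m' \<Longrightarrow> tangent \<Theta> (\<lambda>p. V p + V' p) (m + m')"
  using tangent.lin[of \<Theta> V m V' m' 1 1] by (simp add: cscale_def vec_eq_iff)

lemma tangent_zero: "tangent \<Theta> V m \<Longrightarrow> tangent \<Theta> (\<lambda>p. 0) 0"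
  using tangent_diff[of \<Theta> V m V m] by simp

text \<open>
  A linear subspace that contains all values of a polynomial curve contains its coefficients. To
  remove the top coefficient, compare the curve at \<open>2t\<close> with \<open>2\<^sup>d\<close> times the curve
  at \<open>t\<close>; the other coefficients are multiplied by nonzero numbers.
\<close>

lemma tangent_coeff_sum:
  assumes "\<And>t. tangent \<Theta> (\<lambda>p. \<Sum>j<d. t ^ j *s V j p) (\<Sum>j<d. cscale (t ^ j) (M j))"
    and "k < d"
  shows "tangent \<Theta> (V k) (M k)"
  using assms
proof (induction d arbitrary: V M k)
  case (Suc d)
  \<comment> \<open>The factor that the comparison of the two curves puts on the coefficient \<open>j\<close>.\<close>
  define x where "x j = (2 ^ j - 2 ^ d :: complex)" for j
  have x: "x j \<noteq> 0" if "j < d" for j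
  proof -
    have "(2::nat) ^ j \<noteq> 2 ^ d" using that by simp
    then have "of_nat (2 ^ j) \<noteq> (of_nat (2 ^ d) :: complex)" by (simp only: of_nat_eq_iff not_False_eq_True)
    then show ?thesis by (simp add: x_def)
  qed
  have "tangent \<Theta> (\<lambda>p. \<Sum>j<d. t ^ j *s (x j *s V j p)) (\<Sum>j<d. cscale (t ^ j) (cscale (x j) (M j)))" for t
  proof (rule tangent.cong)
    have "1 * (\<Sum>j<Suc d. (2 * t) ^ j * c j) + (- (2 ^ d)) * (\<Sum>j<Suc d. t ^ j * c j)
        = (\<Sum>j<d. t ^ j * (x j * c j))" for c :: "nat \<Rightarrow> complex"
      by (simp add: x_def power_mult_distrib sum_distrib_left algebra_simps sum_subtractf sum_negf)
    note e = this[unfolded mult_1]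
    show "tangent \<Theta> (\<lambda>p. 1 *s (\<Sum>j<Suc d. (2 * t) ^ j *s V j p) + (- (2 ^ d)) *s (\<Sum>j<Suc d. t ^ j *s V j p))
       (\<Sum>j<d. cscale (t ^ j) (cscale (x j) (M j)))"
    proof -
      have "cscale 1 (\<Sum>j<Suc d. cscale ((2 * t) ^ j) (M j)) + cscale (- (2 ^ d)) (\<Sum>j<Suc d. cscale (t ^ j) (M j))
          = (\<Sum>j<d. cscale (t ^ j) (cscale (x j) (M j)))"
        using e[of "\<lambda>j. M j $ _ $ _"] by (simp add: vec_eq_iff del: sum.lessThan_Suc)
      then show ?thesis
        using tangent.lin[OF Suc.prems(1)[of "2 * t"] Suc.prems(1)[of t], of 1 "- (2 ^ d)"] by argo
    qed
    show "1 *s (\<Sum>j<Suc d. (2 * t) ^ j *s V j p) + (- (2 ^ d)) *s (\<Sum>j<Suc d. t ^ j *s V j p)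
       = (\<Sum>j<d. t ^ j *s (x j *s V j p))" for p
      using e[of "\<lambda>j. V j p $ _"] by (simp add: vec_eq_iff mult.assoc del: sum.lessThan_Suc)
  qed
  then have "tangent \<Theta> (\<lambda>p. x j *s V j p) (cscale (x j) (M j))" if "j < d" for j
    using Suc.IH[of "\<lambda>j p. x j *s V j p" "\<lambda>j. cscale (x j) (M j)"] that by blast
  then have IH: "tangent \<Theta> (V j) (M j)" if "j < d" for j
    using tangent_unscale x that by blast
  show ?case
  proof (cases "k < d")
    case False
    then have k: "k = d" using Suc.prems(2) by simp
    have z: "tangent \<Theta> (\<lambda>p. 0) 0" using tangent_zero Suc.prems(1) by blast
    have "e \<le> d \<Longrightarrow> tangent \<Theta> (\<lambda>p. \<Sum>j<e. V j p) (\<Sum>j<e. M j)" for e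
    proof (induction e)
      case (Suc e)
      then show ?case using tangent_add[OF Suc.IH IH[of e]] by simp
    qed (simp add: z)
    from tangent_diff[OF Suc.prems(1)[of 1] this[of d]]
    have "tangent \<Theta> (\<lambda>p. V d p) (M d)" by (simp add: cscale_def)
    then show ?thesis using k by simp
  qed (rule IH)
qed simp

lemma tangent_coeff:
  assumes t: "\<And>t. tangent \<Theta> (\<lambda>p. \<chi> i. poly (c i p) t) (\<chi> i j. poly (q i j) t)"
    and d: "\<And>i p. degree (c i p) \<le> d"
  shows "tangent \<Theta> (\<lambda>p. \<chi> i. coeff (c i p) k) (\<chi> i j. coeff (q i j) k)"
proof -
  \<comment> \<open>One degree bound for vector fields and matrices.\<close>
  define e where "e = Max (insert k (insert d (range (\<lambda>(i, j). degree (q i j)))))"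
  have "k \<le> e" "d \<le> e" by (simp_all add: e_def)
  have q: "degree (q i j) \<le> e" for i j
    unfolding e_def by (rule Max_ge) (auto intro!: image_eqI[of _ _ "(i, j)"])
  have c: "degree (c i p) \<le> e" for i p using d[of i p] \<open>d \<le> e\<close> by simp
  have "(\<Sum>j<Suc e. t ^ j *s (\<chi> i. coeff (c i p) j)) = (\<chi> i. poly (c i p) t)" for t p
    by (simp add: vec_eq_iff poly_eq_sum_atMost[OF c] lessThan_Suc_atMost mult.commute del: sum.lessThan_Suc)
  moreover have "(\<Sum>j<Suc e. cscale (t ^ j) (\<chi> i l. coeff (q i l) j)) = (\<chi> i j. poly (q i j) t)" for t
    by (simp add: vec_eq_iff poly_eq_sum_atMost[OF q] lessThan_Suc_atMost mult.commute del: sum.lessThan_Suc)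
  ultimately have "tangent \<Theta> (\<lambda>p. \<Sum>j<Suc e. t ^ j *s (\<chi> i. coeff (c i p) j))
      (\<Sum>j<Suc e. cscale (t ^ j) (\<chi> i l. coeff (q i l) j))" for t
    using t[of t] by (simp only:)
  from tangent_coeff_sum[OF this, of k] show ?thesis using \<open>k \<le> e\<close> by simp
qed

text \<open>
  \<open>J t p\<close> is the differential of \<open>a t\<close> at \<open>p\<close>, and everything in sight is algebraic in
  \<open>t\<close>, so that the transport of a vector field by \<open>a t\<close> is a polynomial curve of vector fields.
\<close>

definition tangent_map ::
    "(complex \<Rightarrow> complex^3 \<Rightarrow> complex^3) \<Rightarrow> (complex \<Rightarrow> complex^3 \<Rightarrow> complex^3 \<Rightarrow> complex^3) \<Rightarrow> bool" where
  "tangent_map a J \<longleftrightarrow>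
     (\<forall>t \<gamma> w. (\<forall>s. \<gamma> s \<in> quadric 1) \<longrightarrow> curve_deriv \<gamma> w \<longrightarrow> curve_deriv (\<lambda>s. a t (\<gamma> s)) (J t (\<gamma> 0) w)) \<and>
     (\<forall>t p x y v w. J t p (x *s v + y *s w) = x *s J t p v + y *s J t p w) \<and>
     (\<forall>G V. (\<forall>i. poly_family (quadric 1) (\<lambda>t p. G t p $ i)) \<longrightarrow> (\<forall>i. poly_family (quadric 1) (\<lambda>t p. V t p $ i)) \<longrightarrow>
        (\<forall>i. poly_family (quadric 1) (\<lambda>t p. J t (G t p) (V t p) $ i))) \<and>
     (\<forall>i. poly_family (quadric 1) (\<lambda>t p. a (- t) p $ i))"

lemma tangent_mapD:
  assumes "tangent_map a J"
  shows "(\<And>s. \<gamma> s \<in> quadric 1) \<Longrightarrow> curve_deriv \<gamma> w \<Longrightarrow> curve_deriv (\<lambda>s. a t (\<gamma> s)) (J t (\<gamma> 0) w)"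
    and "J t p (x *s v + y *s w) = x *s J t p v + y *s J t p w"
    and "(\<And>i. poly_family (quadric 1) (\<lambda>t p. G t p $ i)) \<Longrightarrow> (\<And>i. poly_family (quadric 1) (\<lambda>t p. V t p $ i)) \<Longrightarrow>
        poly_family (quadric 1) (\<lambda>t p. J t (G t p) (V t p) $ i)"
    and "poly_family (quadric 1) (\<lambda>t p. a (- t) p $ i)"
  using assms unfolding tangent_map_def by simp_all

text \<open>
  A finite-dimensional representation of the group generated by the additive actions on
  \<open>quadric 1\<close>, seen through its values on these actions. The last assumption says that its
  differential is well defined, which is what regularity provides.
\<close>

locale action_rep =
  fixes \<Theta> :: "(complex \<Rightarrow> complex^3 \<Rightarrow> complex^3) \<Rightarrow> complex \<Rightarrow> complex^3^3"
  assumes \<Theta>_add: "additive_action (quadric 1) b \<Longrightarrow> \<Theta> b (s + t) = \<Theta> b s ** \<Theta> b t"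
    and \<Theta>_0: "additive_action (quadric 1) b \<Longrightarrow> \<Theta> b 0 = mat 1"
    and \<Theta>_conj: "additive_action (quadric 1) a \<Longrightarrow> additive_action (quadric 1) b \<Longrightarrow>
       \<Theta> (\<lambda>s p. a t (b s (a (- t) p))) s = \<Theta> a t ** \<Theta> b s ** \<Theta> a (- t)"
    and \<Theta>_poly: "additive_action (quadric 1) b \<Longrightarrow> \<exists>q. \<forall>s. \<Theta> b s $ i $ j = poly q s"
    and tangent_0: "tangent \<Theta> (\<lambda>p. 0) m \<Longrightarrow> m = 0"
begin

definition velocity :: "(complex \<Rightarrow> complex^3 \<Rightarrow> complex^3) \<Rightarrow> complex^3^3" where
  "velocity b = (\<chi> i j. deriv (\<lambda>s. \<Theta> b s $ i $ j) 0)"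

lemma matrix_deriv_velocity:
  assumes "additive_action (quadric 1) b" shows "matrix_deriv (\<Theta> b) (velocity b)"
  unfolding matrix_deriv_def
proof (intro allI)
  fix i j
  obtain q where "\<And>s. \<Theta> b s $ i $ j = poly q s" using \<Theta>_poly[OF assms] by blast
  then have "((\<lambda>s. \<Theta> b s $ i $ j) has_field_derivative poly (pderiv q) 0) (at 0)"
    using poly_DERIV[of q 0] by simp
  then show "((\<lambda>s. \<Theta> b s $ i $ j) has_field_derivative velocity b $ i $ j) (at 0)"
    by (simp add: velocity_def DERIV_imp_deriv)
qed

lemma matrix_deriv_velocity_minus:
  assumes "additive_action (quadric 1) b" shows "matrix_deriv (\<lambda>s. \<Theta> b (- s)) (- velocity b)"
  unfolding matrix_deriv_def
proof (intro allI)
  fix i j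
  have "((\<lambda>s. \<Theta> b s $ i $ j) has_field_derivative velocity b $ i $ j) (at (- 0))"
    using matrix_deriv_velocity[OF assms] by (simp add: matrix_deriv_def)
  from DERIV_chain2[OF this DERIV_minus[OF DERIV_ident]]
  show "((\<lambda>s. \<Theta> b (- s) $ i $ j) has_field_derivative (- velocity b) $ i $ j) (at 0)" by simp
qed

lemma tangent_velocity:
  assumes "additive_action (quadric 1) b" "\<And>p. p \<in> quadric 1 \<Longrightarrow> curve_deriv (\<lambda>s. b s p) (V p)"
  shows "tangent \<Theta> V (velocity b)"
  using assms matrix_deriv_velocity by (intro tangent.gen) auto

lemma tangent_unique: "tangent \<Theta> V m \<Longrightarrow> tangent \<Theta> V m' \<Longrightarrow> m = m'"
  using tangent_diff[of \<Theta> V m V m'] tangent_0[of "m - m'"] by simp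

lemma trivial_if_velocity_0:
  assumes b: "additive_action (quadric 1) b" and "velocity b = 0" shows "\<Theta> b s = mat 1"
proof -
  have "((\<lambda>t. \<Theta> b t $ i $ j) has_field_derivative 0) (at s)" for s i j
  proof -
    have "matrix_deriv (\<lambda>h. \<Theta> b s ** \<Theta> b h) (0 ** \<Theta> b 0 + \<Theta> b s ** velocity b)"
      by (rule matrix_deriv_mult[OF matrix_deriv_const matrix_deriv_velocity[OF b]])
    then have "matrix_deriv (\<lambda>h. \<Theta> b (s + h)) 0"
      unfolding \<Theta>_add[OF b] assms(2) by simp
    then have "((\<lambda>h. \<Theta> b (h + s) $ i $ j) has_field_derivative 0) (at 0)"
      by (simp add: matrix_deriv_def add.commute)
    then show ?thesis using DERIV_shift[of "\<lambda>t. \<Theta> b t $ i $ j" 0 0 s] by simp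
  qed
  then have "\<Theta> b s $ i $ j = \<Theta> b 0 $ i $ j" for i j
    using has_field_derivative_zero_constant[of UNIV "\<lambda>t. \<Theta> b t $ i $ j"] by (metis UNIV_I convex_UNIV)
  then show ?thesis using \<Theta>_0[OF b] by (simp add: vec_eq_iff)
qed

lemma tangent_polymap:
  assumes "tangent \<Theta> V m" shows "\<exists>\<Phi>. polymap \<Phi> \<and> (\<forall>p\<in>quadric 1. V p = \<Phi> p)"
  using assms
proof induction
  case (gen b V m)
  have "\<exists>P. is_poly coords P \<and> (\<forall>p\<in>quadric 1. V p $ i = P p)" for i
  proof -
    obtain c d where c: "\<And>p. degree (c p) \<le> d" "\<And>j. is_poly coords (\<lambda>p. coeff (c p) j)"
      "\<And>t p. p \<in> quadric 1 \<Longrightarrow> b t p $ i = poly (c p) t"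
      by (rule poly_familyE[OF additive_action_poly_family[OF gen(1), of i]]) (rule that)
    have "V p $ i = coeff (c p) 1" if "p \<in> quadric 1" for p
    proof (rule DERIV_unique)
      show "((\<lambda>s. b s p $ i) has_field_derivative V p $ i) (at 0)"
        using gen(2)[OF that] by (simp add: curve_deriv_def)
      show "((\<lambda>s. b s p $ i) has_field_derivative coeff (c p) 1) (at 0)"
        using poly_DERIV[of "c p" 0] by (simp add: c(3)[OF that] poly_0_coeff_0 coeff_pderiv)
    qed
    then show ?thesis using c(2) by blast
  qed
  then obtain P where "\<And>i. is_poly coords (P i)" "\<And>i p. p \<in> quadric 1 \<Longrightarrow> V p $ i = P i p"
    by metis
  then show ?case by (intro exI[of _ "\<lambda>p. \<chi> i. P i p"]) (simp add: polymap_def vec_eq_iff)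
next
  case (lin V m V' m' x y)
  then obtain \<Phi> \<Phi>' where "polymap \<Phi>" "\<forall>p\<in>quadric 1. V p = \<Phi> p" "polymap \<Phi>'" "\<forall>p\<in>quadric 1. V' p = \<Phi>' p"
    by blast
  then show ?case
    by (intro exI[of _ "\<lambda>p. x *s \<Phi> p + y *s \<Phi>' p"]) (auto simp: polymap_def intro!: is_poly_intros)
qed auto

text \<open>
  Conjugation with the time \<open>t\<close> of an action transports the generating vector fields and
  conjugates their images.
\<close>

lemma tangent_Ad:
  assumes a: "additive_action (quadric 1) a" "tangent_map a J" and V: "tangent \<Theta> V m"
  shows "tangent \<Theta> (\<lambda>p. J t (a (- t) p) (V (a (- t) p))) (\<Theta> a t ** m ** \<Theta> a (- t))"
  using V
proof induction
  case (gen b V m)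
  show ?case
  proof (rule tangent.gen)
    show "additive_action (quadric 1) (\<lambda>s p. a t (b s (a (- t) p)))"
      by (rule conj_action[OF a(1) gen(1)])
    show "curve_deriv (\<lambda>s. a t (b s (a (- t) p))) (J t (a (- t) p) (V (a (- t) p)))" if "p \<in> quadric 1" for p
    proof -
      let ?p = "a (- t) p"
      have p: "?p \<in> quadric 1" by (rule additive_actionD(1)[OF a(1) that])
      have "curve_deriv (\<lambda>s. a t (b s ?p)) (J t (b 0 ?p) (V ?p))"
        by (rule tangent_mapD(1)[OF a(2) _ gen(2)[OF p]]) (rule additive_actionD(1)[OF gen(1) p])
      then show ?thesis by (simp add: additive_actionD(2)[OF gen(1) p])
    qed
    have "matrix_deriv (\<lambda>s. \<Theta> a t ** \<Theta> b s) (\<Theta> a t ** m)"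
      using matrix_deriv_mult[OF matrix_deriv_const gen(3)] by simp
    from matrix_deriv_mult[OF this matrix_deriv_const]
    have "matrix_deriv (\<lambda>s. \<Theta> a t ** \<Theta> b s ** \<Theta> a (- t)) (\<Theta> a t ** m ** \<Theta> a (- t))" by simp
    moreover have "\<Theta> (\<lambda>s p. a t (b s (a (- t) p))) = (\<lambda>s. \<Theta> a t ** \<Theta> b s ** \<Theta> a (- t))"
      by (rule ext) (rule \<Theta>_conj[OF a(1) gen(1)])
    ultimately show "matrix_deriv (\<Theta> (\<lambda>s p. a t (b s (a (- t) p)))) (\<Theta> a t ** m ** \<Theta> a (- t))" by simp
  qed
next
  case (lin V m V' m' x y)
  have "\<Theta> a t ** (cscale x m + cscale y m') ** \<Theta> a (- t) =
      cscale x (\<Theta> a t ** m ** \<Theta> a (- t)) + cscale y (\<Theta> a t ** m' ** \<Theta> a (- t))"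
    by (simp add: vec_eq_iff matrix_matrix_mult_def sum.distrib sum_distrib_left sum_distrib_right algebra_simps)
  then show ?case
    using tangent.lin[OF lin(3,4), of x y] a(2) unfolding tangent_map_def by simp
next
  case (cong V m V')
  show ?case
    by (rule tangent.cong[OF cong(3)]) (simp add: cong(2) additive_actionD(1)[OF a(1)])
qed

text \<open>
  The differential respects Lie brackets: the coefficient of \<open>t\<close> in the transported vector field
  is the bracket with the generator of \<open>a\<close>, and the coefficient of \<open>t\<close> in the
  conjugated matrix is the commutator. This is where coefficients of polynomial curves are taken, as
  the bracket itself need not generate an action.
\<close>

lemma tangent_bracket:
  assumes a: "additive_action (quadric 1) a" "tangent_map a J" and V: "tangent \<Theta> V m"
    and W: "\<And>p. p \<in> quadric 1 \<Longrightarrow> curve_deriv (\<lambda>t. J t (a (- t) p) (V (a (- t) p))) (W p)"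
  shows "tangent \<Theta> W (velocity a ** m - m ** velocity a)"
proof -
  obtain \<Phi> where \<Phi>: "polymap \<Phi>" "\<And>p. p \<in> quadric 1 \<Longrightarrow> V p = \<Phi> p"
    using tangent_polymap[OF V] by blast
  let ?F = "\<lambda>t p. J t (a (- t) p) (V (a (- t) p))"
  have am: "poly_family (quadric 1) (\<lambda>t p. a (- t) p $ i)" for i
    using a(2) by (simp add: tangent_map_def)
  have "poly_family (quadric 1) (\<lambda>t p. V (a (- t) p) $ i)" for i
    by (rule poly_family_cong[OF poly_family_polymap_after[OF \<Phi>(1) am]])
      (simp add: \<Phi>(2) additive_actionD(1)[OF a(1)])
  then have F: "poly_family (quadric 1) (\<lambda>t p. ?F t p $ i)" for i
    by (intro tangent_mapD(3)[OF a(2)] am)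
  have "\<exists>c d. (\<forall>p. degree (c p) \<le> d) \<and> (\<forall>t. \<forall>p\<in>quadric 1. ?F t p $ i = poly (c p) t)" for i
    by (rule poly_familyE[OF F[of i]]) blast
  then obtain c d where c: "\<And>i p. degree (c i p) \<le> d i"
    "\<And>i t p. p \<in> quadric 1 \<Longrightarrow> ?F t p $ i = poly (c i p) t" by metis
  have c': "degree (c i p) \<le> Max (range d)" for i p
    using c(1)[of i p] Max_ge[of "range d" "d i"] by (meson finite finite_imageI order_trans rangeI)
  let ?M = "\<lambda>t. \<Theta> a t ** m ** \<Theta> a (- t)"
  have "\<exists>q. \<forall>t. ?M t $ i $ j = poly q t" for i j
  proof -
    have "\<exists>r. \<forall>k l t. \<Theta> a t $ k $ l = poly (r k l) t" using \<Theta>_poly[OF a(1)] by metis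
    then obtain r where r: "\<And>k l t. \<Theta> a t $ k $ l = poly (r k l) t" by blast
    show ?thesis
      by (rule exI[of _ "\<Sum>k\<in>UNIV. (\<Sum>l\<in>UNIV. r i l * [:m $ l $ k:]) * pcompose (r k j) [:0, - 1:]"])
        (simp add: matrix_matrix_mult_def r poly_sum poly_pcompose mult.commute)
  qed
  then obtain q where q: "\<And>i j t. ?M t $ i $ j = poly (q i j) t" by metis
  have "tangent \<Theta> (\<lambda>p. \<chi> i. poly (c i p) t) (\<chi> i j. poly (q i j) t)" for t
  proof -
    have M: "?M t = (\<chi> i j. poly (q i j) t)" by (simp add: vec_eq_iff q)
    show ?thesis
      by (rule tangent.cong[OF tangent_Ad[OF a V, of t, unfolded M]]) (simp add: vec_eq_iff c(2))
  qed
  then have 1: "tangent \<Theta> (\<lambda>p. \<chi> i. coeff (c i p) 1) (\<chi> i j. coeff (q i j) 1)"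
    using c' by (rule tangent_coeff)
  have "matrix_deriv ?M ((velocity a ** m + \<Theta> a 0 ** 0) ** \<Theta> a (- 0) + (\<Theta> a 0 ** m) ** (- velocity a))"
    by (rule matrix_deriv_mult[OF matrix_deriv_mult[OF matrix_deriv_velocity[OF a(1)] matrix_deriv_const] matrix_deriv_velocity_minus[OF a(1)]])
  then have 2: "matrix_deriv ?M (velocity a ** m - m ** velocity a)"
    by (simp add: \<Theta>_0[OF a(1)] matrix_mult_minus)
  have coeff: "(poly r has_field_derivative coeff r 1) (at 0)" for r :: "complex poly"
    using poly_DERIV[of r 0] by (simp add: poly_0_coeff_0 coeff_pderiv)
  have "(\<chi> i j. coeff (q i j) 1) = velocity a ** m - m ** velocity a"
    by (rule matrix_deriv_unique[OF _ 2]) (simp add: matrix_deriv_def q coeff[simplified])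
  moreover have "(\<chi> i. coeff (c i p) 1) = W p" if "p \<in> quadric 1" for p
    by (rule curve_deriv_unique[OF _ W[OF that]]) (simp add: curve_deriv_def c(2)[OF that] coeff[simplified])
  ultimately show ?thesis using tangent.cong[OF 1] by simp
qed

end

section \<open>Shears of the quadrics and their brackets\<close>

text \<open>
  The flow of the Hamiltonian vector field of a multiple of \<open>x\<^sup>n\<^sup>+\<^sup>1\<close>, for the coordinates
  \<open>(x, y, u)\<close>; the function \<open>x\<close> is constant along the flow. For \<open>n = 0\<close> these are
  the lower triangular unipotent matrices.
\<close>

definition shear :: "nat \<Rightarrow> complex \<Rightarrow> complex^3 \<Rightarrow> complex^3" where
  "shear n t v = vector [v $ 1, v $ 2 + t * v $ 1 ^ n * v $ 3 + t\<^sup>2 * v $ 1 ^ (2 * n + 1),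
     v $ 3 + 2 * t * v $ 1 ^ (n + 1)]"

text \<open>
  The mirror images, with \<open>x\<close> and \<open>y\<close> exchanged.
\<close>

definition coshear :: "nat \<Rightarrow> complex \<Rightarrow> complex^3 \<Rightarrow> complex^3" where
  "coshear n t v = vector [v $ 1 + t * v $ 2 ^ n * v $ 3 + t\<^sup>2 * v $ 2 ^ (2 * n + 1), v $ 2,
     v $ 3 + 2 * t * v $ 2 ^ (n + 1)]"

definition shear_field :: "nat \<Rightarrow> complex^3 \<Rightarrow> complex^3" where
  "shear_field n v = vector [0, v $ 1 ^ n * v $ 3, 2 * v $ 1 ^ (n + 1)]"

definition coshear_field :: "nat \<Rightarrow> complex^3 \<Rightarrow> complex^3" where
  "coshear_field n v = vector [v $ 2 ^ n * v $ 3, 0, 2 * v $ 2 ^ (n + 1)]"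

text \<open>
  The differential of \<open>shear n t\<close> at \<open>v\<close>, applied to \<open>w\<close>.
\<close>

definition dshear :: "nat \<Rightarrow> complex \<Rightarrow> complex^3 \<Rightarrow> complex^3 \<Rightarrow> complex^3" where
  "dshear n t v w = vector [w $ 1,
     w $ 2 + t * (of_nat n * v $ 1 ^ (n - 1) * w $ 1 * v $ 3 + v $ 1 ^ n * w $ 3)
       + t\<^sup>2 * (of_nat (2 * n + 1) * v $ 1 ^ (2 * n) * w $ 1),
     w $ 3 + 2 * t * (of_nat (n + 1) * v $ 1 ^ n * w $ 1)]"

lemma power_double: "x ^ (2 * n) = x ^ n * x ^ n" "x ^ (n * 2) = x ^ n * x ^ n" for x :: complex
  by (simp_all add: mult_2 mult_2_right power_add)

lemma shear_action: "additive_action (quadric c) (shear n)"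
  unfolding additive_action_iff
proof (intro conjI allI ballI)
  fix s t :: complex and p assume "p \<in> quadric c"
  then have p: "(p $ 3)\<^sup>2 - 4 * p $ 1 * p $ 2 = c" by (simp add: quadric_def)
  have "(shear n t p $ 3)\<^sup>2 - 4 * shear n t p $ 1 * shear n t p $ 2 = (p $ 3)\<^sup>2 - 4 * p $ 1 * p $ 2"
    by (simp add: shear_def power_double power2_eq_square algebra_simps)
  then show "shear n t p \<in> quadric c" using p by (simp add: quadric_def)
  show "shear n 0 p = p" by (simp add: vec_eq_iff forall_3 shear_def)
  show "shear n (s + t) p = shear n s (shear n t p)"
    by (simp add: vec_eq_iff forall_3 shear_def power_double power2_eq_square algebra_simps)
next
  show "poly_family (quadric c) (\<lambda>t p. shear n t p $ i)" for i
    using exhaust_3[of i] by (elim disjE; simp only: shear_def vector_3; intro poly_family_intros)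
qed

lemma coshear_action: "additive_action (quadric c) (coshear n)"
  unfolding additive_action_iff
proof (intro conjI allI ballI)
  fix s t :: complex and p assume "p \<in> quadric c"
  then have p: "(p $ 3)\<^sup>2 - 4 * p $ 1 * p $ 2 = c" by (simp add: quadric_def)
  have "(coshear n t p $ 3)\<^sup>2 - 4 * coshear n t p $ 1 * coshear n t p $ 2 = (p $ 3)\<^sup>2 - 4 * p $ 1 * p $ 2"
    by (simp add: coshear_def power_double power2_eq_square algebra_simps)
  then show "coshear n t p \<in> quadric c" using p by (simp add: quadric_def)
  show "coshear n 0 p = p" by (simp add: vec_eq_iff forall_3 coshear_def)
  show "coshear n (s + t) p = coshear n s (coshear n t p)"
    by (simp add: vec_eq_iff forall_3 coshear_def power_double power2_eq_square algebra_simps)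
next
  show "poly_family (quadric c) (\<lambda>t p. coshear n t p $ i)" for i
    using exhaust_3[of i] by (elim disjE; simp only: coshear_def vector_3; intro poly_family_intros)
qed

lemma curve_deriv_3: "curve_deriv (\<gamma> :: complex \<Rightarrow> complex^3) w \<longleftrightarrow>
    ((\<lambda>s. \<gamma> s $ 1) has_field_derivative w $ 1) (at 0) \<and>
    ((\<lambda>s. \<gamma> s $ 2) has_field_derivative w $ 2) (at 0) \<and>
    ((\<lambda>s. \<gamma> s $ 3) has_field_derivative w $ 3) (at 0)"
  by (simp add: curve_deriv_def forall_3)

lemma shear_curve_deriv: "curve_deriv (\<lambda>s. shear n s p) (shear_field n p)"
  unfolding curve_deriv_3 by (auto simp: shear_def shear_field_def intro!: derivative_eq_intros)

lemma coshear_curve_deriv: "curve_deriv (\<lambda>s. coshear n s p) (coshear_field n p)"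
  unfolding curve_deriv_3 by (auto simp: coshear_def coshear_field_def intro!: derivative_eq_intros)

lemma tangent_map_shear: "tangent_map (shear n) (dshear n)"
  unfolding tangent_map_def
proof (intro conjI allI impI)
  fix t and \<gamma> :: "complex \<Rightarrow> complex^3" and w assume "curve_deriv \<gamma> w"
  then have \<gamma>: "((\<lambda>s. \<gamma> s $ 1) has_field_derivative w $ 1) (at 0)"
    "((\<lambda>s. \<gamma> s $ 2) has_field_derivative w $ 2) (at 0)"
    "((\<lambda>s. \<gamma> s $ 3) has_field_derivative w $ 3) (at 0)" by (simp_all add: curve_deriv_3)
  show "curve_deriv (\<lambda>s. shear n t (\<gamma> s)) (dshear n t (\<gamma> 0) w)"
    unfolding curve_deriv_3 shear_def dshear_def vector_3
    by (intro conjI; (rule derivative_eq_intros \<gamma> refl)+; cases n; simp add: algebra_simps)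
next
  show "dshear n t p (x *s v + y *s w) = x *s dshear n t p v + y *s dshear n t p w" for t p x y v w
    by (simp add: vec_eq_iff forall_3 dshear_def algebra_simps)
next
  fix G V :: "complex \<Rightarrow> complex^3 \<Rightarrow> complex^3" and i
  assume "\<forall>i. poly_family (quadric 1) (\<lambda>t p. G t p $ i)" "\<forall>i. poly_family (quadric 1) (\<lambda>t p. V t p $ i)"
  then have GV: "\<And>i. poly_family (quadric 1) (\<lambda>t p. G t p $ i)" "\<And>i. poly_family (quadric 1) (\<lambda>t p. V t p $ i)" by auto
  show "poly_family (quadric 1) (\<lambda>t p. dshear n t (G t p) (V t p) $ i)"
    using exhaust_3[of i] by (elim disjE; simp only: dshear_def vector_3; intro poly_family_intros GV)
next
  show "poly_family (quadric 1) (\<lambda>t p. shear n (- t) p $ i)" for i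
    using exhaust_3[of i] by (elim disjE; simp only: shear_def vector_3; intro poly_family_intros)
qed

lemma tangent_map_coshear: "tangent_map (coshear 0) (\<lambda>t p. coshear 0 t)"
  unfolding tangent_map_def
proof (intro conjI allI impI)
  fix t and \<gamma> :: "complex \<Rightarrow> complex^3" and w assume "curve_deriv \<gamma> w"
  then have \<gamma>: "((\<lambda>s. \<gamma> s $ 1) has_field_derivative w $ 1) (at 0)"
    "((\<lambda>s. \<gamma> s $ 2) has_field_derivative w $ 2) (at 0)"
    "((\<lambda>s. \<gamma> s $ 3) has_field_derivative w $ 3) (at 0)" by (simp_all add: curve_deriv_3)
  show "curve_deriv (\<lambda>s. coshear 0 t (\<gamma> s)) (coshear 0 t w)"
    unfolding curve_deriv_3
    by (auto simp: coshear_def algebra_simps intro!: derivative_eq_intros \<gamma>)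
next
  show "coshear 0 t (x *s v + y *s w) = x *s coshear 0 t v + y *s coshear 0 t w" for t x y v w
    by (simp add: vec_eq_iff forall_3 coshear_def algebra_simps)
next
  fix V :: "complex \<Rightarrow> complex^3 \<Rightarrow> complex^3" and i
  assume "\<forall>i. poly_family (quadric 1) (\<lambda>t p. V t p $ i)"
  then have V: "\<And>i. poly_family (quadric 1) (\<lambda>t p. V t p $ i)" by auto
  show "poly_family (quadric 1) (\<lambda>t p. coshear 0 t (V t p) $ i)"
    using exhaust_3[of i] by (elim disjE; simp only: coshear_def vector_3; intro poly_family_intros V)
next
  show "poly_family (quadric 1) (\<lambda>t p. coshear 0 (- t) p $ i)" for i
    using exhaust_3[of i] by (elim disjE; simp only: coshear_def vector_3; intro poly_family_intros)
qed

text \<open>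
  \<open>W\<close> is the bracket of the generator of the shears with \<open>V\<close>, given as the derivative of
  the transported vector field. Below, \<open>E n\<close> and \<open>F n\<close> stand for the generators of
  \<open>shear n\<close> and \<open>coshear n\<close>; the fields \<open>E 0\<close> and \<open>F 0\<close> generate the Lie algebra
  of \<open>SL\<^sub>2\<close>.
\<close>

definition ad_shear where
  "ad_shear n V W \<longleftrightarrow> (\<forall>p. curve_deriv (\<lambda>t. dshear n t (shear n (- t) p) (V (shear n (- t) p))) (W p))"

definition ad_coshear where
  "ad_coshear V W \<longleftrightarrow> (\<forall>p. curve_deriv (\<lambda>t. coshear 0 t (V (coshear 0 (- t) p))) (W p))"

text \<open>
  The bracket of \<open>F 0\<close> with \<open>E n\<close>.
\<close>

definition bracket_F_E :: "nat \<Rightarrow> complex^3 \<Rightarrow> complex^3" where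
  "bracket_F_E n v = vector [2 * v $ 1 ^ (n + 1), - (of_nat n * v $ 1 ^ (n - 1) * (v $ 3)\<^sup>2 + 2 * v $ 1 ^ n * v $ 2),
     - 2 * of_nat n * v $ 1 ^ n * v $ 3]"

lemma ad_coshear_shear_field: "ad_coshear (shear_field n) (bracket_F_E n)"
  unfolding ad_coshear_def curve_deriv_3 coshear_def shear_field_def bracket_F_E_def vector_3
  by (intro allI conjI; (rule derivative_eq_intros refl)+; simp add: algebra_simps power2_eq_square power3_eq_cube)

text \<open>
  Since \<open>E 0\<close> commutes with \<open>E n\<close>, this is the action of the torus: \<open>E n\<close> is a
  weight vector, with a weight that grows with \<open>n\<close>.
\<close>

lemma ad_shear_bracket_F_E: "ad_shear 0 (bracket_F_E n) (\<lambda>p. (2 * of_nat n + 2) *s shear_field n p)"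
  unfolding ad_shear_def curve_deriv_3 shear_def dshear_def shear_field_def bracket_F_E_def vector_smult_component vector_3
  by (intro allI conjI; (rule derivative_eq_intros refl)+; cases n; simp add: algebra_simps power2_eq_square power3_eq_cube)

text \<open>
  The iterated bracket of \<open>F 0\<close>, twice, with \<open>E (k + 2)\<close>.
\<close>

definition bracket_FF_E :: "nat \<Rightarrow> complex^3 \<Rightarrow> complex^3" where
  "bracket_FF_E k v = vector [- (4 * of_nat k + 10) * v $ 1 ^ (k + 2) * v $ 3,
     of_nat (k + 1) * of_nat (k + 2) * v $ 1 ^ k * v $ 3 ^ 3 + 6 * of_nat (k + 2) * v $ 1 ^ (k + 1) * v $ 3 * v $ 2,
     2 * of_nat (k + 1) * of_nat (k + 2) * v $ 1 ^ (k + 1) * (v $ 3)\<^sup>2 + 4 * of_nat (k + 1) * v $ 1 ^ (k + 2) * v $ 2]"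

lemma ad_coshear_bracket_F_E: "ad_coshear (bracket_F_E (k + 2)) (bracket_FF_E k)"
  unfolding ad_coshear_def curve_deriv_3 coshear_def bracket_FF_E_def bracket_F_E_def vector_3
  by (intro allI conjI; (rule derivative_eq_intros refl)+; simp add: algebra_simps power2_eq_square power3_eq_cube)

text \<open>
  The bracket of \<open>E (k + 1)\<close> with \<open>F 1\<close>.
\<close>

definition bracket_E_F1 :: "nat \<Rightarrow> complex^3 \<Rightarrow> complex^3" where
  "bracket_E_F1 k v = vector [- (v $ 1 ^ (k + 1)) * (v $ 3)\<^sup>2 - 2 * v $ 1 ^ (k + 2) * v $ 2,
     of_nat (k + 1) * v $ 1 ^ k * v $ 2 * (v $ 3)\<^sup>2 + 2 * v $ 1 ^ (k + 1) * (v $ 2)\<^sup>2,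
     2 * of_nat k * v $ 1 ^ (k + 1) * v $ 2 * v $ 3]"

lemma ad_shear_coshear_field: "ad_shear (k + 1) (coshear_field 1) (bracket_E_F1 k)"
  unfolding ad_shear_def curve_deriv_3 shear_def dshear_def bracket_E_F1_def coshear_field_def vector_3
  by (intro allI conjI; (rule derivative_eq_intros refl)+; simp add: algebra_simps power2_eq_square power3_eq_cube)

text \<open>
  The bracket of \<open>E 0\<close> with the one of \<open>E (k + 1)\<close> and \<open>F 1\<close>.
\<close>

definition bracket_EE_F1 :: "nat \<Rightarrow> complex^3 \<Rightarrow> complex^3" where
  "bracket_EE_F1 k v = vector [6 * v $ 1 ^ (k + 2) * v $ 3,
     - of_nat (k + 1) * v $ 1 ^ k * v $ 3 ^ 3 - (2 * of_nat k + 8) * v $ 1 ^ (k + 1) * v $ 3 * v $ 2,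
     - 2 * of_nat (k + 1) * v $ 1 ^ (k + 1) * (v $ 3)\<^sup>2 - 4 * of_nat (k + 1) * v $ 1 ^ (k + 2) * v $ 2]"

lemma ad_shear_bracket_E_F1: "ad_shear 0 (bracket_E_F1 k) (bracket_EE_F1 k)"
  unfolding ad_shear_def curve_deriv_3 shear_def dshear_def bracket_E_F1_def bracket_EE_F1_def vector_3
  by (intro allI conjI; (rule derivative_eq_intros refl)+; simp add: algebra_simps power2_eq_square power3_eq_cube)

text \<open>
  The step that distinguishes the smooth quadric from the cone. In terms of Hamiltonian functions,
  \<open>x\<^sup>k\<^sup>+\<^sup>1\<close> is a combination of the Poisson brackets \<open>{y, {y, x\<^sup>k\<^sup>+\<^sup>3}}\<close> and
  \<open>{x, {x\<^sup>k\<^sup>+\<^sup>2, y\<^sup>2}}\<close>. These have the weight of \<open>x\<^sup>k\<^sup>+\<^sup>1\<close> but a higher degree, and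
  the factors are chosen such that the combination is a multiple of \<open>u\<^sup>2 - 4xy\<close>. On the cone
  it vanishes; there the bracket is graded and cannot lower the degree.
\<close>

lemma bracket_combination:
  assumes "p \<in> quadric 1"
  shows "6 *s bracket_FF_E k p + (4 * of_nat k + 10) *s bracket_EE_F1 k p = (2 * of_nat (k + 1) ^ 2) *s shear_field k p"
proof -
  have p: "p $ 3 * p $ 3 = 1 + 4 * p $ 1 * p $ 2"
    using assms by (simp add: quadric_def power2_eq_square algebra_simps)
  show ?thesis
    by (simp add: vec_eq_iff forall_3 bracket_FF_E_def bracket_EE_F1_def shear_field_def power2_eq_square power3_eq_cube p algebra_simps)
qed

lemma ad_coshear_bracket_F_E_0: "ad_coshear (bracket_F_E 0) (\<lambda>p. (- 2) *s coshear_field 0 p)"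
  unfolding ad_coshear_def curve_deriv_3 coshear_def coshear_field_def bracket_F_E_def vector_smult_component vector_3
  by (intro allI conjI; (rule derivative_eq_intros refl)+; simp add: algebra_simps power2_eq_square power3_eq_cube)

section \<open>The shears lie in the kernel\<close>

lemma eigenvectors_independent:
  fixes f :: "'a::real_vector \<Rightarrow> 'a" and c :: "nat \<Rightarrow> real"
  assumes "linear f" "\<And>n. f (v n) = c n *\<^sub>R v n" "inj c" "\<And>n. v n \<noteq> 0"
  shows "independent (v ` {..<n})"
proof (induction n)
  case (Suc n)
  define g where "g i w = f w - c i *\<^sub>R w" for i w
  have g: "linear (g i)" for i
    unfolding g_def by (intro linear_compose_sub assms(1) linear_scale_self)
  have gv: "g i (v j) = (c j - c i) *\<^sub>R v j" for i j
    by (simp add: g_def assms(2) algebra_simps)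
  \<comment> \<open>The product of the operators \<open>f - c i\<close> for \<open>i < m\<close> kills the first \<open>m\<close> eigenvectors and no other one.\<close>
  have kill: "\<exists>h. linear h \<and> (\<forall>w\<in>span (v ` {..<m}). h w = 0) \<and>
      (\<forall>j. h (v j) = (\<Prod>i<m. c j - c i) *\<^sub>R v j)" for m
  proof (induction m)
    case 0
    show ?case by (intro exI[of _ "\<lambda>w. w"]) (auto simp: linear_id[unfolded id_def])
  next
    case (Suc m)
    then obtain h where h: "linear h" "\<And>w. w \<in> span (v ` {..<m}) \<Longrightarrow> h w = 0"
      "\<And>j. h (v j) = (\<Prod>i<m. c j - c i) *\<^sub>R v j" by blast
    have lin: "linear (\<lambda>w. g m (h w))"
      using linear_compose[OF h(1) g[of m]] by (simp add: o_def)
    have ev: "g m (h (v j)) = (\<Prod>i<Suc m. c j - c i) *\<^sub>R v j" for j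
      by (simp add: h(3) linear_scale[OF g] gv)
    have "g m (h w) = 0" if "w \<in> span (v ` {..<Suc m})" for w
    proof (rule linear_eq_0_on_span[OF lin _ that])
      show "g m (h x) = 0" if "x \<in> v ` {..<Suc m}" for x
        using that ev by (auto simp: lessThan_Suc)
    qed
    then show ?case using lin ev by blast
  qed
  obtain h where h: "\<forall>w\<in>span (v ` {..<n}). h w = 0" "h (v n) = (\<Prod>i<n. c n - c i) *\<^sub>R v n"
    using kill[of n] by blast
  have "h (v n) \<noteq> 0" using assms(3,4) by (auto simp: h(2) inj_eq)
  then have "v n \<notin> span (v ` {..<n})" using h(1) by blast
  then show ?case using Suc by (simp add: lessThan_Suc independent_insert)
qed (simp add: independent_empty)

text \<open>
  Eigenvectors for different eigenvalues are independent, so that only finitely many of them can be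
  nonzero.
\<close>

lemma eigenvectors_finite:
  fixes f :: "'a::euclidean_space \<Rightarrow> 'a" and c :: "nat \<Rightarrow> real"
  assumes "linear f" "\<And>n. f (v n) = c n *\<^sub>R v n" "inj c"
  shows "finite {n. v n \<noteq> 0}"
proof (rule ccontr)
  assume inf: "infinite {n. v n \<noteq> 0}"
  define r where "r = enumerate {n. v n \<noteq> 0}"
  have r: "strict_mono r" "\<And>n. v (r n) \<noteq> 0"
    using strict_mono_enumerate[OF inf] enumerate_in_set[OF inf] by (auto simp: r_def)
  then have "inj r" by (simp add: strict_mono_imp_inj_on)
  have ind: "independent ((\<lambda>n. v (r n)) ` {..<n})" for n
    by (rule eigenvectors_independent[OF assms(1), of _ "\<lambda>n. c (r n)"])
      (use assms(2,3) r(2) \<open>inj r\<close> in \<open>auto simp: inj_def\<close>)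
  have inj: "inj (\<lambda>n. v (r n))"
  proof (rule injI)
    fix i j assume e: "v (r i) = v (r j)"
    then have "c (r i) *\<^sub>R v (r i) = c (r j) *\<^sub>R v (r i)" using assms(2) by metis
    then show "i = j" using r(2) assms(3) \<open>inj r\<close> by (auto simp: inj_eq)
  qed
  have "card ((\<lambda>n. v (r n)) ` {..<Suc DIM('a)}) = Suc DIM('a)"
    by (simp add: card_image inj_on_subset[OF inj])
  then show False using independent_bound[OF ind[of "Suc DIM('a)"]] by simp
qed

lemma cscale_zero: "cscale c 0 = 0"
  by (simp add: vec_eq_iff)

lemma linear_commutator: "linear (\<lambda>N. A ** N - N ** A)" for A :: "complex^'n^'n"
proof (rule linearI)
  show "A ** (r *\<^sub>R N) - (r *\<^sub>R N) ** A = r *\<^sub>R (A ** N - N ** A)" for r N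
    by (simp add: vec_eq_iff matrix_matrix_mult_def scaleR_sum_right scaleR_diff_right)
qed (simp add: vec_eq_iff matrix_matrix_mult_def sum.distrib algebra_simps)

context action_rep
begin

lemma tangent_shear_field: "tangent \<Theta> (shear_field n) (velocity (shear n))"
  by (rule tangent_velocity[OF shear_action shear_curve_deriv])

lemma tangent_coshear_field: "tangent \<Theta> (coshear_field n) (velocity (coshear n))"
  by (rule tangent_velocity[OF coshear_action coshear_curve_deriv])

lemma tangent_ad_shear:
  "tangent \<Theta> V m \<Longrightarrow> ad_shear n V W \<Longrightarrow> tangent \<Theta> W (velocity (shear n) ** m - m ** velocity (shear n))"
  by (rule tangent_bracket[OF shear_action tangent_map_shear]) (auto simp: ad_shear_def)

lemma tangent_ad_coshear:
  "tangent \<Theta> V m \<Longrightarrow> ad_coshear V W \<Longrightarrow> tangent \<Theta> W (velocity (coshear 0) ** m - m ** velocity (coshear 0))"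
  by (rule tangent_bracket[OF coshear_action tangent_map_coshear]) (auto simp: ad_coshear_def)

text \<open>
  The images of the \<open>E n\<close> are eigenvectors, for pairwise different eigenvalues, of one operator
  on the space of matrices, namely of the image of the torus in the adjoint representation.
\<close>

lemma velocity_shear_eventually_0: "finite {n. velocity (shear n) \<noteq> 0}"
proof -
  define f where "f N = velocity (shear 0) ** (velocity (coshear 0) ** N - N ** velocity (coshear 0)) -
      (velocity (coshear 0) ** N - N ** velocity (coshear 0)) ** velocity (shear 0)" for N
  have f: "linear f"
    using linear_compose[OF linear_commutator linear_commutator, of "velocity (shear 0)" "velocity (coshear 0)"]
      linear_compose[OF linear_commutator linear_commutator, of "velocity (coshear 0)" "velocity (shear 0)"]
    by (simp add: f_def[abs_def] o_def)
  have "f (velocity (shear n)) = cscale (2 * of_nat n + 2) (velocity (shear n))" for n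
  proof (rule tangent_unique)
    show "tangent \<Theta> (\<lambda>p. (2 * of_nat n + 2) *s shear_field n p) (f (velocity (shear n)))"
      unfolding f_def
      by (rule tangent_ad_shear[OF tangent_ad_coshear[OF tangent_shear_field ad_coshear_shear_field] ad_shear_bracket_F_E])
    show "tangent \<Theta> (\<lambda>p. (2 * of_nat n + 2) *s shear_field n p) (cscale (2 * of_nat n + 2) (velocity (shear n)))"
      by (rule tangent_scale[OF tangent_shear_field])
  qed
  moreover have "cscale (2 * of_nat n + 2) N = (2 * real n + 2) *\<^sub>R N" for n and N :: "complex^3^3"
    by (simp add: vec_eq_iff scaleR_conv_of_real[of _ "N $ _ $ _"])
  ultimately have "f (velocity (shear n)) = (2 * real n + 2) *\<^sub>R velocity (shear n)" for n by metis
  then show ?thesis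
    by (rule eigenvectors_finite[OF f, of "\<lambda>n. velocity (shear n)"]) (auto intro: injI)
qed

text \<open>
  The kernel of the differential is an ideal, which contains the brackets of \<open>E (k + 1)\<close> and
  \<open>E (k + 2)\<close> with everything, hence also \<open>E k\<close>.
\<close>

lemma velocity_shear_down:
  assumes "velocity (shear (k + 1)) = 0" "velocity (shear (k + 2)) = 0"
  shows "velocity (shear k) = 0"
proof -
  have "tangent \<Theta> (bracket_F_E (k + 2)) 0"
    using tangent_ad_coshear[OF tangent_shear_field ad_coshear_shear_field, of "k + 2"] assms(2) by simp
  from tangent_ad_coshear[OF this ad_coshear_bracket_F_E] have A: "tangent \<Theta> (bracket_FF_E k) 0" by simp
  have "tangent \<Theta> (bracket_E_F1 k) 0"
    using tangent_ad_shear[OF tangent_coshear_field ad_shear_coshear_field, of k] assms(1) by simp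
  from tangent_ad_shear[OF this ad_shear_bracket_E_F1] have B: "tangent \<Theta> (bracket_EE_F1 k) 0" by simp
  have "tangent \<Theta> (\<lambda>p. 6 *s bracket_FF_E k p + (4 * of_nat k + 10) *s bracket_EE_F1 k p) 0"
    using tangent.lin[OF A B, of 6 "4 * of_nat k + 10"] by (simp add: cscale_zero)
  from tangent.cong[OF this bracket_combination]
  have "tangent \<Theta> (\<lambda>p. (2 * of_nat (k + 1) ^ 2) *s shear_field k p) (cscale (2 * of_nat (k + 1) ^ 2) 0)"
    by (simp add: cscale_zero)
  moreover have "2 * of_nat (k + 1) ^ 2 \<noteq> (0 :: complex)"
    by (simp only: mult_eq_0_iff power_eq_0_iff of_nat_eq_0_iff) simp
  ultimately have "tangent \<Theta> (shear_field k) 0" by (rule tangent_unscale)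
  then show ?thesis using tangent_unique tangent_shear_field by blast
qed

lemma velocity_shear_0: "velocity (shear n) = 0"
proof -
  have "\<exists>N. \<forall>n\<ge>N. velocity (shear n) = 0"
  proof -
    obtain N where "\<forall>n\<in>{n. velocity (shear n) \<noteq> 0}. n < N"
      using velocity_shear_eventually_0 unfolding finite_nat_set_iff_bounded by blast
    then show ?thesis by (intro exI[of _ N]) (auto simp: not_less[symmetric])
  qed
  then obtain N where N: "\<And>n. n \<ge> N \<Longrightarrow> velocity (shear n) = 0" by blast
  have "\<forall>n\<ge>N - j. velocity (shear n) = 0" for j
  proof (induction j)
    case (Suc j)
    show ?case
    proof (intro allI impI)
      fix n assume n: "n \<ge> N - Suc j"
      then have "n + 1 \<ge> N - j" "n + 2 \<ge> N - j" by linarith+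
      then show "velocity (shear n) = 0" using Suc.IH by (metis velocity_shear_down)
    qed
  qed (use N in auto)
  from this[of N] show ?thesis by simp
qed

lemma velocity_coshear_0: "velocity (coshear 0) = 0"
proof -
  have "tangent \<Theta> (bracket_F_E 0) 0"
    using tangent_ad_coshear[OF tangent_shear_field ad_coshear_shear_field, of 0] by (simp add: velocity_shear_0)
  from tangent_ad_coshear[OF this ad_coshear_bracket_F_E_0]
  have "tangent \<Theta> (\<lambda>p. (- 2) *s coshear_field 0 p) (cscale (- 2) 0)"
    by (simp add: cscale_zero)
  then have "tangent \<Theta> (coshear_field 0) 0" by (rule tangent_unscale) simp
  then show ?thesis using tangent_unique tangent_coshear_field by blast
qed

end

section \<open>Averaging over the special linear group\<close>

text \<open>
  The diagonal matrix with entries \<open>s\<close> and \<open>1/s\<close> acts as \<open>stretch (s\<^sup>2)\<close>.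
\<close>

definition stretch :: "complex \<Rightarrow> complex^3 \<Rightarrow> complex^3" where
  "stretch c v = vector [c * v $ 1, v $ 2 / c, v $ 3]"

lemma stretch_nth:
  "stretch c v $ 1 = c * v $ 1" "stretch c v $ 2 = v $ 2 / c" "stretch c v $ 3 = v $ 3"
  by (simp_all add: stretch_def)

text \<open>
  The diagonal matrix with entries \<open>2\<close> and \<open>1/2\<close> as a product of four elementary
  matrices. It has infinite order, so that this one element separates all weights.
\<close>

lemma stretch_eq_shears:
  "shear 0 (- 1 / 2) (coshear 0 1 (shear 0 1 (coshear 0 (- 1 / 2) v))) = stretch 4 v"
  "coshear 0 (1 / 2) (shear 0 (- 1) (coshear 0 (- 1) (shear 0 (1 / 2) v))) = stretch (1 / 4) v"
  by (simp_all add: vec_eq_iff forall_3 shear_def coshear_def stretch_def field_simps power2_eq_square)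

text \<open>
  The functions of weight \<open>k\<close> for the torus. On \<open>quadric 1\<close> the product \<open>xy\<close> is a
  polynomial in \<open>u\<close>, so that each monomial can be written with \<open>x\<close> alone or with
  \<open>y\<close> alone.
\<close>

definition wt :: "int \<Rightarrow> complex poly \<Rightarrow> complex^3 \<Rightarrow> complex" where
  "wt k A p = (if k \<ge> 0 then p $ 1 ^ nat k else p $ 2 ^ nat (- k)) * poly A (p $ 3)"

lemma quadric_xy: "p \<in> quadric 1 \<Longrightarrow> p $ 1 * p $ 2 = ((p $ 3)\<^sup>2 - 1) / 4"
  by (simp add: quadric_def field_simps)

lemma wt_mult_coord: "\<exists>k' A'. \<forall>p\<in>quadric 1. p $ i * wt k A p = wt k' A' p"
proof -
  have r: "poly [:- 1 / 4, 0, 1 / 4:] u = (u\<^sup>2 - 1) / 4" for u :: complex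
    by (simp add: field_simps power2_eq_square)
  consider "i = 1" "k \<ge> 0" | "i = 1" "k < 0" | "i = 2" "k > 0" | "i = 2" "k \<le> 0" | "i = 3"
    using exhaust_3[of i] by linarith
  then show ?thesis
  proof cases
    case 1
    then have "nat (k + 1) = Suc (nat k)" by simp
    then show ?thesis using 1 by (intro exI[of _ "k + 1"] exI[of _ A]) (simp add: wt_def)
  next
    case 2
    then have e: "nat (- k) = Suc (nat (- (k + 1)))" by simp
    show ?thesis
    proof (intro exI ballI)
      fix p assume p: "p \<in> quadric 1"
      have "p $ 1 * wt k A p = (p $ 1 * p $ 2) * (p $ 2 ^ nat (- (k + 1)) * poly A (p $ 3))"
        using 2 by (simp add: wt_def e)
      also have "\<dots> = p $ 2 ^ nat (- (k + 1)) * poly ([:- 1 / 4, 0, 1 / 4:] * A) (p $ 3)"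
        unfolding quadric_xy[OF p] poly_mult r by simp
      also have "\<dots> = wt (k + 1) ([:- 1 / 4, 0, 1 / 4:] * A) p"
        using 2 by (auto simp: wt_def)
      finally show "p $ i * wt k A p = wt (k + 1) ([:- 1 / 4, 0, 1 / 4:] * A) p" using 2 by simp
    qed
  next
    case 3
    then have e: "nat k = Suc (nat (k - 1))" by simp
    show ?thesis
    proof (intro exI ballI)
      fix p assume p: "p \<in> quadric 1"
      have "p $ 2 * wt k A p = (p $ 1 * p $ 2) * (p $ 1 ^ nat (k - 1) * poly A (p $ 3))"
        using 3 by (simp add: wt_def e)
      also have "\<dots> = p $ 1 ^ nat (k - 1) * poly ([:- 1 / 4, 0, 1 / 4:] * A) (p $ 3)"
        unfolding quadric_xy[OF p] poly_mult r by simp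
      also have "\<dots> = wt (k - 1) ([:- 1 / 4, 0, 1 / 4:] * A) p"
        using 3 by (auto simp: wt_def)
      finally show "p $ i * wt k A p = wt (k - 1) ([:- 1 / 4, 0, 1 / 4:] * A) p" using 3 by simp
    qed
  next
    case 4
    then have e: "nat (- (k - 1)) = Suc (nat (- k))" "nat (1 - k) = Suc (nat (- k))" by simp_all
    show ?thesis using 4 by (intro exI[of _ "k - 1"] exI[of _ A]) (auto simp: wt_def e)
  next
    case 5
    then show ?thesis by (intro exI[of _ k] exI[of _ "[:0, 1:] * A"]) (simp add: wt_def)
  qed
qed

lemma mono_fun_wt:
  "mono_fun coords n m \<Longrightarrow> \<exists>k A. \<forall>p\<in>quadric 1. m p = wt k A p"
proof (induction rule: mono_fun.induct)
  case (mono_one n)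
  show ?case by (intro exI[of _ 0] exI[of _ 1]) (simp add: wt_def)
next
  case (mono_step f n m)
  then obtain k A i where "\<And>p. p \<in> quadric 1 \<Longrightarrow> m p = wt k A p" "f = (\<lambda>p. p $ i)"
    by (auto simp: coords_def)
  then show ?case using wt_mult_coord[of i k A] by simp
qed

lemma wt_smult: "wt k (Polynomial.smult c A) p = c * wt k A p"
  by (simp add: wt_def)

lemma is_poly_wt:
  assumes "is_poly coords P"
  obtains ts where "\<And>p. p \<in> quadric 1 \<Longrightarrow> P p = (\<Sum>(k, A)\<leftarrow>ts. wt k A p)"
proof -
  obtain n where "poly_fun coords n P" using assms by (auto simp: is_poly_def)
  then have "mono_span coords n P" by (rule poly_fun_span)
  then have "\<exists>ts. \<forall>p\<in>quadric 1. P p = (\<Sum>(k, A)\<leftarrow>ts. wt k A p)"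
  proof induction
    case span_zero
    show ?case by (intro exI[of _ "[]"]) simp
  next
    case (span_add m f c)
    obtain k A where "\<And>p. p \<in> quadric 1 \<Longrightarrow> m p = wt k A p" using mono_fun_wt[OF span_add(1)] by blast
    moreover obtain ts where "\<forall>p\<in>quadric 1. f p = (\<Sum>(k, A)\<leftarrow>ts. wt k A p)" using span_add(3) by blast
    ultimately show ?case by (intro exI[of _ "(k, Polynomial.smult c A) # ts"]) (simp add: wt_smult)
  qed
  then show ?thesis using that by blast
qed

definition wt_index :: "3 \<Rightarrow> int" where
  "wt_index i = (if i = 1 then 1 else if i = 2 then - 1 else 0)"

text \<open>
  The vector field whose component with index \<open>i\<close> is a function of weight \<open>k\<close> and whose other
  components vanish; it is an eigenvector of the torus of weight \<open>wt_index i - k\<close>.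
\<close>

definition wt_field :: "3 \<times> int \<times> complex poly \<Rightarrow> complex^3 \<Rightarrow> complex^3" where
  "wt_field \<tau> p = axis (fst \<tau>) (wt (fst (snd \<tau>)) (snd (snd \<tau>)) p)"

definition wt_factor :: "3 \<times> int \<times> complex poly \<Rightarrow> complex" where
  "wt_factor \<tau> = 4 powi (wt_index (fst \<tau>) - fst (snd \<tau>))"

lemma wt_stretch: "wt k A (stretch (1 / 4) p) = 4 powi (- k) * wt k A p"
  by (simp add: wt_def stretch_def power_int_def power_mult_distrib field_simps)

lemma stretch_wt_field: "stretch 4 (wt_field \<tau> (stretch (1 / 4) p)) = wt_factor \<tau> *s wt_field \<tau> p"
proof -
  obtain i k A where \<tau>: "\<tau> = (i, k, A)" by (cases \<tau>)
  consider "i = 1" | "i = 2" | "i = 3" using exhaust_3 by blast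
  then show ?thesis
    by cases (simp_all add: \<tau> wt_field_def wt_factor_def wt_index_def wt_stretch vec_eq_iff forall_3
        stretch_nth axis_def power_int_diff power_int_minus field_simps)
qed

lemma wt_factor_1: "wt_factor (i, k, A) = 1 \<longleftrightarrow> k = wt_index i"
proof -
  have "(4::complex) powi j = 1 \<longleftrightarrow> j = 0" for j
  proof
    assume "(4::complex) powi j = 1"
    then have "norm ((4::complex) powi j) = 1" by simp
    then have e: "(4::real) powi j = 4 powi 0" by (simp add: norm_power_int)
    show "j = 0"
      using power_int_strict_increasing[of j 0 "4 :: real"] power_int_strict_increasing[of 0 j "4 :: real"] e
      by (cases j "0 :: int" rule: linorder_cases) auto
  qed simp
  then show ?thesis by (auto simp: wt_factor_def)
qed

lemma stretch_sum: "stretch c (\<Sum>\<tau>\<leftarrow>ts. Z \<tau>) = (\<Sum>\<tau>\<leftarrow>ts. stretch c (Z \<tau>))"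
  by (induction ts) (auto simp: stretch_def vec_eq_iff forall_3 distrib_left add_divide_distrib)

lemma sum_wt_index_field:
  assumes "\<And>i k A. (i, k, A) \<in> set ts \<Longrightarrow> k = wt_index i"
  shows "\<exists>A B C. \<forall>p. (\<Sum>\<tau>\<leftarrow>ts. wt_field \<tau> p) = vector [p $ 1 * poly A (p $ 3), p $ 2 * poly B (p $ 3), poly C (p $ 3)]"
  using assms
proof (induction ts)
  case Nil
  show ?case by (intro exI[of _ 0]) (simp add: vec_eq_iff forall_3)
next
  case (Cons \<tau> ts)
  then obtain A B C where ABC: "\<And>p. (\<Sum>\<tau>\<leftarrow>ts. wt_field \<tau> p) = vector [p $ 1 * poly A (p $ 3), p $ 2 * poly B (p $ 3), poly C (p $ 3)]"
    by (metis list.set_intros(2))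
  obtain i k D where \<tau>: "\<tau> = (i, k, D)" by (cases \<tau>)
  then have k: "k = wt_index i" using Cons.prems by auto
  have sum: "(\<Sum>\<tau>\<leftarrow>\<tau> # ts. wt_field \<tau> p) = wt_field \<tau> p + (\<Sum>\<tau>\<leftarrow>ts. wt_field \<tau> p)" for p by simp
  consider "i = 1" | "i = 2" | "i = 3" using exhaust_3 by blast
  then show ?case
  proof cases
    case 1 show ?thesis
      by (rule exI[of _ "A + D"], rule exI[of _ B], rule exI[of _ C], unfold sum ABC)
        (simp add: 1 \<tau> k wt_field_def wt_index_def wt_def axis_def vec_eq_iff forall_3 algebra_simps)
  next
    case 2 show ?thesis
      by (rule exI[of _ A], rule exI[of _ "B + D"], rule exI[of _ C], unfold sum ABC)
        (simp add: 2 \<tau> k wt_field_def wt_index_def wt_def axis_def vec_eq_iff forall_3 algebra_simps)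
  next
    case 3 show ?thesis
      by (rule exI[of _ A], rule exI[of _ B], rule exI[of _ "C + D"], unfold sum ABC)
        (simp add: 3 \<tau> k wt_field_def wt_index_def wt_def axis_def vec_eq_iff forall_3 algebra_simps)
  qed
qed

lemma polymap_wt_field:
  assumes "polymap \<Phi>"
  obtains ts where "\<And>p. p \<in> quadric 1 \<Longrightarrow> \<Phi> p = (\<Sum>\<tau>\<leftarrow>ts. wt_field \<tau> p)"
proof -
  have "\<exists>ts. \<forall>p\<in>quadric 1. \<Phi> p $ i = (\<Sum>(k, A)\<leftarrow>ts. wt k A p)" for i
    by (rule is_poly_wt[of "\<lambda>p. \<Phi> p $ i"]) (use assms in \<open>auto simp: polymap_def\<close>)
  then obtain ts where ts: "\<And>i p. p \<in> quadric 1 \<Longrightarrow> \<Phi> p $ i = (\<Sum>(k, A)\<leftarrow>ts i. wt k A p)" by metis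
  have e: "(\<Sum>\<tau>\<leftarrow>map (Pair i) l. wt_field \<tau> p) = axis i (\<Sum>(k, A)\<leftarrow>l. wt k A p)" for i l p
    by (induction l) (auto simp: wt_field_def axis_def vec_eq_iff)
  show ?thesis
    by (rule that[of "map (Pair 1) (ts 1) @ map (Pair 2) (ts 2) @ map (Pair 3) (ts 3)"])
      (simp only: map_append sum_list_append e, simp add: ts vec_eq_iff forall_3 axis_def)
qed

text \<open>
  The vector fields that are invariant under the torus, not necessarily tangent to the quadric.
\<close>

definition weight0_field where
  "weight0_field A B C p = (vector [p $ 1 * poly A (p $ 3), p $ 2 * poly B (p $ 3), poly C (p $ 3)] :: complex^3)"

text \<open>
  The bracket of \<open>F 0\<close> with \<open>weight0_field A B C\<close>.
\<close>

definition weight0_bracket_F :: "complex poly \<Rightarrow> complex poly \<Rightarrow> complex poly \<Rightarrow> complex^3 \<Rightarrow> complex^3" where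
  "weight0_bracket_F A B C p = vector [poly C (p $ 3) - p $ 3 * poly A (p $ 3) - 2 * p $ 1 * p $ 2 * poly (pderiv A) (p $ 3),
     - 2 * (p $ 2)\<^sup>2 * poly (pderiv B) (p $ 3),
     2 * p $ 2 * (poly B (p $ 3) - poly (pderiv C) (p $ 3))]"

text \<open>
  The bracket of \<open>E 0\<close> with the preceding one.
\<close>

definition weight0_bracket_EF :: "complex poly \<Rightarrow> complex poly \<Rightarrow> complex poly \<Rightarrow> complex^3 \<Rightarrow> complex^3" where
  "weight0_bracket_EF A B C p = (let x = p $ 1; y = p $ 2; u = p $ 3 in vector [
     2 * x * (poly A u + 2 * u * poly (pderiv A) u + 2 * x * y * poly (pderiv (pderiv A)) u - poly (pderiv C) u),
     2 * y * (2 * u * poly (pderiv B) u + 2 * x * y * poly (pderiv (pderiv B)) u - poly (pderiv C) u + poly B u),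
     2 * u * (poly (pderiv C) u - poly B u) + 4 * x * y * (poly (pderiv (pderiv C)) u - poly (pderiv B) u)
       - 2 * (u * poly A u + 2 * x * y * poly (pderiv A) u - poly C u)])"

lemma ad_coshear_weight0_field: "ad_coshear (weight0_field A B C) (weight0_bracket_F A B C)"
  unfolding ad_coshear_def curve_deriv_3 coshear_def weight0_field_def weight0_bracket_F_def vector_3
  by (intro allI conjI; (rule derivative_eq_intros poly_DERIV[THEN DERIV_chain2] refl)+;
      simp add: algebra_simps power2_eq_square)

lemma ad_shear_weight0_bracket_F: "ad_shear 0 (weight0_bracket_F A B C) (weight0_bracket_EF A B C)"
  unfolding ad_shear_def curve_deriv_3 shear_def dshear_def weight0_bracket_F_def weight0_bracket_EF_def Let_def vector_3
  by (intro allI conjI; (rule derivative_eq_intros poly_DERIV[THEN DERIV_chain2] refl)+;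
      simp add: algebra_simps power2_eq_square)

text \<open>
  The invariant fields that are tangent to \<open>quadric 1\<close>: the part with \<open>W\<close> consists of
  Hamiltonian fields of functions of \<open>u\<close>, and the part with \<open>S\<close> of multiples of the gradient
  of \<open>u\<close>.
\<close>

definition weight0_tangent :: "complex poly \<Rightarrow> complex poly \<Rightarrow> complex^3 \<Rightarrow> complex^3" where
  "weight0_tangent S W = weight0_field ([:0, 1:] * S + W) ([:0, 1:] * S - W) ([:- 1, 0, 1:] * S)"

text \<open>
  The differential operator whose eigenfunctions are the Gegenbauer polynomials with parameter
  \<open>3/2\<close>, the derivatives of the Legendre polynomials.
\<close>

definition gegenbauer :: "complex poly \<Rightarrow> complex poly" where
  "gegenbauer S = [:- 1, 0, 1:] * pderiv (pderiv S) + [:0, 4:] * pderiv S + Polynomial.smult 2 S"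

text \<open>
  On vectors of weight \<open>0\<close>, the operator \<open>ad (E 0) ad (F 0)\<close> is a multiple of the
  Casimir operator, and there it becomes the same differential operator on both parts.
\<close>

lemma weight0_bracket_EF_tangent:
  assumes "p \<in> quadric 1"
  shows "weight0_bracket_EF ([:0, 1:] * S + W) ([:0, 1:] * S - W) ([:- 1, 0, 1:] * S) p = weight0_tangent (gegenbauer S) (gegenbauer W) p"
proof -
  have u: "p $ 3 * p $ 3 = 1 + 4 * p $ 1 * p $ 2"
    using assms by (simp add: quadric_def power2_eq_square algebra_simps)
  have u': "p $ 3 * (p $ 3 * z) = (1 + 4 * p $ 1 * p $ 2) * z" for z
    using u by (simp flip: mult.assoc)
  have d: "pderiv ([:0, 1:] * T) = T + [:0, 1:] * pderiv T"
    "pderiv ([:- 1, 0, 1:] * T) = [:0, 2:] * T + [:- 1, 0, 1:] * pderiv T"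
    "pderiv ([:0, 2:] * T) = Polynomial.smult 2 T + [:0, 2:] * pderiv T" for T :: "complex poly"
    unfolding pderiv_mult by (simp_all add: pderiv_pCons)
  show ?thesis
    unfolding weight0_bracket_EF_def Let_def weight0_tangent_def weight0_field_def gegenbauer_def pderiv_add pderiv_diff d pderiv_smult
    by (simp add: vec_eq_iff forall_3 algebra_simps u u')
qed

text \<open>
  The operator is triangular for the degree, with the nonzero diagonal entries \<open>(d + 1) (d + 2)\<close>. So
  the Casimir operator is injective: there is no vector field on the quadric that is invariant under
  \<open>SL\<^sub>2\<close>.
\<close>

lemma coeff_gegenbauer:
  "coeff (gegenbauer S) k = of_nat ((k + 1) * (k + 2)) * (coeff S k - coeff S (k + 2))"
proof -
  have "gegenbauer S = pCons 0 (pCons 0 (pderiv (pderiv S))) - pderiv (pderiv S)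
      + pCons 0 (Polynomial.smult 4 (pderiv S)) + Polynomial.smult 2 S"
    by (simp add: gegenbauer_def)
  then show ?thesis
    by (simp add: coeff_pCons coeff_pderiv split: nat.split) (auto simp: algebra_simps)
qed

lemma weight0_tangent_lin: "x *s weight0_tangent S W p + y *s weight0_tangent S' W' p =
    weight0_tangent (Polynomial.smult x S + Polynomial.smult y S') (Polynomial.smult x W + Polynomial.smult y W') p"
  by (simp add: weight0_tangent_def weight0_field_def vec_eq_iff forall_3 algebra_simps)

text \<open>
  The flow stays on the quadric, so its generator annihilates the equation.
\<close>

lemma tangent_quadric:
  assumes "tangent \<Theta> V m" "p \<in> quadric 1"
  shows "p $ 3 * V p $ 3 = 2 * (p $ 1 * V p $ 2 + p $ 2 * V p $ 1)"
  using assms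
proof (induction)
  case (gen b V m)
  have V: "((\<lambda>s. b s p $ i) has_field_derivative V p $ i) (at 0)" for i
    using gen(2)[OF gen(4)] by (simp add: curve_deriv_def)
  have "((\<lambda>s. (b s p $ 3)\<^sup>2 - 4 * b s p $ 1 * b s p $ 2) has_field_derivative
      2 * p $ 3 * V p $ 3 - 4 * (p $ 1 * V p $ 2 + p $ 2 * V p $ 1)) (at 0)"
    using additive_actionD(2)[OF gen(1,4)]
    by (auto intro!: derivative_eq_intros V simp: algebra_simps)
  moreover have "(b s p $ 3)\<^sup>2 - 4 * b s p $ 1 * b s p $ 2 = 1" for s
    using additive_actionD(1)[OF gen(1,4), of s] by (simp add: quadric_def)
  ultimately have "((\<lambda>s. 1) has_field_derivative
      2 * p $ 3 * V p $ 3 - 4 * (p $ 1 * V p $ 2 + p $ 2 * V p $ 1)) (at 0)" by simp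
  from DERIV_unique[OF this DERIV_const] show ?case by algebra
next
  case (lin V m V' m' x y)
  then show ?case by (simp add: algebra_simps)
qed simp

lemma poly_eqI_values: "(\<And>u. poly p u = poly q u) \<Longrightarrow> p = q" for p q :: "complex poly"
  using poly_eq_poly_eq_iff by blast

lemma additive_action_generator:
  assumes "additive_action X b"
  obtains V where "\<And>p. p \<in> X \<Longrightarrow> curve_deriv (\<lambda>s. b s p) (V p)"
proof -
  have "\<exists>w. ((\<lambda>s. b s p $ i) has_field_derivative w) (at 0)" if "p \<in> X" for p i
  proof -
    obtain c d where "\<And>p. degree (c p) \<le> d" "\<And>j. is_poly coords (\<lambda>p. coeff (c p) j)"
      "\<And>t p. p \<in> X \<Longrightarrow> b t p $ i = poly (c p) t"
      by (rule poly_familyE[OF additive_action_poly_family[OF assms, of i]]) (rule that)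
    then have "(\<lambda>s. b s p $ i) = poly (c p)" using that by auto
    then show ?thesis by (simp only:) (rule exI, rule poly_DERIV)
  qed
  then obtain V where "\<And>p i. p \<in> X \<Longrightarrow> ((\<lambda>s. b s p $ i) has_field_derivative V p i) (at 0)" by metis
  then show ?thesis by (intro that[of "\<lambda>p. \<chi> i. V p i"]) (simp add: curve_deriv_def)
qed

context action_rep
begin

lemma \<Theta>_shear: "\<Theta> (shear 0) t = mat 1" and \<Theta>_coshear: "\<Theta> (coshear 0) t = mat 1"
  using trivial_if_velocity_0[OF shear_action velocity_shear_0] trivial_if_velocity_0[OF coshear_action velocity_coshear_0]
  by auto

text \<open>
  Once the unipotent elements of \<open>SL\<^sub>2\<close> act trivially, moving a vector field by
  \<open>SL\<^sub>2\<close> does not change its image.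
\<close>

lemma tangent_rotate:
  assumes "tangent \<Theta> V m"
  shows "tangent \<Theta> (\<lambda>p. shear 0 t (V (shear 0 (- t) p))) m"
    and "tangent \<Theta> (\<lambda>p. coshear 0 t (V (coshear 0 (- t) p))) m"
proof -
  have "dshear 0 t v = shear 0 t" for v
    by (rule ext) (simp add: dshear_def shear_def vec_eq_iff forall_3 algebra_simps)
  then show "tangent \<Theta> (\<lambda>p. shear 0 t (V (shear 0 (- t) p))) m"
    using tangent_Ad[OF shear_action tangent_map_shear assms, of 0 t] by (simp add: \<Theta>_shear)
  show "tangent \<Theta> (\<lambda>p. coshear 0 t (V (coshear 0 (- t) p))) m"
    using tangent_Ad[OF coshear_action tangent_map_coshear assms, of t] by (simp add: \<Theta>_coshear)
qed

lemma tangent_stretch: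
  assumes "tangent \<Theta> V m" shows "tangent \<Theta> (\<lambda>p. stretch 4 (V (stretch (1 / 4) p))) m"
  using tangent_rotate(1)[OF tangent_rotate(2)[OF tangent_rotate(1)[OF tangent_rotate(2)[OF assms,
    of "- 1 / 2"], of 1], of 1], of "- 1 / 2"]
  by (simp add: stretch_eq_shears[simplified])

text \<open>
  The components of nonzero weight can be removed without a change of the image. If \<open>T\<close> is the
  transport by the torus element, then \<open>T\<close> preserves images, hence so does
  \<open>(T - c) / (1 - c)\<close> for each eigenvalue \<open>c \<noteq> 1\<close>; this operator kills the eigenvectors for
  \<open>c\<close> and fixes the invariant part.
\<close>

lemma tangent_fixed_part:
  assumes "tangent \<Theta> (\<lambda>p. \<Sum>\<tau>\<leftarrow>ts. Z \<tau> p) m"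
    and "\<And>\<tau> p. stretch 4 (Z \<tau> (stretch (1 / 4) p)) = c \<tau> *s Z \<tau> p"
  shows "tangent \<Theta> (\<lambda>p. \<Sum>\<tau>\<leftarrow>filter (\<lambda>\<tau>. c \<tau> = 1) ts. Z \<tau> p) m"
  using assms
proof (induction "length ts" arbitrary: ts Z rule: less_induct)
  case less
  show ?case
  proof (cases "\<forall>\<tau>\<in>set ts. c \<tau> = 1")
    case True
    then show ?thesis using less.prems(1) by (simp add: filter_id_conv[THEN iffD2])
  next
    case False
    then obtain \<sigma> where \<sigma>: "\<sigma> \<in> set ts" "c \<sigma> \<noteq> 1" by blast
    \<comment> \<open>The operator \<open>(T - c \<sigma>) / (1 - c \<sigma>)\<close>, applied termwise.\<close>
    define Z' where "Z' \<tau> p = ((c \<tau> - c \<sigma>) / (1 - c \<sigma>)) *s Z \<tau> p" for \<tau> p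
    define ts' where "ts' = filter (\<lambda>\<tau>. c \<tau> \<noteq> c \<sigma>) ts"
    have *: "(\<Sum>\<tau>\<leftarrow>l. Z' \<tau> p) = (1 / (1 - c \<sigma>)) *s (\<Sum>\<tau>\<leftarrow>l. c \<tau> *s Z \<tau> p) + (- c \<sigma> / (1 - c \<sigma>)) *s (\<Sum>\<tau>\<leftarrow>l. Z \<tau> p)" for l p
    proof (induction l)
      case (Cons \<tau> l)
      have "Z' \<tau> p = (1 / (1 - c \<sigma>)) *s (c \<tau> *s Z \<tau> p) + (- c \<sigma> / (1 - c \<sigma>)) *s Z \<tau> p"
        by (simp add: Z'_def vec_eq_iff diff_divide_distrib left_diff_distrib)
      then show ?case using Cons by (simp add: vector_add_ldistrib)
    qed simp
    have "(\<Sum>\<tau>\<leftarrow>ts'. Z' \<tau> p) = (\<Sum>\<tau>\<leftarrow>ts. Z' \<tau> p)" for p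
      unfolding ts'_def by (induction ts) (auto simp: Z'_def)
    then have e: "(\<lambda>p. \<Sum>\<tau>\<leftarrow>ts'. Z' \<tau> p) = (\<lambda>p. (1 / (1 - c \<sigma>)) *s stretch 4 (\<Sum>\<tau>\<leftarrow>ts. Z \<tau> (stretch (1 / 4) p)) + (- c \<sigma> / (1 - c \<sigma>)) *s (\<Sum>\<tau>\<leftarrow>ts. Z \<tau> p))"
      by (simp add: * stretch_sum less.prems(2))
    have m: "cscale (1 / (1 - c \<sigma>)) m + cscale (- c \<sigma> / (1 - c \<sigma>)) m = m"
    proof -
      have "1 / (1 - c \<sigma>) + - c \<sigma> / (1 - c \<sigma>) = 1" using \<sigma>(2) by (simp add: field_simps)
      moreover have "cscale x m + cscale y m = cscale (x + y) m" for x y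
        by (simp add: vec_eq_iff distrib_right)
      moreover have "cscale 1 m = m" by (simp add: vec_eq_iff)
      ultimately show ?thesis by metis
    qed
    have t: "tangent \<Theta> (\<lambda>p. \<Sum>\<tau>\<leftarrow>ts'. Z' \<tau> p) m"
      unfolding e using tangent.lin[OF tangent_stretch[OF less.prems(1)] less.prems(1), of "1 / (1 - c \<sigma>)" "- c \<sigma> / (1 - c \<sigma>)"]
      unfolding m .
    have "length ts' < length ts"
      unfolding ts'_def using \<sigma>(1) by (auto intro!: length_filter_less)
    moreover have "stretch 4 (Z' \<tau> (stretch (1 / 4) p)) = c \<tau> *s Z' \<tau> p" for \<tau> p
    proof -
      have "stretch 4 (x *s v) = x *s stretch 4 v" for x v
        by (simp add: stretch_def vec_eq_iff forall_3)
      then show ?thesis by (simp add: Z'_def less.prems(2) mult.commute)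
    qed
    ultimately have "tangent \<Theta> (\<lambda>p. \<Sum>\<tau>\<leftarrow>filter (\<lambda>\<tau>. c \<tau> = 1) ts'. Z' \<tau> p) m"
      using less.hyps t by blast
    moreover have "(\<Sum>\<tau>\<leftarrow>filter (\<lambda>\<tau>. c \<tau> = 1) ts'. Z' \<tau> p) = (\<Sum>\<tau>\<leftarrow>filter (\<lambda>\<tau>. c \<tau> = 1) ts. Z \<tau> p)" for p
      unfolding ts'_def using \<sigma>(2) by (induction ts) (auto simp: Z'_def)
    ultimately show ?thesis by simp
  qed
qed

text \<open>
  By induction on the degree. The bracket with \<open>E 0\<close> has image \<open>0\<close>, hence also
  \<open>ad (E 0) ad (F 0)\<close> of the field. Subtracting \<open>(d + 1) (d + 2)\<close> times the field lowers the
  degree and multiplies the image by a nonzero number.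
\<close>

lemma tangent_weight0_trivial:
  assumes "tangent \<Theta> (weight0_tangent S W) m" "\<And>k. k \<ge> d \<Longrightarrow> coeff S k = 0 \<and> coeff W k = 0"
  shows "m = 0"
  using assms
proof (induction d arbitrary: S W m)
  case 0
  then have "S = 0" "W = 0" by (auto simp: poly_eq_iff)
  then have "weight0_tangent S W p = 0" for p by (simp add: weight0_tangent_def weight0_field_def vec_eq_iff forall_3)
  then show ?case using tangent_0 0(1) tangent.cong[OF 0(1), of "\<lambda>p. 0"] by simp
next
  case (Suc d)
  define c :: complex where "c = of_nat ((d + 1) * (d + 2))"
  have "tangent \<Theta> (weight0_bracket_F ([:0, 1:] * S + W) ([:0, 1:] * S - W) ([:- 1, 0, 1:] * S)) 0"
    using tangent_ad_coshear[OF Suc.prems(1)[unfolded weight0_tangent_def] ad_coshear_weight0_field] by (simp add: velocity_coshear_0)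
  from tangent_ad_shear[OF this ad_shear_weight0_bracket_F]
  have "tangent \<Theta> (weight0_bracket_EF ([:0, 1:] * S + W) ([:0, 1:] * S - W) ([:- 1, 0, 1:] * S)) 0" by simp
  from tangent.cong[OF this weight0_bracket_EF_tangent]
  have "tangent \<Theta> (weight0_tangent (gegenbauer S) (gegenbauer W)) 0" .
  from tangent.lin[OF this Suc.prems(1), of 1 "- c"]
  have "tangent \<Theta> (weight0_tangent (Polynomial.smult 1 (gegenbauer S) + Polynomial.smult (- c) S)
      (Polynomial.smult 1 (gegenbauer W) + Polynomial.smult (- c) W)) (cscale (- c) m)"
    by (simp only: weight0_tangent_lin cscale_zero add_0)
  moreover have "coeff (gegenbauer T) k = c * coeff T k"
    if "k \<ge> d" "\<And>k. k \<ge> Suc d \<Longrightarrow> coeff T k = 0" for T k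
    using that by (cases "k = d") (auto simp: coeff_gegenbauer c_def)
  ultimately have "cscale (- c) m = 0"
    by (intro Suc.IH) (use Suc.prems(2) in auto)
  moreover have "c \<noteq> 0" unfolding c_def of_nat_eq_0_iff by simp
  ultimately show ?case by (simp add: vec_eq_iff)
qed

text \<open>
  Averaging over \<open>SL\<^sub>2\<close>: first over the torus, then with the Casimir operator.
\<close>

lemma tangent_trivial:
  assumes "tangent \<Theta> V m" shows "m = 0"
proof -
  obtain \<Phi> where "polymap \<Phi>" "\<And>p. p \<in> quadric 1 \<Longrightarrow> V p = \<Phi> p"
    using tangent_polymap[OF assms] by blast
  then obtain ts where "\<And>p. p \<in> quadric 1 \<Longrightarrow> V p = (\<Sum>\<tau>\<leftarrow>ts. wt_field \<tau> p)"
    using polymap_wt_field by metis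
  then have "tangent \<Theta> (\<lambda>p. \<Sum>\<tau>\<leftarrow>ts. wt_field \<tau> p) m" by (rule tangent.cong[OF assms])
  from tangent_fixed_part[OF this stretch_wt_field]
  have t: "tangent \<Theta> (\<lambda>p. \<Sum>\<tau>\<leftarrow>filter (\<lambda>\<tau>. wt_factor \<tau> = 1) ts. wt_field \<tau> p) m" .
  obtain A B C where "\<And>p. (\<Sum>\<tau>\<leftarrow>filter (\<lambda>\<tau>. wt_factor \<tau> = 1) ts. wt_field \<tau> p) = weight0_field A B C p"
    using sum_wt_index_field[of "filter (\<lambda>\<tau>. wt_factor \<tau> = 1) ts"] unfolding weight0_field_def
    by (auto simp: wt_factor_1)
  then have t: "tangent \<Theta> (weight0_field A B C) m" using tangent.cong[OF t, of "weight0_field A B C"] by simp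
  have ABC: "u * poly C u = (u\<^sup>2 - 1) / 2 * (poly A u + poly B u)" for u
  proof -
    \<comment> \<open>Every value of \<open>u\<close> occurs on the quadric, so the tangency condition is an identity of polynomials.\<close>
    define y where "y = (u\<^sup>2 - 1) / 4"
    define p :: "complex^3" where "p = vector [1, y, u]"
    have y: "(u\<^sup>2 - 1) / 2 = 2 * y" "4 * y = u\<^sup>2 - 1" by (simp_all add: y_def)
    then have "p \<in> quadric 1" by (simp add: p_def quadric_def)
    from tangent_quadric[OF t this] show ?thesis unfolding y by (simp add: weight0_field_def p_def algebra_simps)
  qed
  from ABC[of 0] have "poly (A + B) 0 = 0" by simp
  moreover obtain a T where "A + B = pCons a T" by (cases "A + B")
  ultimately have T: "A + B = [:0, 1:] * T" by simp
  define S where "S = Polynomial.smult (1 / 2) T"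
  define W where "W = Polynomial.smult (1 / 2) (A - B)"
  have AB: "A + B = [:0, 1:] * S + [:0, 1:] * S" by (simp add: T S_def flip: smult_add_left)
  have "A = Q + W \<and> B = Q - W" if "A + B = Q + Q" for Q
  proof -
    have "coeff A n + coeff B n = coeff Q n + coeff Q n" for n
      using arg_cong[OF that, of "\<lambda>q. coeff q n"] by (simp only: coeff_add)
    then have "coeff B n = 2 * coeff Q n - coeff A n" for n by (simp add: eq_diff_eq add.commute)
    then show ?thesis unfolding W_def by (auto simp: poly_eq_iff field_simps)
  qed
  from this[OF AB] have "A = [:0, 1:] * S + W" "B = [:0, 1:] * S - W" by auto
  have "[:0, 1:] * C = [:0, 1:] * ([:- 1, 0, 1:] * S)"
  proof (rule poly_eqI_values)
    fix u
    have s: "poly A u + poly B u = 2 * (u * poly S u)"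
      using arg_cong[OF AB, of "\<lambda>q. poly q u"] by simp
    have "u * poly C u = (u\<^sup>2 - 1) * (u * poly S u)" using ABC[of u] unfolding s by simp
    then show "poly ([:0, 1:] * C) u = poly ([:0, 1:] * ([:- 1, 0, 1:] * S)) u"
      by (simp add: power2_eq_square algebra_simps)
  qed
  then have "C = [:- 1, 0, 1:] * S" by simp
  then have "tangent \<Theta> (weight0_tangent S W) m"
    using t \<open>A = _\<close> \<open>B = _\<close> by (simp add: weight0_tangent_def)
  then show ?thesis
    by (rule tangent_weight0_trivial[of _ _ _ "Suc (max (degree S) (degree W))"]) (simp add: coeff_eq_0)
qed

theorem representation_trivial:
  assumes "additive_action (quadric 1) b" shows "\<Theta> b s = mat 1"
proof (rule trivial_if_velocity_0[OF assms])
  obtain V where "\<And>p. p \<in> quadric 1 \<Longrightarrow> curve_deriv (\<lambda>s. b s p) (V p)"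
    using additive_action_generator[OF assms] by blast
  then show "velocity b = 0" using tangent_trivial tangent_velocity[OF assms] by blast
qed

end

section \<open>Quadrics as models of the quotients\<close>

definition poly_iso ::
    "(complex^'n) set \<Rightarrow> (complex^'n \<Rightarrow> complex^'m) \<Rightarrow> (complex^'m) set \<Rightarrow> (complex^'m \<Rightarrow> complex^'n) \<Rightarrow> bool"
  where
  "poly_iso X \<alpha> Z \<beta> \<longleftrightarrow> polymap \<alpha> \<and> polymap \<beta> \<and>
     (\<forall>p\<in>X. \<alpha> p \<in> Z \<and> \<beta> (\<alpha> p) = p) \<and> (\<forall>q\<in>Z. \<beta> q \<in> X \<and> \<alpha> (\<beta> q) = q)"

lemma poly_isoD:
  assumes "poly_iso X \<alpha> Z \<beta>"
  shows "polymap \<alpha>" "polymap \<beta>" "p \<in> X \<Longrightarrow> \<alpha> p \<in> Z" "p \<in> X \<Longrightarrow> \<beta> (\<alpha> p) = p"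
    "q \<in> Z \<Longrightarrow> \<beta> q \<in> X" "q \<in> Z \<Longrightarrow> \<alpha> (\<beta> q) = q"
  using assms unfolding poly_iso_def by auto

lemma poly_iso_sym: "poly_iso X \<alpha> Z \<beta> \<Longrightarrow> poly_iso Z \<beta> X \<alpha>"
  unfolding poly_iso_def by auto

lemma poly_iso_trans:
  assumes "poly_iso X \<alpha> Y \<beta>" "poly_iso Y \<gamma> Z \<delta>"
  shows "poly_iso X (\<lambda>p. \<gamma> (\<alpha> p)) Z (\<lambda>q. \<beta> (\<delta> q))"
  using assms unfolding poly_iso_def by (auto intro: polymap_comp)

text \<open>
  The coordinates of \<open>Z\<close> are invariant functions on \<open>V\<close>, hence they come from polynomials
  on \<open>X\<close>.
\<close>

lemma quotient_factor:
  assumes "affine_quotient V G act X \<pi>" "affine_quotient V G act Z \<pi>'"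
  obtains \<alpha> where "polymap \<alpha>" "\<And>v. v \<in> points V \<Longrightarrow> \<alpha> (\<pi> v) = \<pi>' v"
proof -
  have X: "\<pi> ` points V = X" and Z: "\<pi>' ` points V = Z"
    using assms by (auto simp: affine_quotient_def)
  have "\<exists>P. is_poly coords P \<and> (\<forall>v\<in>points V. P (\<pi> v) = \<pi>' v $ i)" for i
  proof -
    have "restrict (\<lambda>p. p $ i) Z \<in> regs (affine_subvar Z)"
      by (auto simp: affine_subvar_def regs_variety_gen)
    then have "compose (points V) (restrict (\<lambda>p. p $ i) Z) \<pi>' \<in> {compose (points V) h \<pi> | h. h \<in> regs (affine_subvar X)}"
      using assms unfolding affine_quotient_def by blast
    then obtain H where H: "is_poly coords H"
      "compose (points V) (restrict (\<lambda>p. p $ i) Z) \<pi>' = compose (points V) (restrict H X) \<pi>"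
      by (auto simp: affine_subvar_def regs_variety_gen)
    have "H (\<pi> v) = \<pi>' v $ i" if "v \<in> points V" for v
      using fun_cong[OF H(2), of v] that X Z by (auto simp: compose_def)
    then show ?thesis using H(1) by blast
  qed
  then obtain P where "\<And>i. is_poly coords (P i)" "\<And>i v. v \<in> points V \<Longrightarrow> P i (\<pi> v) = \<pi>' v $ i" by metis
  then show ?thesis by (intro that[of "\<lambda>p. \<chi> i. P i p"]) (auto simp: polymap_def vec_eq_iff)
qed

lemma quotient_iso:
  assumes "affine_quotient V G act X \<pi>" "affine_quotient V G act Z \<pi>'"
  shows "\<exists>\<alpha> \<beta>. poly_iso X \<alpha> Z \<beta>"
proof -
  obtain \<alpha> where \<alpha>: "polymap \<alpha>" "\<And>v. v \<in> points V \<Longrightarrow> \<alpha> (\<pi> v) = \<pi>' v"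
    by (rule quotient_factor[OF assms]) (rule that)
  obtain \<beta> where \<beta>: "polymap \<beta>" "\<And>v. v \<in> points V \<Longrightarrow> \<beta> (\<pi>' v) = \<pi> v"
    by (rule quotient_factor[OF assms(2,1)]) (rule that)
  have "\<pi> ` points V = X" "\<pi>' ` points V = Z" using assms by (auto simp: affine_quotient_def)
  then have "poly_iso X \<alpha> Z \<beta>" using \<alpha> \<beta> unfolding poly_iso_def by auto
  then show ?thesis by blast
qed

lemma polymap_vector3:
  "is_poly coords f \<Longrightarrow> is_poly coords g \<Longrightarrow> is_poly coords h \<Longrightarrow> polymap (\<lambda>v. vector [f v, g v, h v] :: complex^3)"
  unfolding polymap_def by (simp add: forall_3)

lemma is_SL2_mod_T_quadric:
  assumes "is_SL2_mod_T X" shows "\<exists>\<alpha> \<beta>. poly_iso X \<alpha> (quadric 1) \<beta>"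
proof -
  let ?Z = "{v :: complex^3. v $ 1 * v $ 2 = (v $ 3)\<^sup>2 - v $ 3}"
  obtain \<pi> where \<pi>: "affine_quotient SL2 torus (\<lambda>t A. A ** t) X \<pi>"
    using assms unfolding is_SL2_mod_T_def by (elim exE)
  obtain \<pi>' where \<pi>': "affine_quotient SL2 torus (\<lambda>t A. A ** t) ?Z \<pi>'"
    using SL2_mod_T_exists unfolding is_SL2_mod_T_def by (elim exE)
  obtain \<alpha> \<beta> where 1: "poly_iso X \<alpha> ?Z \<beta>"
    using quotient_iso[OF \<pi> \<pi>'] by (elim exE)
  have "poly_iso ?Z (\<lambda>v. vector [v $ 1, v $ 2, 2 * v $ 3 - 1]) (quadric 1)
      (\<lambda>v. vector [v $ 1, v $ 2, v $ 3 * (1 / 2) + 1 / 2])"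
    unfolding poly_iso_def
  proof (intro conjI ballI polymap_vector3 is_poly_intros)
    fix v :: "complex^3" assume "v \<in> ?Z"
    then have "v $ 1 * v $ 2 = (v $ 3)\<^sup>2 - v $ 3" by simp
    then have "(2 * v $ 3 - 1)\<^sup>2 - 4 * v $ 1 * v $ 2 = 1" by algebra
    then show "vector [v $ 1, v $ 2, 2 * v $ 3 - 1] \<in> quadric 1" by (simp add: quadric_def)
  next
    fix v assume "v \<in> quadric 1"
    then have "(v $ 3)\<^sup>2 - 4 * v $ 1 * v $ 2 = 1" by (simp add: quadric_def)
    moreover define h :: complex where "h = 1 / 2"
    moreover have "2 * h = 1" by (simp add: h_def)
    ultimately have "v $ 1 * v $ 2 = (v $ 3 * h + h)\<^sup>2 - (v $ 3 * h + h)" by algebra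
    then show "vector [v $ 1, v $ 2, v $ 3 * (1 / 2) + 1 / 2] \<in> ?Z" by (simp add: h_def)
  qed (simp_all add: vec_eq_iff forall_3 field_simps)
  from poly_iso_trans[OF 1 this] show ?thesis by blast
qed

lemma is_A2_mod_mu2_quadric:
  assumes "is_A2_mod_mu2 Y" shows "\<exists>\<alpha> \<beta>. poly_iso Y \<alpha> (quadric 0) \<beta>"
proof -
  let ?Z = "{v :: complex^3. v $ 1 * v $ 3 = (v $ 2)\<^sup>2}"
  obtain \<pi> where \<pi>: "affine_quotient affine_plane mu2 (\<lambda>\<xi> v. \<xi> *s v) Y \<pi>"
    using assms unfolding is_A2_mod_mu2_def by (elim exE)
  obtain \<pi>' where \<pi>': "affine_quotient affine_plane mu2 (\<lambda>\<xi> v. \<xi> *s v) ?Z \<pi>'"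
    using A2_mod_mu2_exists unfolding is_A2_mod_mu2_def by (elim exE)
  obtain \<alpha> \<beta> where 1: "poly_iso Y \<alpha> ?Z \<beta>"
    using quotient_iso[OF \<pi> \<pi>'] by (elim exE)
  have "poly_iso ?Z (\<lambda>v. vector [v $ 1, v $ 3, 2 * v $ 2]) (quadric 0)
      (\<lambda>v. vector [v $ 1, v $ 3 * (1 / 2), v $ 2])"
    unfolding poly_iso_def
    by (intro conjI ballI polymap_vector3 is_poly_intros)
      (simp_all add: quadric_def vec_eq_iff forall_3 power_mult_distrib power_divide)
  from poly_iso_trans[OF 1 this] show ?thesis by blast
qed

text \<open>
  Transport of structure, by the coordinates \<open>\<alpha>\<close> on \<open>X\<close> and their inverse \<open>\<beta>\<close>.
\<close>

definition lift_action where
  "lift_action \<alpha> \<beta> b = (\<lambda>s p. \<beta> (b s (\<alpha> p)))"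

lemma lift_action:
  assumes "poly_iso X \<alpha> Z \<beta>" "additive_action Z b"
  shows "additive_action X (lift_action \<alpha> \<beta> b)"
  unfolding additive_action_iff lift_action_def
proof (intro conjI allI ballI)
  note iso = poly_isoD[OF assms(1)] and b = additive_actionD[OF assms(2)]
  show "poly_family X (\<lambda>t p. \<beta> (b t (\<alpha> p)) $ i)" for i
    by (rule poly_family_polymap_after[OF iso(2) poly_family_polymap_before[OF additive_action_poly_family[OF assms(2)] iso(1,3)]])
  show "\<beta> (b t (\<alpha> p)) \<in> X" "\<beta> (b 0 (\<alpha> p)) = p"
    "\<beta> (b (s + t) (\<alpha> p)) = \<beta> (b s (\<alpha> (\<beta> (b t (\<alpha> p)))))" if "p \<in> X" for s t p
    using that by (simp_all add: iso b)
qed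

section \<open>Regular functions on the automorphism group along an action\<close>

lemma U_simps:
  "carrier (U X) = generate (Aut X) {restrict (a t) X | a t. additive_action X a}"
  "mult (U X) = mult (Aut X)" "one (U X) = (\<lambda>x\<in>X. x)" "one (Aut X) = (\<lambda>x\<in>X. x)"
  by (simp_all add: U_def ind_subgroup_def Aut_def BijGroup_def)

lemma carrier_Aut: "f \<in> carrier (Aut X) \<Longrightarrow> f \<in> Bij X"
  by (auto simp: Aut_def aut_points_def)

lemma carrier_U: "f \<in> carrier (U X) \<Longrightarrow> f \<in> carrier (Aut X)"
  unfolding U_simps
  by (rule group.generate_in_carrier[OF group_Aut]) (use additive_action_carrier in auto)

lemma mult_Aut: "f \<in> Bij X \<Longrightarrow> g \<in> Bij X \<Longrightarrow> mult (Aut X) f g = compose X f g"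
  by (simp add: Aut_def BijGroup_def)

lemma mult_U: "f \<in> carrier (U X) \<Longrightarrow> g \<in> carrier (U X) \<Longrightarrow> mult (U X) f g = compose X f g"
  using mult_Aut carrier_Aut carrier_U unfolding U_simps(2) by blast

lemma additive_action_U: "additive_action X a \<Longrightarrow> restrict (a t) X \<in> carrier (U X)"
  unfolding U_simps by (rule generate.incl) blast

lemma stage_U:
  "points (stage (U X) k) = aut_points X k \<inter> carrier (U X)"
  "regs (stage (U X) k) = {restrict f (aut_points X k \<inter> carrier (U X)) | f. f \<in> regs (aut_stage X k)}"
  by (simp_all add: U_def ind_subgroup_def restrict_variety_def Aut_def aut_stage_def)

lemma inv_action:
  assumes "additive_action X a"
  shows "inv\<^bsub>BijGroup X\<^esub> (restrict (a t) X) = restrict (a (- t)) X"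
proof -
  have B: "restrict (a s) X \<in> Bij X" for s
    by (rule carrier_Aut[OF additive_action_carrier[OF assms]])
  have "restrict (a (- t)) X \<otimes>\<^bsub>BijGroup X\<^esub> restrict (a t) X = \<one>\<^bsub>BijGroup X\<^esub>"
    using B additive_actionD[OF assms] by (auto simp: BijGroup_def compose_def intro!: restrict_ext)
  then show ?thesis
    using group.inv_equality[OF group_BijGroup] B by (metis BijGroup_def partial_object.select_convs(1))
qed

lemma poly_maps_add:
  assumes "f \<in> poly_maps X k" "g \<in> poly_maps X k" shows "(\<lambda>p\<in>X. f p + g p) \<in> poly_maps X k"
proof -
  have "\<exists>R. poly_fun coords k R \<and> (\<forall>p\<in>X. f p $ i + g p $ i = R p)" for i
  proof -
    obtain P Q where "poly_fun coords k P" "\<forall>p\<in>X. f p $ i = P p"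
      "poly_fun coords k Q" "\<forall>p\<in>X. g p $ i = Q p"
      using assms unfolding poly_maps_def by blast
    then show ?thesis by (intro exI[of _ "\<lambda>p. P p + Q p"]) (auto intro: poly_fun.add)
  qed
  then show ?thesis unfolding poly_maps_def by simp
qed

lemma poly_maps_scale:
  assumes "f \<in> poly_maps X k" shows "(\<lambda>p\<in>X. c *s f p) \<in> poly_maps X k"
proof -
  have "\<exists>R. poly_fun coords k R \<and> (\<forall>p\<in>X. c * f p $ i = R p)" for i
  proof -
    obtain P where "poly_fun coords k P" "\<forall>p\<in>X. f p $ i = P p"
      using assms unfolding poly_maps_def by blast
    then show ?thesis
      using poly_fun.mult[OF poly_fun.const[of coords 0 c], of k P]
      by (intro exI[of _ "\<lambda>p. c * P p"]) auto
  qed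
  then show ?thesis unfolding poly_maps_def by simp
qed

lemma poly_maps_mono: "f \<in> poly_maps X k \<Longrightarrow> k \<le> l \<Longrightarrow> f \<in> poly_maps X l"
  unfolding poly_maps_def using poly_fun_mono by blast

definition poly_arc ::
    "(complex^'n) set \<Rightarrow> nat \<Rightarrow> (nat \<Rightarrow> complex^'n \<Rightarrow> complex^'n) \<Rightarrow> complex \<Rightarrow> complex^'n \<Rightarrow> complex^'n"
  where
  "poly_arc X d A s = (\<lambda>p\<in>X. \<Sum>j\<le>d. s ^ j *s A j p)"

lemma poly_arc_Suc: "poly_arc X (Suc d) A s = (\<lambda>p\<in>X. poly_arc X d A s p + (\<lambda>p\<in>X. s ^ Suc d *s A (Suc d) p) p)"
  by (auto simp: poly_arc_def intro!: restrict_ext)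

lemma poly_arc_0: "A 0 \<in> poly_maps X k \<Longrightarrow> poly_arc X 0 A s = A 0"
  by (auto simp: poly_arc_def poly_maps_def extensional_def)

lemma poly_arc_poly_maps:
  assumes "\<And>j. A j \<in> poly_maps X k" shows "poly_arc X d A s \<in> poly_maps X k"
proof (induction d)
  case 0
  then show ?case using assms[of 0] by (simp add: poly_arc_0)
next
  case (Suc d)
  then show ?case unfolding poly_arc_Suc by (intro poly_maps_add poly_maps_scale assms)
qed

lemma linear_functional_poly_arc:
  assumes "linear_functional X k l" "\<And>j. A j \<in> poly_maps X k"
  shows "l (poly_arc X d A s) = (\<Sum>j\<le>d. s ^ j * l (A j))"
proof (induction d)
  case (Suc d)
  have "l (poly_arc X (Suc d) A s) = l (poly_arc X d A s) + l (\<lambda>p\<in>X. s ^ Suc d *s A (Suc d) p)"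
    unfolding poly_arc_Suc using assms poly_arc_poly_maps[of A X k] poly_maps_scale[of "A (Suc d)" X k]
    unfolding linear_functional_def by blast
  also have "l (\<lambda>p\<in>X. s ^ Suc d *s A (Suc d) p) = s ^ Suc d * l (A (Suc d))"
    using assms unfolding linear_functional_def by blast
  finally show ?case by (simp add: Suc)
qed (simp add: poly_arc_0[OF assms(2)])

text \<open>
  \<open>\<Lambda>\<close> is the differential at the identity of the function \<open>h\<close> of an endomorphism and its
  inverse, restricted to those directions in which the second argument moves opposite to the first.
\<close>

definition differential_at_id where
  "differential_at_id X k h \<Lambda> \<longleftrightarrow> linear_functional X k \<Lambda> \<and>
     (\<forall>A d. 1 \<le> d \<longrightarrow> (\<forall>j. A j \<in> poly_maps X k) \<longrightarrow> (\<forall>p\<in>X. A 0 p = p) \<longrightarrow>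
       (\<exists>q. (\<forall>s. h (poly_arc X d A s, poly_arc X d A (- s)) = poly q s) \<and> coeff q 1 = \<Lambda> (A 1)))"

lemma differential_at_idI:
  assumes "linear_functional X k \<Lambda>"
    "\<And>A d. 1 \<le> d \<Longrightarrow> (\<And>j. A j \<in> poly_maps X k) \<Longrightarrow> (\<And>p. p \<in> X \<Longrightarrow> A 0 p = p) \<Longrightarrow>
       \<exists>q. (\<forall>s. h (poly_arc X d A s, poly_arc X d A (- s)) = poly q s) \<and> coeff q 1 = \<Lambda> (A 1)"
  shows "differential_at_id X k h \<Lambda>"
  unfolding differential_at_id_def using assms by simp

lemma differential_at_idD:
  assumes "differential_at_id X k h \<Lambda>"
  shows "linear_functional X k \<Lambda>"
    "1 \<le> d \<Longrightarrow> (\<And>j. A j \<in> poly_maps X k) \<Longrightarrow> (\<And>p. p \<in> X \<Longrightarrow> A 0 p = p) \<Longrightarrow>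
       \<exists>q. (\<forall>s. h (poly_arc X d A s, poly_arc X d A (- s)) = poly q s) \<and> coeff q 1 = \<Lambda> (A 1)"
  using assms unfolding differential_at_id_def by simp_all

definition has_differential where
  "has_differential X k h \<longleftrightarrow> (\<exists>\<Lambda>. differential_at_id X k h \<Lambda>)"

lemma poly_arc_at_0: "(\<And>p. p \<in> X \<Longrightarrow> A 0 p = p) \<Longrightarrow> poly_arc X d A 0 = (\<lambda>p\<in>X. p)"
proof -
  assume A: "\<And>p. p \<in> X \<Longrightarrow> A 0 p = p"
  have "(\<Sum>j\<le>d. 0 ^ j *s A j p) = A 0 p" for p
    by (induction d) (auto simp: vec_eq_iff)
  then show ?thesis using A by (auto simp: poly_arc_def intro!: restrict_ext)
qed

lemma linear_functional_zero: "linear_functional X k (\<lambda>f. 0)"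
  by (simp add: linear_functional_def)

lemma linear_functional_comb:
  "linear_functional X k l \<Longrightarrow> linear_functional X k l' \<Longrightarrow> linear_functional X k (\<lambda>f. x * l f + y * l' f)"
  unfolding linear_functional_def by (simp add: algebra_simps)

lemma has_differential_const: "has_differential X k (\<lambda>x. c)"
  unfolding has_differential_def by (rule exI, rule differential_at_idI[OF linear_functional_zero]) (auto intro!: exI[of _ "[:c:]"])

lemma has_differential_add:
  assumes "has_differential X k f" "has_differential X k g" shows "has_differential X k (\<lambda>x. f x + g x)"
proof -
  obtain \<Lambda> where L: "differential_at_id X k f \<Lambda>"
    using assms(1) unfolding has_differential_def by blast
  note L = differential_at_idD[OF L]
  obtain \<Lambda>' where L': "differential_at_id X k g \<Lambda>'"
    using assms(2) unfolding has_differential_def by blast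
  note L' = differential_at_idD[OF L']
  show ?thesis
  proof (unfold has_differential_def, rule exI, rule differential_at_idI[OF linear_functional_comb[OF L(1) L'(1), of 1 1]])
    fix A :: "nat \<Rightarrow> _" and d :: nat assume A: "1 \<le> d" "\<And>j. A j \<in> poly_maps X k" "\<And>p. p \<in> X \<Longrightarrow> A 0 p = p"
    from L(2)[of d A, OF A] obtain q where "\<forall>s. f (poly_arc X d A s, poly_arc X d A (- s)) = poly q s" "coeff q 1 = \<Lambda> (A 1)" by blast
    moreover from L'(2)[of d A, OF A] obtain q' where "\<forall>s. g (poly_arc X d A s, poly_arc X d A (- s)) = poly q' s" "coeff q' 1 = \<Lambda>' (A 1)" by blast
    ultimately show "\<exists>q. (\<forall>s. f (poly_arc X d A s, poly_arc X d A (- s)) + g (poly_arc X d A s, poly_arc X d A (- s)) = poly q s) \<and>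
        coeff q 1 = 1 * \<Lambda> (A 1) + 1 * \<Lambda>' (A 1)"
      by (intro exI[of _ "q + q'"]) simp
  qed
qed

text \<open>
  The Leibniz rule at the identity; the values of both factors there do not depend on the curve.
\<close>

lemma has_differential_mult:
  assumes "has_differential X k f" "has_differential X k g" shows "has_differential X k (\<lambda>x. f x * g x)"
proof -
  obtain \<Lambda> where L: "differential_at_id X k f \<Lambda>"
    using assms(1) unfolding has_differential_def by blast
  note L = differential_at_idD[OF L]
  obtain \<Lambda>' where L': "differential_at_id X k g \<Lambda>'"
    using assms(2) unfolding has_differential_def by blast
  note L' = differential_at_idD[OF L']
  let ?e = "(\<lambda>p\<in>X. p, \<lambda>p\<in>X. p)"
  show ?thesis
  proof (unfold has_differential_def, rule exI, rule differential_at_idI[OF linear_functional_comb[OF L(1) L'(1), of "g ?e" "f ?e"]])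
    fix A :: "nat \<Rightarrow> _" and d :: nat assume A: "1 \<le> d" "\<And>j. A j \<in> poly_maps X k" "\<And>p. p \<in> X \<Longrightarrow> A 0 p = p"
    from L(2)[of d A, OF A] obtain q where q: "\<And>s. f (poly_arc X d A s, poly_arc X d A (- s)) = poly q s" "coeff q 1 = \<Lambda> (A 1)" by blast
    from L'(2)[of d A, OF A] obtain q' where q': "\<And>s. g (poly_arc X d A s, poly_arc X d A (- s)) = poly q' s" "coeff q' 1 = \<Lambda>' (A 1)" by blast
    have "coeff q 0 = f ?e" "coeff q' 0 = g ?e"
      using q(1)[of 0] q'(1)[of 0] poly_arc_at_0[of X A d] A(3) by (simp_all add: poly_0_coeff_0)
    then show "\<exists>q. (\<forall>s. f (poly_arc X d A s, poly_arc X d A (- s)) * g (poly_arc X d A s, poly_arc X d A (- s)) = poly q s) \<and>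
        coeff q 1 = g ?e * \<Lambda> (A 1) + f ?e * \<Lambda>' (A 1)"
      using q q' by (intro exI[of _ "q * q'"]) (simp add: coeff_mult atMost_Suc)
  qed
qed

lemma has_differential_is_poly:
  assumes "is_poly S F" "\<And>s. s \<in> S \<Longrightarrow> has_differential X k (\<lambda>x. s (G x))"
  shows "has_differential X k (\<lambda>x. F (G x))"
proof -
  obtain n where "poly_fun S n F" using assms(1) by (auto simp: is_poly_def)
  then show ?thesis by induction (use assms(2) in \<open>auto intro: has_differential_const has_differential_add has_differential_mult\<close>)
qed

lemma has_differential_linear_functional:
  assumes l: "linear_functional X k l"
  shows "has_differential X k (\<lambda>x. l (fst x))" "has_differential X k (\<lambda>x. l (snd x))"
proof -
  have c1: "coeff (\<Sum>j\<le>d. monom (x j) j) 1 = x 1" if "1 \<le> d" for d and x :: "nat \<Rightarrow> complex"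
    using that by (simp add: coeff_sum)
  show "has_differential X k (\<lambda>x. l (fst x))"
  proof (unfold has_differential_def, rule exI, rule differential_at_idI[OF l])
    fix A :: "nat \<Rightarrow> _" and d :: nat assume A: "1 \<le> d" "\<And>j. A j \<in> poly_maps X k"
    show "\<exists>q. (\<forall>s. l (fst (poly_arc X d A s, poly_arc X d A (- s))) = poly q s) \<and> coeff q 1 = l (A 1)"
      by (rule exI[of _ "\<Sum>j\<le>d. monom (l (A j)) j"], intro conjI c1[OF A(1)])
        (simp add: linear_functional_poly_arc[OF l A(2)] poly_sum poly_monom mult.commute)
  qed
  have "linear_functional X k (\<lambda>f. - 1 * l f + 0 * l f)" by (rule linear_functional_comb[OF l l])
  then have m: "linear_functional X k (\<lambda>f. - l f)" by simp
  show "has_differential X k (\<lambda>x. l (snd x))"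
  proof (unfold has_differential_def, rule exI, rule differential_at_idI[OF m])
    fix A :: "nat \<Rightarrow> _" and d :: nat assume A: "1 \<le> d" "\<And>j. A j \<in> poly_maps X k"
    show "\<exists>q. (\<forall>s. l (snd (poly_arc X d A s, poly_arc X d A (- s))) = poly q s) \<and> coeff q 1 = - l (A 1)"
    proof (rule exI[of _ "\<Sum>j\<le>d. monom ((- 1) ^ j * l (A j)) j"], intro conjI allI)
      show "l (snd (poly_arc X d A s, poly_arc X d A (- s))) = poly (\<Sum>j\<le>d. monom ((- 1) ^ j * l (A j)) j) s" for s
        by (simp add: linear_functional_poly_arc[OF l A(2)] poly_sum poly_monom power_minus[of s] mult_ac)
    qed (use c1[OF A(1), of "\<lambda>j. (- 1) ^ j * l (A j)"] in simp)
  qed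
qed

lemma has_differential_regs:
  assumes "h \<in> regs (prod_variety (poly_maps_variety X k) (poly_maps_variety X k))"
  shows "has_differential X k h"
proof -
  let ?PM = "poly_maps_variety X k" and ?L = "{l. linear_functional X k l}"
  let ?S = "{\<lambda>p. f (fst p) | f. f \<in> regs ?PM} \<union> {\<lambda>p. g (snd p) | g. g \<in> regs ?PM}"
  have cong: "has_differential X k g" if t: "has_differential X k f" and e: "\<And>x. fst x \<in> poly_maps X k \<Longrightarrow> snd x \<in> poly_maps X k \<Longrightarrow> g x = f x" for f g
  proof -
    obtain \<Lambda> where L: "differential_at_id X k f \<Lambda>"
    using t unfolding has_differential_def by blast
  note L = differential_at_idD[OF L]
    show ?thesis
    proof (unfold has_differential_def, rule exI, rule differential_at_idI[OF L(1)])
      fix A :: "nat \<Rightarrow> _" and d :: nat assume A: "1 \<le> d" "\<And>j. A j \<in> poly_maps X k" "\<And>p. p \<in> X \<Longrightarrow> A 0 p = p"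
      show "\<exists>q. (\<forall>s. g (poly_arc X d A s, poly_arc X d A (- s)) = poly q s) \<and> coeff q 1 = \<Lambda> (A 1)"
        using L(2)[of d A, OF A] e[of "(poly_arc X d A _, poly_arc X d A _)"] poly_arc_poly_maps[of A X k d] A(2) by simp
    qed
  qed
  obtain F where F: "h = restrict F (poly_maps X k \<times> poly_maps X k)" "is_poly ?S F"
    using assms by (auto simp: prod_variety_def regs_variety_gen poly_maps_variety_def)
  have "has_differential X k s" if "s \<in> ?S" for s
  proof -
    have S: "s \<in> {\<lambda>p. f (fst p) | f. f \<in> regs ?PM} \<or> s \<in> {\<lambda>p. g (snd p) | g. g \<in> regs ?PM}" using that by blast
    have regs: "\<exists>G. f = restrict G (poly_maps X k) \<and> is_poly ?L G" if "f \<in> regs ?PM" for f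
      using that by (auto simp: regs_variety_gen poly_maps_variety_def)
    from S show ?thesis
    proof
      assume "s \<in> {\<lambda>p. f (fst p) | f. f \<in> regs ?PM}"
      then obtain G where G: "s = (\<lambda>p. restrict G (poly_maps X k) (fst p))" "is_poly ?L G" using regs by blast
      have "has_differential X k (\<lambda>x. G (fst x))"
        by (rule has_differential_is_poly[OF G(2)]) (use has_differential_linear_functional in auto)
      then show ?thesis by (rule cong) (simp add: G(1))
    next
      assume "s \<in> {\<lambda>p. g (snd p) | g. g \<in> regs ?PM}"
      then obtain G where G: "s = (\<lambda>p. restrict G (poly_maps X k) (snd p))" "is_poly ?L G" using regs by blast
      have "has_differential X k (\<lambda>x. G (snd x))"
        by (rule has_differential_is_poly[OF G(2)]) (use has_differential_linear_functional in auto)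
      then show ?thesis by (rule cong) (simp add: G(1))
    qed
  qed
  then have "has_differential X k F" by (rule has_differential_is_poly[OF F(2), of X k "\<lambda>x. x"])
  then show ?thesis by (rule cong) (auto simp: F(1) mem_Times_iff)
qed

text \<open>
  The same for a function \<open>f\<close> on the group, along additive actions. Here \<open>A 1\<close> is the
  generating vector field of \<open>a\<close>.
\<close>

definition action_differential where
  "action_differential X k f \<Lambda> \<longleftrightarrow> linear_functional X k \<Lambda> \<and>
     (\<forall>a A d. additive_action X a \<longrightarrow> 1 \<le> d \<longrightarrow> (\<forall>j. A j \<in> poly_maps X k) \<longrightarrow>
       (\<forall>s. restrict (a s) X = poly_arc X d A s) \<longrightarrow>
       (\<exists>q. (\<forall>s. f (restrict (a s) X) = poly q s) \<and> coeff q 1 = \<Lambda> (A 1)))"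

lemma action_differentialD:
  assumes "action_differential X k f \<Lambda>"
  shows "linear_functional X k \<Lambda>"
    "additive_action X a \<Longrightarrow> 1 \<le> d \<Longrightarrow> (\<And>j. A j \<in> poly_maps X k) \<Longrightarrow>
       (\<And>s. restrict (a s) X = poly_arc X d A s) \<Longrightarrow>
       \<exists>q. (\<forall>s. f (restrict (a s) X) = poly q s) \<and> coeff q 1 = \<Lambda> (A 1)"
  using assms unfolding action_differential_def by simp_all

lemma action_in_stage:
  assumes a: "additive_action X a" and "\<And>j. A j \<in> poly_maps X k" "\<And>s. restrict (a s) X = poly_arc X d A s"
  shows "restrict (a s) X \<in> points (stage (U X) k)"
  using carrier_Aut[OF additive_action_carrier[OF a]] additive_action_U[OF a] poly_arc_poly_maps[of A X k d] assms(2)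
  by (simp add: aut_points_def inv_action[OF a] stage_U) (simp add: assms(3))

text \<open>
  The regular functions of a stage are polynomials in linear functionals of an automorphism and of
  its inverse, and the inverse of the time \<open>s\<close> of an action is its time \<open>- s\<close>.
\<close>

lemma stage_regs_differential:
  assumes "f \<in> regs (stage (U X) k)" shows "\<exists>\<Lambda>. action_differential X k f \<Lambda>"
proof -
  obtain h where h: "h \<in> regs (prod_variety (poly_maps_variety X k) (poly_maps_variety X k))"
    "f = restrict (\<lambda>g\<in>aut_points X k. h (g, inv\<^bsub>BijGroup X\<^esub> g)) (aut_points X k \<inter> carrier (U X))"
    using assms unfolding stage_U aut_stage_def by auto
  obtain \<Lambda> where L: "differential_at_id X k h \<Lambda>"
    using has_differential_regs[OF h(1)] unfolding has_differential_def by blast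
  note L = differential_at_idD[OF L]
  have "\<exists>q. (\<forall>s. f (restrict (a s) X) = poly q s) \<and> coeff q 1 = \<Lambda> (A 1)"
    if a: "additive_action X a" and A: "1 \<le> d" "\<And>j. A j \<in> poly_maps X k"
      and poly_arc: "\<And>s. restrict (a s) X = poly_arc X d A s" for a A d
  proof -
    have A0: "A 0 p = p" if p: "p \<in> X" for p
    proof -
      have "(\<Sum>j\<le>d. 0 ^ j *s A j p) = A 0 p" by (induction d) (auto simp: vec_eq_iff)
      then show ?thesis
        using fun_cong[OF poly_arc[of 0], of p] additive_actionD(2)[OF a p] p by (simp add: poly_arc_def)
    qed
    obtain q where "\<forall>s. h (poly_arc X d A s, poly_arc X d A (- s)) = poly q s" "coeff q 1 = \<Lambda> (A 1)"
      using L(2)[of d A, OF A A0] by blast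
    moreover have "f (restrict (a s) X) = h (poly_arc X d A s, poly_arc X d A (- s))" for s
      using action_in_stage[of X a A k d s, OF a A(2) poly_arc]
      by (simp add: h(2) stage_U inv_action[OF a]) (simp add: poly_arc)
    ultimately show ?thesis by auto
  qed
  then show ?thesis using L(1) unfolding action_differential_def by blast
qed

text \<open>
  An additive action lies in a single stage, and its expansion in \<open>s\<close> starts with the identity and
  the generating vector field.
\<close>

lemma action_expansion:
  fixes X :: "(complex^'n) set"
  assumes a: "additive_action X a"
  obtains A d k where "1 \<le> d" "\<And>j. A j \<in> poly_maps X k" "\<And>s. restrict (a s) X = poly_arc X d A s"
    "\<And>V p. p \<in> X \<Longrightarrow> curve_deriv (\<lambda>s. a s p) (V p) \<Longrightarrow> A 1 p = V p"
proof -
  have "\<exists>c d. (\<forall>p. degree (c p) \<le> d) \<and> (\<forall>j. is_poly coords (\<lambda>p. coeff (c p) j)) \<and>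
      (\<forall>t. \<forall>p\<in>X. a t p $ i = poly (c p) t)" for i
    using additive_action_poly_family[OF a, of i] unfolding poly_family_def .
  then obtain c e where c: "\<And>i p. degree (c i p) \<le> e i" "\<And>i j. is_poly coords (\<lambda>p. coeff (c i p) j)"
    "\<And>i t p. p \<in> X \<Longrightarrow> a t p $ i = poly (c i p) t" by metis
  define d where "d = Suc (Max (range e))"
  have d: "degree (c i p) \<le> d" for i p
    using c(1)[of i p] Max_ge[of "range e" "e i"] unfolding d_def by (meson finite finite_imageI le_SucI order_trans rangeI)
  obtain n where n: "\<And>i j. poly_fun coords (n i j) (\<lambda>p. coeff (c i p) j)"
    using c(2) unfolding is_poly_def by metis
  define k where "k = Max ((\<lambda>(i, j). n i j) ` (UNIV \<times> {..d}))"
  define A where "A j = (\<lambda>p\<in>X. \<chi> i. coeff (c i p) j)" for j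
  have "poly_fun coords k (\<lambda>p. coeff (c i p) j)" for i j
  proof (cases "j \<le> d")
    case True
    then have "n i j \<le> k" unfolding k_def by (intro Max_ge) auto
    then show ?thesis by (rule poly_fun_mono[OF n])
  next
    case False
    then have "coeff (c i p) j = 0" for p using d[of i p] by (intro coeff_eq_0) simp
    then show ?thesis by (simp add: poly_fun.const)
  qed
  then have A: "A j \<in> poly_maps X k" for j
    unfolding poly_maps_def A_def by auto
  have poly_arc: "restrict (a s) X = poly_arc X d A s" for s
    by (auto simp: poly_arc_def A_def vec_eq_iff c(3) poly_eq_sum_atMost[OF d] mult.commute intro!: restrict_ext)
  have "A 1 p = V p" if "p \<in> X" "curve_deriv (\<lambda>s. a s p) (V p)" for V p
  proof -
    have "((\<lambda>s. a s p $ i) has_field_derivative coeff (c i p) 1) (at 0)" for i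
      using poly_DERIV[of "c i p" 0] by (simp add: c(3)[OF that(1)] poly_0_coeff_0 coeff_pderiv)
    then have "curve_deriv (\<lambda>s. a s p) (A 1 p)" using that(1) by (simp add: curve_deriv_def A_def)
    then show ?thesis using that(2) curve_deriv_unique by blast
  qed
  then show ?thesis using that[OF _ A poly_arc] by (simp add: d_def)
qed

section \<open>Regular representations for the smooth quadric\<close>

text \<open>
  What an isomorphism of ind-groups would make of the tangent representation of the cone.
\<close>

locale stagewise_rep =
  fixes X :: "(complex^'n) set" and \<alpha> \<beta> and \<psi> :: "(complex^'n \<Rightarrow> complex^'n) \<Rightarrow> complex^3^3"
  assumes iso: "poly_iso X \<alpha> (quadric 1) \<beta>"
    and \<psi>_mult: "g \<in> carrier (U X) \<Longrightarrow> h \<in> carrier (U X) \<Longrightarrow> \<psi> (g \<otimes>\<^bsub>U X\<^esub> h) = \<psi> g ** \<psi> h"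
    and \<psi>_one: "\<psi> \<one>\<^bsub>U X\<^esub> = mat 1"
    and \<psi>_reg: "\<exists>f\<in>regs (stage (U X) k). \<forall>g\<in>points (stage (U X) k). \<psi> g $ i $ j = f g"
begin

definition \<Theta> where "\<Theta> b s = \<psi> (restrict (lift_action \<alpha> \<beta> b s) X)"

lemma \<psi>_differential: "\<exists>\<Lambda>. action_differential X k (\<lambda>g. \<psi> g $ i $ j) \<Lambda>"
proof -
  obtain f where f: "f \<in> regs (stage (U X) k)" "\<And>g. g \<in> points (stage (U X) k) \<Longrightarrow> \<psi> g $ i $ j = f g"
    using \<psi>_reg[of k i j] by blast
  obtain L where L: "action_differential X k f L" using stage_regs_differential[OF f(1)] by blast
  have "\<exists>q. (\<forall>s. \<psi> (restrict (a s) X) $ i $ j = poly q s) \<and> coeff q 1 = L (A 1)"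
    if a: "additive_action X a" "1 \<le> d" "\<And>j. A j \<in> poly_maps X k" "\<And>s. restrict (a s) X = poly_arc X d A s" for a A d
    using action_differentialD(2)[OF L, of a d A, OF a] f(2)[OF action_in_stage[OF a(1,3,4)]] by auto
  then show ?thesis
    using action_differentialD(1)[OF L] unfolding action_differential_def by blast
qed

text \<open>
  The differential of a regular representation is well defined: in a sufficiently large stage the
  image of a vector field is given by linear functionals. The stage depends on the fields that occur
  in a linear combination, therefore the claim is made for all large stages.
\<close>

lemma tangent_\<Theta>_0:
  assumes "tangent \<Theta> (\<lambda>p. 0) m" shows "m = 0"
proof -
  obtain \<Lambda> where D: "\<And>k i j. action_differential X k (\<lambda>g. \<psi> g $ i $ j) (\<Lambda> k i j)"
    using \<psi>_differential by metis
  note L = action_differentialD[OF D]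
  have "\<exists>J. \<forall>\<gamma> w. \<gamma> 0 = q \<longrightarrow> curve_deriv \<gamma> w \<longrightarrow> curve_deriv (\<lambda>s. \<beta> (\<gamma> s)) (J *v w)" for q
    by (rule polymap_jacobian[OF poly_isoD(2)[OF iso], of q]) blast
  then obtain J where J: "\<And>q \<gamma> w. \<gamma> 0 = q \<Longrightarrow> curve_deriv \<gamma> w \<Longrightarrow> curve_deriv (\<lambda>s. \<beta> (\<gamma> s)) (J q *v w)"
    by metis
  \<comment> \<open>The vector field on \<open>X\<close> that corresponds to a field on the quadric.\<close>
  define push where "push V = (\<lambda>p\<in>X. J (\<alpha> p) *v V (\<alpha> p))" for V
  have "\<exists>k. \<forall>l\<ge>k. push V \<in> poly_maps X l \<and> (\<forall>i j. \<Lambda> l i j (push V) = m $ i $ j)"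
    if "tangent \<Theta> V m" for V m
    using that
  proof induction
    case (gen b V m)
    have a: "additive_action X (lift_action \<alpha> \<beta> b)" by (rule lift_action[OF iso gen(1)])
    obtain A d k where A: "1 \<le> d" "\<And>j. A j \<in> poly_maps X k"
      "\<And>s. restrict (lift_action \<alpha> \<beta> b s) X = poly_arc X d A s"
      "\<And>V p. p \<in> X \<Longrightarrow> curve_deriv (\<lambda>s. lift_action \<alpha> \<beta> b s p) (V p) \<Longrightarrow> A 1 p = V p"
      by (rule action_expansion[OF a]) (rule that)
    have "A 1 p = push V p" if "p \<in> X" for p
    proof (rule A(4)[OF that])
      have q: "\<alpha> p \<in> quadric 1" by (rule poly_isoD(3)[OF iso that])
      show "curve_deriv (\<lambda>s. lift_action \<alpha> \<beta> b s p) (push V p)"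
        unfolding lift_action_def push_def using that
        by (simp add: J[OF additive_actionD(2)[OF gen(1) q] gen(2)[OF q]])
    qed
    then have 1: "A 1 = push V"
      using A(2)[of 1] by (intro extensionalityI[of _ X]) (auto simp: poly_maps_def push_def)
    show ?case
    proof (intro exI allI impI conjI)
      fix l assume "l \<ge> k"
      then have Al: "A j \<in> poly_maps X l" for j using poly_maps_mono A(2) by blast
      then show "push V \<in> poly_maps X l" using 1 by metis
      fix i j
      obtain q where q: "\<forall>s. \<psi> (restrict (lift_action \<alpha> \<beta> b s) X) $ i $ j = poly q s" "coeff q 1 = \<Lambda> l i j (A 1)"
        using L(2)[of "lift_action \<alpha> \<beta> b" d A l i j, OF a A(1) Al A(3)] by blast
      have "((\<lambda>s. \<Theta> b s $ i $ j) has_field_derivative coeff q 1) (at 0)"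
        using poly_DERIV[of q 0] q(1) by (simp add: \<Theta>_def poly_0_coeff_0 coeff_pderiv)
      moreover have "((\<lambda>s. \<Theta> b s $ i $ j) has_field_derivative m $ i $ j) (at 0)"
        using gen(3) by (simp add: matrix_deriv_def)
      ultimately show "\<Lambda> l i j (push V) = m $ i $ j" using DERIV_unique q(2) 1 by metis
    qed
  next
    case (lin V m V' m' x y)
    then obtain k k' where k: "\<And>l. l \<ge> k \<Longrightarrow> push V \<in> poly_maps X l \<and> (\<forall>i j. \<Lambda> l i j (push V) = m $ i $ j)"
      "\<And>l. l \<ge> k' \<Longrightarrow> push V' \<in> poly_maps X l \<and> (\<forall>i j. \<Lambda> l i j (push V') = m' $ i $ j)" by blast
    have e: "push (\<lambda>p. x *s V p + y *s V' p) = (\<lambda>p\<in>X. (\<lambda>p\<in>X. x *s push V p) p + (\<lambda>p\<in>X. y *s push V' p) p)"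
      by (auto simp: push_def matrix_vector_right_distrib vector_scalar_commute intro!: restrict_ext)
    show ?case
    proof (intro exI allI impI conjI)
      fix l assume "l \<ge> max k k'"
      then have l: "push V \<in> poly_maps X l" "\<And>i j. \<Lambda> l i j (push V) = m $ i $ j"
        "push V' \<in> poly_maps X l" "\<And>i j. \<Lambda> l i j (push V') = m' $ i $ j" using k by auto
      note sc = poly_maps_scale[OF l(1), of x] poly_maps_scale[OF l(3), of y]
      show "push (\<lambda>p. x *s V p + y *s V' p) \<in> poly_maps X l"
        unfolding e by (rule poly_maps_add[OF sc])
      fix i j
      have lf: "\<And>f g. f \<in> poly_maps X l \<Longrightarrow> g \<in> poly_maps X l \<Longrightarrow>
          \<Lambda> l i j (\<lambda>p\<in>X. f p + g p) = \<Lambda> l i j f + \<Lambda> l i j g"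
        "\<And>c f. f \<in> poly_maps X l \<Longrightarrow> \<Lambda> l i j (\<lambda>p\<in>X. c *s f p) = c * \<Lambda> l i j f"
        using L(1)[of l i j] unfolding linear_functional_def by blast+
      show "\<Lambda> l i j (push (\<lambda>p. x *s V p + y *s V' p)) = (cscale x m + cscale y m') $ i $ j"
        unfolding e lf(1)[OF sc] lf(2)[OF l(1)] lf(2)[OF l(3)] by (simp add: l)
    qed
  next
    case (cong V m V')
    have "push V = push V'"
      unfolding push_def by (rule restrict_ext) (simp add: cong(2) poly_isoD(3)[OF iso])
    then show ?case using cong(3) by simp
  qed
  from this[OF assms] obtain k where k: "push (\<lambda>p. 0) \<in> poly_maps X k"
    "\<And>i j. \<Lambda> k i j (push (\<lambda>p. 0)) = m $ i $ j" by blast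
  have "push (\<lambda>p. 0) = (\<lambda>p\<in>X. 0 *s push (\<lambda>p. 0) p)"
    by (auto simp: push_def intro!: restrict_ext)
  then have "\<Lambda> k i j (push (\<lambda>p. 0)) = 0 * \<Lambda> k i j (push (\<lambda>p. 0))" for i j
    using L(1)[of k i j] k(1) unfolding linear_functional_def by metis
  then show ?thesis using k(2) by (simp add: vec_eq_iff)
qed

lemma \<psi>_compose:
  assumes "additive_action X a" "additive_action X b"
  shows "\<psi> (compose X (restrict (a s) X) (restrict (b t) X)) = \<psi> (restrict (a s) X) ** \<psi> (restrict (b t) X)"
  using \<psi>_mult[OF additive_action_U[OF assms(1)] additive_action_U[OF assms(2)], of s t]
    mult_U[OF additive_action_U[OF assms(1)] additive_action_U[OF assms(2)], of s t] by simp

sublocale action_rep \<Theta>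
proof
  fix a b s t i j m
  assume b: "additive_action (quadric 1) b"
  note B = lift_action[OF iso b] and D = additive_actionD[OF b] and I = poly_isoD[OF iso]
  have "restrict (lift_action \<alpha> \<beta> b (s + t)) X
      = compose X (restrict (lift_action \<alpha> \<beta> b s) X) (restrict (lift_action \<alpha> \<beta> b t) X)"
    by (auto simp: compose_def lift_action_def D I intro!: restrict_ext)
  then show "\<Theta> b (s + t) = \<Theta> b s ** \<Theta> b t" by (simp add: \<Theta>_def \<psi>_compose[OF B B])
  have "restrict (lift_action \<alpha> \<beta> b 0) X = \<one>\<^bsub>U X\<^esub>"
    by (auto simp: U_simps lift_action_def D I intro!: restrict_ext)
  then show "\<Theta> b 0 = mat 1" by (simp add: \<Theta>_def \<psi>_one)
  obtain A d k where A: "1 \<le> d" "\<And>j. A j \<in> poly_maps X k"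
      "\<And>s. restrict (lift_action \<alpha> \<beta> b s) X = poly_arc X d A s"
    by (rule action_expansion[OF B]) (rule that)
  obtain \<Lambda> where "action_differential X k (\<lambda>g. \<psi> g $ i $ j) \<Lambda>" using \<psi>_differential by blast
  from action_differentialD(2)[OF this, of "lift_action \<alpha> \<beta> b" d A, OF B A] show "\<exists>q. \<forall>s. \<Theta> b s $ i $ j = poly q s" unfolding \<Theta>_def by blast
  assume a: "additive_action (quadric 1) a"
  note A = lift_action[OF iso a] and E = additive_actionD[OF a]
  have C: "additive_action X (\<lambda>r p. lift_action \<alpha> \<beta> a t (lift_action \<alpha> \<beta> b r (lift_action \<alpha> \<beta> a (- t) p)))"
    by (rule conj_action[OF A B])
  let ?a = "restrict (lift_action \<alpha> \<beta> a t) X" and ?b = "restrict (lift_action \<alpha> \<beta> b s) X"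
    and ?a' = "restrict (lift_action \<alpha> \<beta> a (- t)) X"
  have e: "restrict (lift_action \<alpha> \<beta> (\<lambda>s p. a t (b s (a (- t) p))) s) X = compose X (compose X ?a ?b) ?a'"
    by (auto simp: compose_def lift_action_def D E I intro!: restrict_ext)
  have U: "?a \<in> carrier (U X)" "?b \<in> carrier (U X)" "?a' \<in> carrier (U X)"
    using additive_action_U[OF A] additive_action_U[OF B] by blast+
  have ab: "?a \<otimes>\<^bsub>U X\<^esub> ?b \<in> carrier (U X)"
    using U group_U[of X] by (meson group.is_monoid monoid.m_closed)
  have "\<psi> ((?a \<otimes>\<^bsub>U X\<^esub> ?b) \<otimes>\<^bsub>U X\<^esub> ?a') = \<psi> ?a ** \<psi> ?b ** \<psi> ?a'"
    by (simp only: \<psi>_mult U ab)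
  moreover have "(?a \<otimes>\<^bsub>U X\<^esub> ?b) \<otimes>\<^bsub>U X\<^esub> ?a' = compose X (compose X ?a ?b) ?a'"
    by (rule trans[OF mult_U[OF ab U(3)]]) (simp only: mult_U[OF U(1,2)])
  ultimately show "\<Theta> (\<lambda>s p. a t (b s (a (- t) p))) s = \<Theta> a t ** \<Theta> b s ** \<Theta> a (- t)"
    unfolding \<Theta>_def e by simp
qed (rule tangent_\<Theta>_0)

text \<open>
  The group is generated by additive actions by definition, and on those the representation is
  trivial.
\<close>

theorem \<psi>_trivial:
  assumes "g \<in> carrier (U X)" shows "\<psi> g = mat 1"
proof -
  note I = poly_isoD[OF iso]
  have gen: "\<psi> (restrict (a s) X) = mat 1" if a: "additive_action X a" for a s
  proof -
    have b: "additive_action (quadric 1) (lift_action \<beta> \<alpha> a)"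
      by (rule lift_action[OF poly_iso_sym[OF iso] a])
    have "restrict (a s) X = restrict (lift_action \<alpha> \<beta> (lift_action \<beta> \<alpha> a) s) X"
      by (auto simp: lift_action_def I additive_actionD[OF a] intro!: restrict_ext)
    then show ?thesis using representation_trivial[OF b, of s] by (simp add: \<Theta>_def)
  qed
  have "g \<in> generate (Aut X) {restrict (a t) X | a t. additive_action X a}"
    using assms by (simp add: U_simps)
  then show ?thesis
  proof induction
    case one
    show ?case using \<psi>_one unfolding U_simps(3,4) .
  next
    case (incl h)
    then show ?case using gen by auto
  next
    case (inv h)
    then obtain a t where a: "additive_action X a" "h = restrict (a t) X" by blast
    have "inv\<^bsub>Aut X\<^esub> h = restrict (a (- t)) X"
    proof (rule group.inv_equality[OF group_Aut])
      show "restrict (a (- t)) X \<otimes>\<^bsub>Aut X\<^esub> h = \<one>\<^bsub>Aut X\<^esub>"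
        using carrier_Aut[OF additive_action_carrier[OF a(1)]] additive_actionD[OF a(1)]
        by (auto simp: a(2) mult_Aut U_simps compose_def intro!: restrict_ext)
    qed (use additive_action_carrier[OF a(1)] a(2) in auto)
    then show ?case using gen[OF a(1), of "- t"] by (simp only:)
  next
    case (eng h1 h2)
    then show ?case using \<psi>_mult[of h1 h2] by (simp add: U_simps)
  qed
qed

end

section \<open>The tangent representation at the vertex of the cone\<close>

lemma cone_basis:
  "vector [1, 0, 0] \<in> quadric 0" "vector [0, 1, 0] \<in> quadric 0" "vector [1, 1, 2] \<in> quadric 0"
  by (simp_all add: quadric_def)

lemma cone_scale: "w \<in> quadric 0 \<Longrightarrow> \<sigma> *s w \<in> quadric 0"
proof -
  assume "w \<in> quadric 0"
  then have "(w $ 3)\<^sup>2 - 4 * w $ 1 * w $ 2 = 0" by (simp add: quadric_def)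
  then have "(\<sigma> * w $ 3)\<^sup>2 - 4 * (\<sigma> * w $ 1) * (\<sigma> * w $ 2) = 0" by algebra
  then show ?thesis by (simp add: quadric_def)
qed

lemma matrix_columns:
  fixes A :: "complex^3^'k"
  shows "(A *v vector [1, 0, 0]) $ i = A $ i $ 1" "(A *v vector [0, 1, 0]) $ i = A $ i $ 2"
    "(A *v vector [1, 1, 2]) $ i = A $ i $ 1 + A $ i $ 2 + 2 * A $ i $ 3"
  by (simp_all add: matrix_vector_mult_def sum_3)

text \<open>
  The cone contains a basis of the ambient space.
\<close>

lemma cone_spans:
  fixes A B :: "complex^3^'k"
  assumes "\<And>w. w \<in> quadric 0 \<Longrightarrow> A *v w = B *v w" shows "A = B"
proof -
  have e: "(A *v w) $ i = (B *v w) $ i" if "w \<in> quadric 0" for w i using assms[OF that] by simp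
  show ?thesis
    using e[OF cone_basis(1)] e[OF cone_basis(2)] e[OF cone_basis(3)]
    by (simp add: vec_eq_iff forall_3 matrix_columns)
qed

lemma poly_maps_polymap:
  assumes "f \<in> poly_maps X k" obtains \<Phi> where "polymap \<Phi>" "\<And>p. p \<in> X \<Longrightarrow> f p = \<Phi> p"
proof -
  have "\<exists>P. is_poly coords P \<and> (\<forall>p\<in>X. f p $ i = P p)" for i
    using assms unfolding poly_maps_def is_poly_def by blast
  then obtain P where "\<And>i. is_poly coords (P i)" "\<And>i p. p \<in> X \<Longrightarrow> f p $ i = P i p" by metis
  then show ?thesis by (intro that[of "\<lambda>p. \<chi> i. P i p"]) (auto simp: polymap_def vec_eq_iff)
qed

lemma curve_deriv_cong: "curve_deriv \<gamma> w \<Longrightarrow> (\<And>s. \<gamma> s = \<delta> s) \<Longrightarrow> curve_deriv \<delta> w"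
  by (simp add: curve_deriv_def)

lemma carrier_Aut_inverse:
  assumes "g \<in> carrier (Aut X)"
  obtains k h where "g \<in> poly_maps X k" "h \<in> poly_maps X k" "\<And>p. p \<in> X \<Longrightarrow> g p \<in> X"
    "\<And>p. p \<in> X \<Longrightarrow> h p \<in> X" "\<And>p. p \<in> X \<Longrightarrow> h (g p) = p"
proof -
  let ?h = "inv\<^bsub>BijGroup X\<^esub> g"
  obtain k where k: "g \<in> Bij X" "g \<in> poly_maps X k" "?h \<in> poly_maps X k"
    using assms by (auto simp: Aut_def aut_points_def)
  have G: "g \<in> carrier (BijGroup X)" using k(1) by (simp add: BijGroup_def)
  then have H: "?h \<in> Bij X" using group.inv_closed[OF group_BijGroup] by (metis BijGroup_def partial_object.select_convs(1))
  have maps: "f p \<in> X" if "f \<in> Bij X" "p \<in> X" for f p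
    using that by (auto simp: Bij_def bij_betw_def)
  have "?h \<otimes>\<^bsub>BijGroup X\<^esub> g = \<one>\<^bsub>BijGroup X\<^esub>" by (rule group.l_inv[OF group_BijGroup G])
  then have e: "compose X ?h g = (\<lambda>x\<in>X. x)" using k(1) H by (simp add: BijGroup_def)
  have "?h (g p) = p" if p: "p \<in> X" for p
  proof -
    have "?h (g p) = compose X ?h g p" using p by (simp add: compose_eq)
    also have "\<dots> = p" unfolding e using p by simp
    finally show ?thesis .
  qed
  then show ?thesis using that[OF k(2,3)] maps[OF k(1)] maps[OF H] by blast
qed

text \<open>
  \<open>J\<alpha>\<close> is the differential of the coordinates of the cone at its vertex \<open>\<beta> 0\<close>.
\<close>

locale cone_model =
  fixes Y :: "(complex^'m) set" and \<alpha> \<beta> and J\<alpha> :: "complex^'m^3"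
  assumes iso: "poly_iso Y \<alpha> (quadric 0) \<beta>"
    and J\<alpha>: "\<And>\<gamma> w. \<gamma> 0 = \<beta> 0 \<Longrightarrow> curve_deriv \<gamma> w \<Longrightarrow> curve_deriv (\<lambda>s. \<alpha> (\<gamma> s)) (J\<alpha> *v w)"
begin

text \<open>
  The cone consists of lines through the vertex, so that the differential at the vertex can be read
  off from these lines. It is thereby linear in \<open>f\<close>, for every embedding of the cone.
\<close>

definition ray_deriv :: "(complex^'m \<Rightarrow> complex^'m) \<Rightarrow> complex^3 \<Rightarrow> complex^'m" where
  "ray_deriv f w = (\<chi> i. deriv (\<lambda>\<sigma>. f (\<beta> (\<sigma> *s w)) $ i) 0)"

text \<open>
  The last column uses that \<open>(0, 0, 2)\<close> is \<open>(1, 1, 2) - (1, 0, 0) - (0, 1, 0)\<close>, as it is not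
  itself on the cone.
\<close>

definition vertex_jac :: "(complex^'m \<Rightarrow> complex^'m) \<Rightarrow> complex^3^'m" where
  "vertex_jac f = (\<chi> i. vector [ray_deriv f (vector [1, 0, 0]) $ i, ray_deriv f (vector [0, 1, 0]) $ i,
     (ray_deriv f (vector [1, 1, 2]) $ i - ray_deriv f (vector [1, 0, 0]) $ i - ray_deriv f (vector [0, 1, 0]) $ i) / 2])"

definition \<rho> :: "(complex^'m \<Rightarrow> complex^'m) \<Rightarrow> complex^3^3" where
  "\<rho> f = J\<alpha> ** vertex_jac f"

lemma \<beta>_ray: "w \<in> quadric 0 \<Longrightarrow> \<beta> (\<sigma> *s w) \<in> Y"
  using poly_isoD(5)[OF iso cone_scale] .

lemma vertex_jac_eq:
  assumes "\<And>w. w \<in> quadric 0 \<Longrightarrow> curve_deriv (\<lambda>\<sigma>. f (\<beta> (\<sigma> *s w))) (J *v w)"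
  shows "vertex_jac f = J"
proof -
  have "ray_deriv f w = J *v w" if "w \<in> quadric 0" for w
    using assms[OF that] by (simp add: ray_deriv_def vec_eq_iff curve_deriv_def DERIV_imp_deriv)
  then show ?thesis
    by (simp add: vertex_jac_def vec_eq_iff forall_3 cone_basis matrix_columns)
qed

lemma vertex_jac_curve:
  assumes f: "f \<in> poly_maps Y k"
    and \<delta>: "\<And>\<sigma>. \<delta> \<sigma> \<in> quadric 0" "\<delta> 0 = 0" "curve_deriv \<delta> v"
  shows "curve_deriv (\<lambda>\<sigma>. f (\<beta> (\<delta> \<sigma>))) (vertex_jac f *v v)"
proof -
  obtain \<Phi> where \<Phi>: "polymap \<Phi>" "\<And>p. p \<in> Y \<Longrightarrow> f p = \<Phi> p"
    using f by (rule poly_maps_polymap) (rule that)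
  have "polymap (\<lambda>q. \<Phi> (\<beta> q))" by (rule polymap_comp[OF \<Phi>(1) poly_isoD(2)[OF iso]])
  then obtain J where J: "\<And>\<gamma> w. \<gamma> 0 = 0 \<Longrightarrow> curve_deriv \<gamma> w \<Longrightarrow> curve_deriv (\<lambda>s. \<Phi> (\<beta> (\<gamma> s))) (J *v w)"
    by (rule polymap_jacobian[where a = 0]) (rule that)
  have curve: "curve_deriv (\<lambda>\<sigma>. f (\<beta> (\<gamma> \<sigma>))) (J *v w)"
    if "\<And>\<sigma>. \<gamma> \<sigma> \<in> quadric 0" "\<gamma> 0 = 0" "curve_deriv \<gamma> w" for \<gamma> w
    by (rule curve_deriv_cong[OF J[OF that(2,3)]]) (simp add: \<Phi>(2) poly_isoD(5)[OF iso that(1)])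
  have "vertex_jac f = J"
    by (rule vertex_jac_eq, rule curve) (auto intro: cone_scale curve_deriv_line)
  then show ?thesis using curve[OF \<delta>] by simp
qed

lemma vertex_jac_ray:
  "f \<in> poly_maps Y k \<Longrightarrow> w \<in> quadric 0 \<Longrightarrow> curve_deriv (\<lambda>\<sigma>. f (\<beta> (\<sigma> *s w))) (vertex_jac f *v w)"
  by (rule vertex_jac_curve) (auto intro: cone_scale curve_deriv_line)

lemma linear_functional_\<rho>: "linear_functional Y k (\<lambda>f. \<rho> f $ i $ j)"
proof -
  have add: "vertex_jac (\<lambda>p\<in>Y. f p + g p) = vertex_jac f + vertex_jac g"
    if "f \<in> poly_maps Y k" "g \<in> poly_maps Y k" for f g
  proof (rule vertex_jac_eq)
    fix w assume w: "w \<in> quadric 0"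
    from vertex_jac_ray[OF that(1) w] vertex_jac_ray[OF that(2) w]
    show "curve_deriv (\<lambda>\<sigma>. (\<lambda>p\<in>Y. f p + g p) (\<beta> (\<sigma> *s w))) ((vertex_jac f + vertex_jac g) *v w)"
      by (simp add: curve_deriv_def \<beta>_ray[OF w] matrix_vector_mult_add_rdistrib DERIV_add)
  qed
  have scale: "vertex_jac (\<lambda>p\<in>Y. c *s f p) = cscale c (vertex_jac f)" if "f \<in> poly_maps Y k" for f c
  proof (rule vertex_jac_eq)
    fix w assume w: "w \<in> quadric 0"
    have e: "(cscale c (vertex_jac f) *v w) $ i = c * (vertex_jac f *v w) $ i" for i
      by (simp add: matrix_vector_mult_def sum_distrib_left mult.assoc)
    from vertex_jac_ray[OF that w]
    show "curve_deriv (\<lambda>\<sigma>. (\<lambda>p\<in>Y. c *s f p) (\<beta> (\<sigma> *s w))) (cscale c (vertex_jac f) *v w)"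
      by (simp add: curve_deriv_def \<beta>_ray[OF w] e DERIV_cmult)
  qed
  show ?thesis
    unfolding linear_functional_def \<rho>_def
    by (simp add: add scale matrix_add_ldistrib)
      (simp add: matrix_matrix_mult_def sum_distrib_left mult_ac)
qed

text \<open>
  The vertex is the only singular point. If it were mapped to the point with coordinates \<open>c\<close>, then
  the differential at the vertex would be invertible, since it has the one of the inverse as a left
  inverse. But its image lies in the tangent space of the cone at \<open>c\<close>, which is the kernel of the
  gradient of the equation, and this gradient vanishes for \<open>c = 0\<close> only.
\<close>

lemma vertex_fixed:
  assumes "g \<in> carrier (Aut Y)" shows "g (\<beta> 0) = \<beta> 0"
proof -
  note I = poly_isoD[OF iso]
  obtain k h where g: "g \<in> poly_maps Y k" "h \<in> poly_maps Y k" "\<And>p. p \<in> Y \<Longrightarrow> g p \<in> Y"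
    "\<And>p. p \<in> Y \<Longrightarrow> h p \<in> Y" "\<And>p. p \<in> Y \<Longrightarrow> h (g p) = p"
    using assms by (rule carrier_Aut_inverse) (rule that)
  obtain \<Phi> where \<Phi>: "polymap \<Phi>" "\<And>p. p \<in> Y \<Longrightarrow> g p = \<Phi> p"
    using g(1) by (rule poly_maps_polymap) (rule that)
  obtain \<Psi> where \<Psi>: "polymap \<Psi>" "\<And>p. p \<in> Y \<Longrightarrow> h p = \<Psi> p"
    using g(2) by (rule poly_maps_polymap) (rule that)
  define c where "c = \<alpha> (g (\<beta> 0))"
  have 0: "0 \<in> quadric 0" by (simp add: quadric_def)
  have P: "polymap (\<lambda>q. \<alpha> (\<Phi> (\<beta> q)))" "polymap (\<lambda>q. \<alpha> (\<Psi> (\<beta> q)))"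
    by (rule polymap_comp[OF I(1) polymap_comp[OF \<Phi>(1) I(2)]],
        rule polymap_comp[OF I(1) polymap_comp[OF \<Psi>(1) I(2)]])
  obtain A :: "complex^3^3" where
    A: "\<And>\<gamma> w. \<gamma> 0 = 0 \<Longrightarrow> curve_deriv \<gamma> w \<Longrightarrow> curve_deriv (\<lambda>s. \<alpha> (\<Phi> (\<beta> (\<gamma> s)))) (A *v w)"
    using P(1) by (rule polymap_jacobian[where a = 0]) (rule that)
  obtain B :: "complex^3^3" where
    B: "\<And>\<gamma> w. \<gamma> 0 = c \<Longrightarrow> curve_deriv \<gamma> w \<Longrightarrow> curve_deriv (\<lambda>s. \<alpha> (\<Psi> (\<beta> (\<gamma> s)))) (B *v w)"
    using P(2) by (rule polymap_jacobian[where a = c]) (rule that)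
  \<comment> \<open>The images of the lines through the vertex are curves on the cone that start in \<open>c\<close>.\<close>
  define \<delta> where "\<delta> w \<sigma> = \<alpha> (g (\<beta> (\<sigma> *s w)))" for w \<sigma>
  have \<delta>0: "\<delta> w 0 = c" for w by (simp add: \<delta>_def c_def)
  have \<delta>Q: "\<delta> w \<sigma> \<in> quadric 0" if "w \<in> quadric 0" for w \<sigma>
    unfolding \<delta>_def by (intro I g \<beta>_ray that)
  have d\<delta>: "curve_deriv (\<delta> w) (A *v w)" if "w \<in> quadric 0" for w
    by (rule curve_deriv_cong[OF A[of "\<lambda>\<sigma>. \<sigma> *s w" w]]) (auto simp: curve_deriv_line \<delta>_def \<Phi>(2) \<beta>_ray[OF that])
  have "B ** A = mat 1"
  proof (rule cone_spans)
    fix w :: "complex^3" assume w: "w \<in> quadric 0"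
    have e: "\<alpha> (\<Psi> (\<beta> (\<delta> w \<sigma>))) = \<sigma> *s w" for \<sigma>
    proof -
      have b: "\<beta> (\<sigma> *s w) \<in> Y" by (rule \<beta>_ray[OF w])
      have "\<beta> (\<delta> w \<sigma>) = g (\<beta> (\<sigma> *s w))" unfolding \<delta>_def by (rule I(4)[OF g(3)[OF b]])
      then have "\<Psi> (\<beta> (\<delta> w \<sigma>)) = \<beta> (\<sigma> *s w)" using \<Psi>(2)[OF g(3)[OF b]] g(5)[OF b] by simp
      then show ?thesis using I(6)[OF cone_scale[OF w]] by simp
    qed
    have "curve_deriv (\<lambda>\<sigma>. \<sigma> *s w) (B *v (A *v w))"
      by (rule curve_deriv_cong[OF B[OF \<delta>0 d\<delta>[OF w]] e])
    then show "(B ** A) *v w = mat 1 *v w"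
      using curve_deriv_unique[OF _ curve_deriv_line] by (simp add: matrix_vector_mul_assoc[symmetric])
  qed
  then have AB: "A ** B = mat 1" by (rule matrix_left_right_inverse[THEN iffD1])
  \<comment> \<open>Each row is the gradient of the equation of the cone at \<open>c\<close>.\<close>
  define R :: "complex^3^3" where "R = (\<chi> i. vector [- 4 * c $ 2, - 4 * c $ 1, 2 * c $ 3])"
  have R: "(R *v v) $ i = 2 * c $ 3 * v $ 3 - 4 * (c $ 1 * v $ 2 + c $ 2 * v $ 1)" for v i
    by (simp add: R_def matrix_vector_mult_def sum_3 algebra_simps)
  have "R ** A = 0"
  proof (rule cone_spans)
    fix w :: "complex^3" assume w: "w \<in> quadric 0"
    have d: "((\<lambda>s. \<delta> w s $ i) has_field_derivative (A *v w) $ i) (at 0)" for i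
      using d\<delta>[OF w] by (simp add: curve_deriv_def)
    have "((\<lambda>s. (\<delta> w s $ 3)\<^sup>2 - 4 * \<delta> w s $ 1 * \<delta> w s $ 2) has_field_derivative (R *v (A *v w)) $ i) (at 0)" for i
      unfolding R by (auto intro!: derivative_eq_intros d simp: \<delta>0 algebra_simps)
    moreover have "(\<delta> w s $ 3)\<^sup>2 - 4 * \<delta> w s $ 1 * \<delta> w s $ 2 = 0" for s
      using \<delta>Q[OF w, of s] by (simp add: quadric_def)
    ultimately have "((\<lambda>s. 0) has_field_derivative (R *v (A *v w)) $ i) (at 0)" for i by simp
    then have "(R *v (A *v w)) $ i = 0" for i using DERIV_unique[OF _ DERIV_const] by blast
    then show "(R ** A) *v w = 0 *v w"
      by (simp add: matrix_vector_mul_assoc[symmetric] vec_eq_iff)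
  qed
  then have "R ** (A ** B) = 0" unfolding matrix_mul_assoc by simp
  then have "R = 0" by (simp add: AB)
  then have "c = 0" by (simp add: R_def vec_eq_iff forall_3)
  then show ?thesis using I(4)[OF g(3)[OF I(5)[OF 0]]] by (simp add: c_def)
qed

lemma \<rho>_curve:
  assumes g: "g \<in> carrier (Aut Y)"
    and \<delta>: "\<And>\<sigma>. \<delta> \<sigma> \<in> quadric 0" "\<delta> 0 = 0" "curve_deriv \<delta> v"
  shows "curve_deriv (\<lambda>\<sigma>. \<alpha> (g (\<beta> (\<delta> \<sigma>)))) (\<rho> g *v v)"
proof -
  obtain k where "g \<in> poly_maps Y k" using g by (auto simp: Aut_def aut_points_def)
  from J\<alpha>[OF _ vertex_jac_curve[OF this \<delta>]] show ?thesis
    by (simp add: \<delta>(2) vertex_fixed[OF g] \<rho>_def matrix_vector_mul_assoc)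
qed

lemma \<rho>_eqI:
  assumes "g \<in> carrier (Aut Y)"
    and "\<And>w. w \<in> quadric 0 \<Longrightarrow> curve_deriv (\<lambda>\<sigma>. \<alpha> (g (\<beta> (\<sigma> *s w)))) (M *v w)"
  shows "\<rho> g = M"
proof (rule cone_spans)
  fix w :: "complex^3" assume w: "w \<in> quadric 0"
  show "\<rho> g *v w = M *v w"
    by (rule curve_deriv_unique[OF \<rho>_curve[OF assms(1)] assms(2)[OF w]]) (auto intro: cone_scale w curve_deriv_line)
qed

text \<open>
  The chain rule, which needs that the vertex is fixed.
\<close>

lemma \<rho>_compose:
  assumes g: "g \<in> carrier (Aut Y)" "h \<in> carrier (Aut Y)"
  shows "\<rho> (compose Y g h) = \<rho> g ** \<rho> h"
proof (rule \<rho>_eqI)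
  note I = poly_isoD[OF iso]
  show "compose Y g h \<in> carrier (Aut Y)"
    using monoid.m_closed[OF group.is_monoid[OF group_Aut] g] mult_Aut g[THEN carrier_Aut] by metis
  fix w :: "complex^3" assume w: "w \<in> quadric 0"
  have h: "h p \<in> Y" if "p \<in> Y" for p using carrier_Aut[OF g(2)] that by (auto simp: Bij_def bij_betw_def)
  let ?\<delta> = "\<lambda>\<sigma>. \<alpha> (h (\<beta> (\<sigma> *s w)))"
  have 0: "(0 :: complex^3) \<in> quadric 0" by (simp add: quadric_def)
  have d: "curve_deriv ?\<delta> (\<rho> h *v w)"
    by (rule \<rho>_curve[OF g(2)]) (auto intro: cone_scale w curve_deriv_line)
  have "curve_deriv (\<lambda>\<sigma>. \<alpha> (g (\<beta> (?\<delta> \<sigma>)))) (\<rho> g *v (\<rho> h *v w))"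
  proof (rule \<rho>_curve[OF g(1) _ _ d])
    show "?\<delta> \<sigma> \<in> quadric 0" for \<sigma> by (intro I h \<beta>_ray w)
    show "?\<delta> 0 = 0" by (simp add: vertex_fixed[OF g(2)] I(6)[OF 0])
  qed
  then have "curve_deriv (\<lambda>\<sigma>. \<alpha> (compose Y g h (\<beta> (\<sigma> *s w)))) (\<rho> g *v (\<rho> h *v w))"
    by (rule curve_deriv_cong) (simp add: compose_def \<beta>_ray[OF w] I(4)[OF h[OF \<beta>_ray[OF w]]])
  then show "curve_deriv (\<lambda>\<sigma>. \<alpha> (compose Y g h (\<beta> (\<sigma> *s w)))) ((\<rho> g ** \<rho> h) *v w)"
    by (simp add: matrix_vector_mul_assoc)
qed

lemma \<rho>_one: "\<rho> (\<lambda>x\<in>Y. x) = mat 1"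
proof (rule \<rho>_eqI)
  show "(\<lambda>x\<in>Y. x) \<in> carrier (Aut Y)"
    using monoid.one_closed[OF group.is_monoid[OF group_Aut]] by (metis U_simps(4))
  fix w :: "complex^3" assume w: "w \<in> quadric 0"
  show "curve_deriv (\<lambda>\<sigma>. \<alpha> ((\<lambda>x\<in>Y. x) (\<beta> (\<sigma> *s w)))) (mat 1 *v w)"
    using curve_deriv_line[of w] by (simp add: \<beta>_ray[OF w] poly_isoD(6)[OF iso cone_scale[OF w]])
qed

lemma \<rho>_nontrivial: "\<exists>g\<in>carrier (U Y). \<rho> g \<noteq> mat 1"
proof -
  note I = poly_isoD[OF iso]
  have a: "additive_action Y (lift_action \<alpha> \<beta> (shear 0))" by (rule lift_action[OF iso shear_action])
  let ?g = "restrict (lift_action \<alpha> \<beta> (shear 0) 1) Y"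
  have "\<rho> ?g \<noteq> mat 1"
  proof
    assume 1: "\<rho> ?g = mat 1"
    let ?w = "vector [1, 0, 0] :: complex^3"
    note w = cone_basis(1)
    have "curve_deriv (\<lambda>\<sigma>. \<alpha> (?g (\<beta> (\<sigma> *s ?w)))) (\<rho> ?g *v ?w)"
      by (rule \<rho>_curve[OF additive_action_carrier[OF a]]) (auto intro: cone_scale w curve_deriv_line)
    moreover have "\<alpha> (?g (\<beta> (\<sigma> *s ?w))) = \<sigma> *s vector [1, 1, 2]" for \<sigma>
    proof -
      have "\<alpha> (?g (\<beta> (\<sigma> *s ?w))) = shear 0 1 (\<sigma> *s ?w)"
        using \<beta>_ray[OF w] additive_actionD(1)[OF shear_action cone_scale[OF w]] cone_scale[OF w]
        by (simp add: lift_action_def I)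
      also have "\<dots> = \<sigma> *s vector [1, 1, 2]" by (simp add: shear_def vec_eq_iff forall_3)
      finally show ?thesis .
    qed
    ultimately have "curve_deriv (\<lambda>\<sigma>. \<sigma> *s vector [1, 1, 2]) ?w" by (simp add: 1)
    then have "?w = vector [1, 1, 2]" using curve_deriv_unique[OF _ curve_deriv_line] by blast
    then show False by (simp add: vec_eq_iff forall_3)
  qed
  then show ?thesis using additive_action_U[OF a] by blast
qed

text \<open>
  The entries of \<open>\<rho>\<close> are linear functionals of the automorphism.
\<close>

lemma \<rho>_reg: "\<exists>f\<in>regs (stage (U Y) k). \<forall>g\<in>points (stage (U Y) k). \<rho> g $ i $ j = f g"
proof -
  let ?PM = "poly_maps_variety Y k" and ?\<rho> = "\<lambda>f. \<rho> f $ i $ j"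
  let ?l = "restrict ?\<rho> (poly_maps Y k)" and ?PP = "poly_maps Y k \<times> poly_maps Y k"
  have "?l \<in> regs ?PM"
    unfolding poly_maps_variety_def regs_variety_gen
    using linear_functional_\<rho>[of k i j] by (blast intro: is_poly_gen)
  then have h: "restrict (\<lambda>x. ?l (fst x)) ?PP \<in> regs (prod_variety ?PM ?PM)"
    unfolding prod_variety_def regs_variety_gen
    by (auto simp: poly_maps_variety_def intro!: exI[of _ "\<lambda>x. ?l (fst x)"] is_poly_gen)
  let ?h = "\<lambda>g\<in>aut_points Y k. restrict (\<lambda>x. ?l (fst x)) ?PP (g, inv\<^bsub>BijGroup Y\<^esub> g)"
  have "?h \<in> regs (aut_stage Y k)" unfolding aut_stage_def using h by (simp only: variety.select_convs) blast
  then have "restrict ?h (aut_points Y k \<inter> carrier (U Y)) \<in> regs (stage (U Y) k)"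
    unfolding stage_U by blast
  moreover have "\<rho> g $ i $ j = restrict ?h (aut_points Y k \<inter> carrier (U Y)) g" if "g \<in> points (stage (U Y) k)" for g
    using that unfolding stage_U by (auto simp: aut_points_def)
  ultimately show ?thesis by blast
qed

end

section \<open>The two groups\<close>

theorem theorem1:
  fixes X :: "(complex^'n) set" and Y :: "(complex^'m) set"
  assumes "is_SL2_mod_T X" and "is_A2_mod_mu2 Y"
  shows "\<not> ind_group_isomorphic (U X) (U Y)"
proof
  assume "ind_group_isomorphic (U X) (U Y)"
  then obtain \<phi> where \<phi>: "\<phi> \<in> iso (U X) (U Y)" "ind_morphism (stage (U X)) (stage (U Y)) \<phi>"
    unfolding ind_group_isomorphic_def by blast
  obtain \<alpha> \<beta> where X: "poly_iso X \<alpha> (quadric 1) \<beta>" using is_SL2_mod_T_quadric[OF assms(1)] by blast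
  obtain \<gamma> \<delta> where Y: "poly_iso Y \<gamma> (quadric 0) \<delta>" using is_A2_mod_mu2_quadric[OF assms(2)] by blast
  obtain J :: "complex^'m^3" where J: "\<And>c w. c 0 = \<delta> 0 \<Longrightarrow> curve_deriv c w \<Longrightarrow> curve_deriv (\<lambda>s. \<gamma> (c s)) (J *v w)"
    using poly_isoD(1)[OF Y] by (rule polymap_jacobian) (rule that)
  interpret Y: cone_model Y \<gamma> \<delta> J
    by unfold_locales (fact Y, fact J)
  have hom: "\<phi> \<in> hom (U X) (U Y)" and onto: "\<phi> ` carrier (U X) = carrier (U Y)"
    using \<phi>(1) by (auto simp: iso_def bij_betw_def)
  have \<phi>U: "\<phi> g \<in> carrier (U Y)" if "g \<in> carrier (U X)" for g using onto that by blast
  interpret X: stagewise_rep X \<alpha> \<beta> "\<lambda>g. Y.\<rho> (\<phi> g)"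
  proof
    show "poly_iso X \<alpha> (quadric 1) \<beta>" by (fact X)
    show "Y.\<rho> (\<phi> (g \<otimes>\<^bsub>U X\<^esub> h)) = Y.\<rho> (\<phi> g) ** Y.\<rho> (\<phi> h)"
      if "g \<in> carrier (U X)" "h \<in> carrier (U X)" for g h
      by (simp only: hom_mult[OF hom that] mult_U[OF that[THEN \<phi>U]] Y.\<rho>_compose[OF that[THEN \<phi>U, THEN carrier_U]])
    have "\<phi> \<one>\<^bsub>U X\<^esub> = \<one>\<^bsub>U Y\<^esub>" by (rule hom_one[OF hom group_U group_U])
    then show "Y.\<rho> (\<phi> \<one>\<^bsub>U X\<^esub>) = mat 1" using Y.\<rho>_one unfolding U_simps(3) by simp
    show "\<exists>f\<in>regs (stage (U X) k). \<forall>g\<in>points (stage (U X) k). Y.\<rho> (\<phi> g) $ i $ j = f g" for k i j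
    proof -
      obtain l where l: "morphism (stage (U X) k) (stage (U Y) l) \<phi>"
        using \<phi>(2) unfolding ind_morphism_def by blast
      obtain f where f: "f \<in> regs (stage (U Y) l)" "\<And>g. g \<in> points (stage (U Y) l) \<Longrightarrow> Y.\<rho> g $ i $ j = f g"
        using Y.\<rho>_reg[of l i j] by blast
      have "compose (points (stage (U X) k)) f \<phi> \<in> regs (stage (U X) k)"
        using l f(1) unfolding morphism_def by blast
      moreover have "Y.\<rho> (\<phi> g) $ i $ j = compose (points (stage (U X) k)) f \<phi> g"
        if "g \<in> points (stage (U X) k)" for g
        using l f(2)[of "\<phi> g"] that unfolding morphism_def by (auto simp: compose_def)
      ultimately show ?thesis by blast
    qed
  qed
  obtain h where h: "h \<in> carrier (U Y)" "Y.\<rho> h \<noteq> mat 1" using Y.\<rho>_nontrivial by blast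
  then obtain g where "g \<in> carrier (U X)" "h = \<phi> g" using onto by blast
  then show False using X.\<psi>_trivial h(2) by simp
qed

end
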